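(* Let $d\geq1$ and $1<q\leq\infty$. Then there exist $c>0$ and $C>0$ such that for all $\lambda\geq1$, all $\Omega\in L^q(\mathbb{S}^{2d-1})$ and every choice of indices with $\{l_1,l_2,l_3\}=\{1,2,3\}$, $$|\langle T^0_\Omega(f_1,f_2),f_3\rangle|\leq C\lambda^{-c}\|\Omega\|_{L^q(\mathbb{S}^{2d-1})}\|f_{l_1}\|_{L^{2}(\mathbb{R}^d)}\|f_{l_2}\|_{L^{2}(\mathbb{R}^d)}\|f_{l_3}\|_{L^{\infty}(\mathbb{R}^d)},$$ whenever $f_{l_1},f_{l_2}\in L^2(\mathbb{R}^d)$ and $f_{l_3}\in L^\infty(\mathbb{R}^d)$ satisfy $\operatorname{supp}\widehat{f_{l_1}}\cup\operatorname{supp}\widehat{f_{l_2}}\subset\{\lambda\leq|\xi|\leq2\lambda\}$ and $\operatorname{supp}\widehat{f_{l_3}}\subset\{|\xi|\leq2\lambda\}$.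
   Context: $\beta\in C_c^\infty(\mathbb{R})$ is a fixed function with $\operatorname{supp}\beta\subset(2^{-1},2)$; constants may depend on $d,q,\beta$ but not on $\lambda,\Omega,f_1,f_2,f_3$. For $y_1,y_2\in\mathbb{R}^d$, $$K^0(y_1,y_2)=\Omega\left(\frac{(y_1,y_2)}{|(y_1,y_2)|}\right)|(y_1,y_2)|^{-2d}\beta(|(y_1,y_2)|),$$ $$T^0_\Omega(f_1,f_2)(x)=\int_{\mathbb{R}^{2d}}K^0(y_1,y_2)f_1(x-y_1)f_2(x-y_2)\,dy_1dy_2.$$ $\langle f,g\rangle=\int_{\mathbb{R}^d}f\,\overline{g}$, and $\widehat f$ is the Fourier transform (in the sense of tempered distributions), $\widehat f(\xi)=\int f(x)e^{-2\pi i x\cdot\xi}dx$. *)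

theory Defs
  imports "HOL-Analysis.Analysis" "HOL-Probability.Essential_Supremum"
begin

section \<open>Lebesgue spaces with exponent in (0, \<open>\<infinity>\<close>]\<close>

text \<open>
  Elements of \<open>L\<^sup>p\<close> are represented by measurable functions. For \<open>lborel\<close> these are the Borel
  functions; since every class modulo null sets has a Borel representative and every quantity
  below depends only on the class, nothing is lost compared with Lebesgue measurability.
\<close>

definition eLp_norm :: "ennreal \<Rightarrow> 'a measure \<Rightarrow> ('a \<Rightarrow> complex) \<Rightarrow> ennreal" where
  "eLp_norm p M f =
     (if p = \<infinity> then esssup M (\<lambda>x. ennreal (norm (f x)))
      else let I = (\<integral>\<^sup>+ x. ennreal (norm (f x) powr enn2real p) \<partial>M)
           in if I = \<infinity> then \<infinity> else ennreal (enn2real I powr (1 / enn2real p)))"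

definition Lp_space :: "ennreal \<Rightarrow> 'a measure \<Rightarrow> ('a \<Rightarrow> complex) set" where
  "Lp_space p M = {f \<in> borel_measurable M. eLp_norm p M f < \<infinity>}"

definition Lp_norm :: "ennreal \<Rightarrow> 'a measure \<Rightarrow> ('a \<Rightarrow> complex) \<Rightarrow> real" where
  "Lp_norm p M f = enn2real (eLp_norm p M f)"

definition L2_pairing :: "('a::euclidean_space \<Rightarrow> complex) \<Rightarrow> ('a \<Rightarrow> complex) \<Rightarrow> complex" where
  "L2_pairing f g = (\<integral> x. f x * cnj (g x) \<partial>lborel)"


section \<open>Surface measure on the unit sphere\<close>

text \<open>
  The surface measure of \<open>A\<close> is the dimension times the Lebesgue measure of the cone
  \<open>{r \<theta> | 0 < r < 1, \<theta> \<in> A}\<close>; this is the measure that occurs in the polar coordinate formula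
  \<open>dx = r\<^sup>n\<^sup>-\<^sup>1 dr d\<sigma>(\<theta>)\<close> with \<open>n = DIM('a)\<close>. The underlying space is the sphere itself, so the values
  of a function off the sphere do not matter.
\<close>

definition sphere_measure :: "'a::euclidean_space measure" where
  "sphere_measure =
     scale_measure (of_nat DIM('a))
       (distr (restrict_space lborel (ball 0 1 - {0})) (restrict_space borel (sphere 0 1)) sgn)"

lemma space_sphere_measure: "space (sphere_measure :: 'a::euclidean_space measure) = sphere 0 1"
  by (simp add: sphere_measure_def space_scale_measure space_restrict_space)

lemma sets_sphere_measure:
  "sets (sphere_measure :: 'a::euclidean_space measure) = sets (restrict_space borel (sphere 0 1))"
  by (simp add: sphere_measure_def)

lemma emeasure_sphere_measure:
  fixes A :: "'a::euclidean_space set"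
  assumes A: "A \<in> sets borel" "A \<subseteq> sphere 0 1"
  shows "emeasure sphere_measure A =
    of_nat DIM('a) * emeasure lborel {r *\<^sub>R \<theta> | r \<theta>. 0 < r \<and> r < 1 \<and> \<theta> \<in> A}"
proof -
  let ?B = "ball 0 1 - {0} :: 'a set"
  have B: "?B \<in> sets borel" by simp
  have meas: "sgn \<in> restrict_space lborel ?B \<rightarrow>\<^sub>M restrict_space borel (sphere (0::'a) 1)"
  proof (rule measurable_restrict_space2)
    show "sgn \<in> space (restrict_space lborel ?B) \<rightarrow> sphere 0 1"
      by (auto simp: space_restrict_space norm_sgn)
    have "(\<lambda>x::'a. x /\<^sub>R norm x) \<in> borel_measurable borel" by measurable
    then have "(sgn :: 'a \<Rightarrow> 'a) \<in> borel_measurable lborel"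
      by (simp add: sgn_div_norm[abs_def])
    then show "sgn \<in> borel_measurable (restrict_space lborel ?B)"
      by (rule measurable_restrict_space1)
  qed
  have A': "A \<in> sets (restrict_space borel (sphere 0 1))"
    using A by (auto simp: sets_restrict_space_iff)
  have eq: "sgn -` A \<inter> ?B = {r *\<^sub>R \<theta> | r \<theta>. 0 < r \<and> r < 1 \<and> \<theta> \<in> A}"
  proof (intro set_eqI iffI)
    fix x assume "x \<in> sgn -` A \<inter> ?B"
    moreover have "x = norm x *\<^sub>R sgn x" by (cases "x = 0") (simp_all add: sgn_div_norm)
    ultimately show "x \<in> {r *\<^sub>R \<theta> | r \<theta>. 0 < r \<and> r < 1 \<and> \<theta> \<in> A}"
      by (auto intro!: exI[of _ "norm x"] exI[of _ "sgn x"])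
  next
    fix x assume "x \<in> {r *\<^sub>R \<theta> | r \<theta>. 0 < r \<and> r < 1 \<and> \<theta> \<in> A}"
    then obtain r \<theta> where x: "x = r *\<^sub>R \<theta>" "0 < r" "r < 1" "\<theta> \<in> A" by blast
    with A(2) have n: "norm \<theta> = 1" by auto
    then show "x \<in> sgn -` A \<inter> ?B"
      using x by (auto simp: sgn_div_norm)
  qed
  have "emeasure (sphere_measure :: 'a measure) A =
      of_nat DIM('a) * emeasure (restrict_space lborel ?B)
        (sgn -` A \<inter> space (restrict_space lborel ?B))"
    unfolding sphere_measure_def by (simp add: emeasure_distr[OF meas A'])
  also have "sgn -` A \<inter> space (restrict_space lborel ?B) = sgn -` A \<inter> ?B"
    by (simp add: space_restrict_space)
  also have "emeasure (restrict_space lborel ?B) \<dots> = emeasure lborel (sgn -` A \<inter> ?B)"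
    by (rule emeasure_restrict_space) (use B in auto)
  finally show ?thesis by (simp add: eq)
qed


section \<open>Test functions and the Fourier support\<close>

fun iter_partial :: "'a list \<Rightarrow> ('a::euclidean_space \<Rightarrow> complex) \<Rightarrow> 'a \<Rightarrow> complex" where
  "iter_partial [] f = f"
| "iter_partial (b # bs) f = (\<lambda>x. frechet_derivative (iter_partial bs f) (at x) b)"

definition smooth :: "('a::euclidean_space \<Rightarrow> complex) \<Rightarrow> bool" where
  "smooth f \<longleftrightarrow> (\<forall>bs \<in> lists Basis. \<forall>x. iter_partial bs f differentiable (at x))"

definition fun_support :: "('a::euclidean_space \<Rightarrow> complex) \<Rightarrow> 'a set" where
  "fun_support f = closure (support_on UNIV f)"

definition test_functions :: "('a::euclidean_space \<Rightarrow> complex) set" where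
  "test_functions = {\<phi>. smooth \<phi> \<and> compact (fun_support \<phi>)}"

definition fourier :: "('a::euclidean_space \<Rightarrow> complex) \<Rightarrow> 'a \<Rightarrow> complex" where
  "fourier \<phi> \<xi> = (\<integral> x. \<phi> x * exp (- 2 * of_real pi * \<i> * of_real (x \<bullet> \<xi>)) \<partial>lborel)"

text \<open>
  A tempered distribution is represented by the functional \<open>u\<close> it defines on Schwartz functions.
  The Fourier transform is defined by duality. The support of a tempered distribution is its
  support as a distribution, that is, the complement of the largest open set such that the
  distribution vanishes on all test functions supported in that set.
\<close>

definition regular_dist ::
  "('a::euclidean_space \<Rightarrow> complex) \<Rightarrow> ('a \<Rightarrow> complex) \<Rightarrow> complex" where
  "regular_dist f \<phi> = (\<integral> x. f x * \<phi> x \<partial>lborel)"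

definition fourier_dist ::
  "(('a::euclidean_space \<Rightarrow> complex) \<Rightarrow> complex) \<Rightarrow> ('a \<Rightarrow> complex) \<Rightarrow> complex" where
  "fourier_dist u \<phi> = u (fourier \<phi>)"

definition dist_support :: "(('a::euclidean_space \<Rightarrow> complex) \<Rightarrow> complex) \<Rightarrow> 'a set" where
  "dist_support u =
     - \<Union> {U. open U \<and> (\<forall>\<phi> \<in> test_functions. fun_support \<phi> \<subseteq> U \<longrightarrow> u \<phi> = 0)}"

definition fourier_support :: "('a::euclidean_space \<Rightarrow> complex) \<Rightarrow> 'a set" where
  "fourier_support f = dist_support (fourier_dist (regular_dist f))"


section \<open>The bilinear operator\<close>

definition K0 ::
  "(real \<Rightarrow> complex) \<Rightarrow> ('a \<times> 'a \<Rightarrow> complex) \<Rightarrow> 'a::euclidean_space \<times> 'a \<Rightarrow> complex" where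
  "K0 \<beta> \<Omega> y = \<Omega> (y /\<^sub>R norm y) * of_real (norm y powr (- 2 * real DIM('a))) * \<beta> (norm y)"

definition T0 ::
  "(real \<Rightarrow> complex) \<Rightarrow> ('a \<times> 'a \<Rightarrow> complex) \<Rightarrow>
   ('a::euclidean_space \<Rightarrow> complex) \<Rightarrow> ('a \<Rightarrow> complex) \<Rightarrow> 'a \<Rightarrow> complex" where
  "T0 \<beta> \<Omega> f1 f2 x = (\<integral> (y1, y2). K0 \<beta> \<Omega> (y1, y2) * f1 (x - y1) * f2 (x - y2) \<partial>lborel)"

end

theory Submission
  imports Defs "HOL-Probability.Characteristic_Functions" "HOL-Real_Asymp.Real_Asymp"
begin

text \<open>
  One of the first two functions is square integrable with frequencies of size at least \<open>\<lambda>\<close>. Exchanging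
  the two variables of the kernel if necessary, let it be the first one, \<open>f\<close>. The other two functions
  \<open>g\<close>, \<open>h\<close> enter only through norms of products of translates (\<open>l2_pair\<close>), which treats all
  positions of the bounded function alike.

  Truncating \<open>\<Omega>\<close> at the height \<open>\<lambda>\<close>^(1/16) times its norm splits the kernel into a part of small mass, for
  which the trivial bound (\<open>trilinear_bound\<close>) suffices, and a bounded part. It is therefore enough to gain
  \<open>\<lambda>\<close>^(-1/8) for bounded kernels \<open>K\<close> of compact support with \<open>\<bar>fourier K \<zeta>\<bar> = O(\<bar>\<zeta>\<bar>\<close>^(-1/2)\<open>)\<close>. This decay
  comes from the smooth radial part of the kernel (\<open>hom_kernel_fourier_decay\<close>).

  The frequency condition enters through one identity: \<open>f * D = 0\<close> for a nonnegative function \<open>D\<close> of mass 1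
  that is concentrated at scale \<open>1/\<lambda>\<close> and has frequencies of size at most \<open>\<lambda>/2\<close>
  (\<open>lowpass_orthogonal\<close>). If \<open>\<phi>\<close> is the restriction of \<open>D\<close> to the unit ball, then \<open>f * \<phi>\<close> has norm
  \<open>O(1/\<lambda>)\<close>, and \<open>f\<close> can be replaced by \<open>f - f * \<phi>\<close>. Since \<open>K\<close> and \<open>\<phi>\<close> have compact support, the trilinear form
  of \<open>f - f * \<phi>\<close>, \<open>g\<close>, \<open>h\<close> is an average of forms of localised functions (\<open>trilinear_localize\<close>), and on balls
  bounded functions are square integrable. What remains is a bound by three \<open>L\<^sup>2\<close> norms for the function
  \<open>f' - f' * \<phi>\<close> with \<open>f'\<close> of compact support. Its Fourier transform is small at frequencies below
  \<open>R = \<lambda>\<close>^(1/2).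

  For this bound (\<open>trilinear_split\<close>, \<open>trilinear_decay\<close>) let \<open>M(\<xi>)\<^sup>2\<close> be the integral over \<open>w\<close> of the square of
  the Fourier transform of the slice \<open>K(\<cdot>, w)\<close> at \<open>\<xi>\<close>; by Bessel's inequality \<open>M\<^sup>2\<close> is integrable. On the set
  \<open>S\<close> of frequencies with \<open>\<bar>\<xi>\<bar> \<ge> R\<close> and \<open>M(\<xi>) > \<tau> = \<lambda>\<close>^(-1/8), which has measure \<open>O(\<tau>\<close>^(-2)\<open>)\<close>, each character
  separately gives a convolution operator in \<open>g\<close> of norm \<open>O(R\<close>^(-1/2)\<open>)\<close>. Outside \<open>S\<close> a Hilbert-Schmidt
  norm is small. Both contributions are \<open>O(\<lambda>\<close>^(-1/8)\<open>)\<close>.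

  If \<open>\<beta> = 0\<close> there is nothing to prove. Otherwise \<open>\<bar>\<beta>\<bar>\<^sup>2\<close> supplies the test functions that exploit the
  condition on the Fourier support (\<open>bump_exists\<close>).
\<close>

section \<open>The character exp(2 \<pi> i t)\<close>

definition ee :: "real \<Rightarrow> complex" where
  "ee t = exp (2 * of_real pi * \<i> * of_real t)"

lemma ee_cis: "ee t = cis (2 * pi * t)"
  by (simp add: ee_def cis_conv_exp algebra_simps)

lemma norm_ee [simp]: "cmod (ee t) = 1"
  by (simp add: ee_cis)

lemma ee_0 [simp]: "ee 0 = 1"
  by (simp add: ee_def)

lemma ee_add: "ee (s + t) = ee s * ee t"
  by (simp add: ee_cis cis_mult algebra_simps)

lemma cnj_ee [simp]: "cnj (ee t) = ee (- t)"
  by (simp add: ee_cis cis_cnj)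

lemma ee_minus_mult [simp]: "ee (- t) * ee t = 1" "ee t * ee (- t) = 1"
  by (simp_all flip: ee_add)

lemma continuous_ee: "continuous_on A ee"
  unfolding ee_def by (intro continuous_intros)

lemma measurable_ee [measurable]: "ee \<in> borel_measurable borel"
  by (intro borel_measurable_continuous_onI continuous_ee)

lemma ee_diff_1_power2: "(cmod (ee t - 1))\<^sup>2 = 4 * (sin (pi * t))\<^sup>2"
proof -
  have "(cmod (cis (2*pi*t) - 1))\<^sup>2 = (cos (2*pi*t) - 1)\<^sup>2 + (sin (2*pi*t))\<^sup>2"
    by (simp add: cmod_power2)
  also have "\<dots> = 2 - 2 * cos (2 * (pi * t))"
    using sin_cos_squared_add[of "2*pi*t"] by (simp add: power2_eq_square algebra_simps)
  also have "\<dots> = 4 * (sin (pi * t))\<^sup>2"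
    by (simp only: cos_double_sin) simp
  finally show ?thesis by (simp add: ee_cis)
qed

lemma ee_diff_1_le: "cmod (ee t - 1) \<le> 2 * pi * \<bar>t\<bar>"
proof -
  have "(cmod (ee t - 1))\<^sup>2 \<le> 4 * (pi * t)\<^sup>2"
    using abs_sin_x_le_abs_x[of "pi * t"] by (simp add: ee_diff_1_power2 abs_le_square_iff)
  also have "\<dots> = (2 * pi * \<bar>t\<bar>)\<^sup>2" by (simp add: power_mult_distrib)
  finally show ?thesis by (rule power2_le_imp_le) simp
qed

lemma fourier_ee: "fourier f \<xi> = (\<integral>x. f x * ee (- (x \<bullet> \<xi>)) \<partial>lborel)"
  by (simp add: fourier_def ee_def)

section \<open>Affine changes of variable and Fubini for Lebesgue measure\<close>

lemma nn_integral_lborel_affine: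
  fixes f :: "'a::euclidean_space \<Rightarrow> ennreal"
  assumes [measurable]: "f \<in> borel_measurable borel" and "c \<noteq> 0"
  shows "(\<integral>\<^sup>+x. f x \<partial>lborel) = ennreal (\<bar>c\<bar> ^ DIM('a)) * (\<integral>\<^sup>+x. f (t + c *\<^sub>R x) \<partial>lborel)"
  by (subst lborel_affine[OF \<open>c \<noteq> 0\<close>, of t])
     (simp add: nn_integral_density nn_integral_distr nn_integral_cmult)

lemma nn_integral_lborel_translate:
  fixes f :: "'a::euclidean_space \<Rightarrow> ennreal"
  assumes [measurable]: "f \<in> borel_measurable borel"
  shows "(\<integral>\<^sup>+x. f (t + x) \<partial>lborel) = (\<integral>\<^sup>+x. f x \<partial>lborel)"
    "(\<integral>\<^sup>+x. f (x + t) \<partial>lborel) = (\<integral>\<^sup>+x. f x \<partial>lborel)"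
    "(\<integral>\<^sup>+x. f (x - t) \<partial>lborel) = (\<integral>\<^sup>+x. f x \<partial>lborel)"
    "(\<integral>\<^sup>+x. f (t - x) \<partial>lborel) = (\<integral>\<^sup>+x. f x \<partial>lborel)"
  using nn_integral_lborel_affine[of f 1 t] nn_integral_lborel_affine[of f 1 "-t"]
    nn_integral_lborel_affine[of f "-1" t]
  by (simp_all add: add.commute)

lemma integrable_lborel_affine:
  fixes f :: "'a::euclidean_space \<Rightarrow> 'b::{banach, second_countable_topology}"
  assumes f: "integrable lborel f" and c: "c \<noteq> 0"
  shows "integrable lborel (\<lambda>x. f (t + c *\<^sub>R x))"
  using f f[THEN borel_measurable_integrable] c unfolding integrable_iff_bounded
  by (subst (asm) nn_integral_lborel_affine[where c=c and t=t]) (auto simp: ennreal_mult_less_top)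

lemma integrable_lborel_affine_iff:
  fixes f :: "'a::euclidean_space \<Rightarrow> 'b::{banach, second_countable_topology}"
  assumes c: "c \<noteq> 0"
  shows "integrable lborel (\<lambda>x. f (t + c *\<^sub>R x)) \<longleftrightarrow> integrable lborel f"
proof
  assume "integrable lborel (\<lambda>x. f (t + c *\<^sub>R x))"
  from integrable_lborel_affine[OF this, of "inverse c" "inverse c *\<^sub>R (- t)"] c
  show "integrable lborel f" by (simp add: scaleR_right_diff_distrib)
qed (rule integrable_lborel_affine[OF _ c])

lemma integral_lborel_affine:
  fixes f :: "'a::euclidean_space \<Rightarrow> 'b::{banach, second_countable_topology}"
  assumes c: "c \<noteq> 0"
  shows "(\<integral>x. f x \<partial>lborel) = (\<bar>c\<bar> ^ DIM('a)) *\<^sub>R (\<integral>x. f (t + c *\<^sub>R x) \<partial>lborel)"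
proof cases
  assume f[measurable]: "integrable lborel f" then show ?thesis
    using c f f[THEN borel_measurable_integrable] integrable_lborel_affine[OF f c, of t]
    by (subst lborel_affine[OF c, of t])
       (simp add: integral_density integral_distr)
next
  assume "\<not> integrable lborel f" with c show ?thesis
    by (simp add: integrable_lborel_affine_iff not_integrable_integral_eq)
qed

lemma integral_lborel_translate:
  fixes f :: "'a::euclidean_space \<Rightarrow> 'b::{banach, second_countable_topology}"
  shows "(\<integral>x. f (t + x) \<partial>lborel) = (\<integral>x. f x \<partial>lborel)"
    "(\<integral>x. f (x + t) \<partial>lborel) = (\<integral>x. f x \<partial>lborel)"
    "(\<integral>x. f (x - t) \<partial>lborel) = (\<integral>x. f x \<partial>lborel)"
    "(\<integral>x. f (t - x) \<partial>lborel) = (\<integral>x. f x \<partial>lborel)"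
  using integral_lborel_affine[of 1 f t] integral_lborel_affine[of 1 f "-t"]
    integral_lborel_affine[of "-1" f t]
  by (simp_all add: add.commute)

lemma integrable_lborel_translate:
  fixes f :: "'a::euclidean_space \<Rightarrow> 'b::{banach, second_countable_topology}"
  assumes "integrable lborel f"
  shows "integrable lborel (\<lambda>x. f (t + x))" "integrable lborel (\<lambda>x. f (x + t))"
    "integrable lborel (\<lambda>x. f (x - t))" "integrable lborel (\<lambda>x. f (t - x))"
  using integrable_lborel_affine[OF assms, of 1 t] integrable_lborel_affine[OF assms, of 1 "-t"]
    integrable_lborel_affine[OF assms, of "-1" t]
  by (simp_all add: add.commute)

lemma integrable_lborel_pairI:
  fixes f :: "'a::euclidean_space \<Rightarrow> 'b::euclidean_space \<Rightarrow> 'c::{banach, second_countable_topology}"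
  assumes [measurable]: "case_prod f \<in> borel_measurable (borel \<Otimes>\<^sub>M borel)"
    and fin: "(\<integral>\<^sup>+x. \<integral>\<^sup>+y. ennreal (norm (f x y)) \<partial>lborel \<partial>lborel) < \<infinity>"
  shows "integrable (lborel \<Otimes>\<^sub>M lborel) (case_prod f)"
proof (rule integrableI_bounded)
  show "case_prod f \<in> borel_measurable (lborel \<Otimes>\<^sub>M lborel)" by measurable
  have "(\<integral>\<^sup>+ z. ennreal (norm (case_prod f z)) \<partial>(lborel \<Otimes>\<^sub>M lborel)) =
      (\<integral>\<^sup>+x. \<integral>\<^sup>+y. ennreal (norm (f x y)) \<partial>lborel \<partial>lborel)"
    by (subst lborel.nn_integral_fst[symmetric]) auto
  then show "(\<integral>\<^sup>+ z. ennreal (norm (case_prod f z)) \<partial>(lborel \<Otimes>\<^sub>M lborel)) < \<infinity>"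
    using fin by simp
qed

lemma nn_integral_lborel_swap:
  fixes f :: "'a::euclidean_space \<Rightarrow> 'b::euclidean_space \<Rightarrow> ennreal"
  assumes [measurable]: "case_prod f \<in> borel_measurable (borel \<Otimes>\<^sub>M borel)"
  shows "(\<integral>\<^sup>+x. \<integral>\<^sup>+y. f x y \<partial>lborel \<partial>lborel) = (\<integral>\<^sup>+y. \<integral>\<^sup>+x. f x y \<partial>lborel \<partial>lborel)"
  by (rule lborel_pair.Fubini'[symmetric]) simp

lemma
  fixes f :: "'a::euclidean_space \<Rightarrow> 'b::euclidean_space \<Rightarrow> 'c::{banach, second_countable_topology}"
  assumes [measurable]: "case_prod f \<in> borel_measurable (borel \<Otimes>\<^sub>M borel)"
    and fin: "(\<integral>\<^sup>+x. \<integral>\<^sup>+y. ennreal (norm (f x y)) \<partial>lborel \<partial>lborel) < \<infinity>"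
  shows integral_lborel_swap:
      "(\<integral>x. \<integral>y. f x y \<partial>lborel \<partial>lborel) = (\<integral>y. \<integral>x. f x y \<partial>lborel \<partial>lborel)"
    and integrable_lborel_fst: "integrable lborel (\<lambda>x. \<integral>y. f x y \<partial>lborel)"
    and integrable_lborel_snd: "integrable lborel (\<lambda>y. \<integral>x. f x y \<partial>lborel)"
    and AE_integrable_lborel_fst: "AE x in lborel. integrable lborel (f x)"
proof -
  note i = integrable_lborel_pairI[OF assms]
  show "(\<integral>x. \<integral>y. f x y \<partial>lborel \<partial>lborel) = (\<integral>y. \<integral>x. f x y \<partial>lborel \<partial>lborel)"
    by (rule lborel_pair.Fubini_integral[OF i, symmetric])
  show "integrable lborel (\<lambda>x. \<integral>y. f x y \<partial>lborel)" by (rule lborel_pair.integrable_fst[OF i])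
  show "integrable lborel (\<lambda>y. \<integral>x. f x y \<partial>lborel)" by (rule lborel_pair.integrable_snd[OF i])
  show "AE x in lborel. integrable lborel (f x)" by (rule lborel_pair.AE_integrable_fst[OF i])
qed

lemma integral_lborel_prod_Basis:
  fixes f :: "'a::euclidean_space \<Rightarrow> real \<Rightarrow> complex"
  assumes f: "\<And>b. b \<in> Basis \<Longrightarrow> integrable lborel (f b)"
  shows "(\<integral>x. (\<Prod>b\<in>Basis. f b (x \<bullet> b)) \<partial>lborel) = (\<Prod>b\<in>Basis. \<integral>t. f b t \<partial>lborel)"
    and "integrable lborel (\<lambda>x. (\<Prod>b\<in>Basis. f b (x \<bullet> b)))"
proof -
  interpret product_sigma_finite "\<lambda>_::'a. lborel :: real measure" ..
  have [measurable]: "b \<in> Basis \<Longrightarrow> f b \<in> borel_measurable borel" for b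
    using f[of b] by auto
  have T: "(\<lambda>f. \<Sum>b\<in>Basis. f b *\<^sub>R b) \<in> (\<Pi>\<^sub>M b\<in>Basis. lborel) \<rightarrow>\<^sub>M (borel :: 'a measure)"
    by measurable
  have eq: "(\<Prod>b\<in>Basis. f b ((\<Sum>b'\<in>Basis. g b' *\<^sub>R b') \<bullet> b)) = (\<Prod>b\<in>Basis. f b (g b))" for g
    by (intro prod.cong refl) (simp add: inner_sum_left_Basis)
  have m: "(\<lambda>x::'a. \<Prod>b\<in>Basis. f b (x \<bullet> b)) \<in> borel_measurable borel"
    by measurable
  show "(\<integral>x. (\<Prod>b\<in>Basis. f b (x \<bullet> b)) \<partial>lborel) = (\<Prod>b\<in>Basis. \<integral>t. f b t \<partial>lborel)"
    unfolding lborel_eq[where 'a='a]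
    by (subst integral_distr[OF T m]) (simp add: eq product_integral_prod f)
  show "integrable lborel (\<lambda>x. (\<Prod>b\<in>Basis. f b (x \<bullet> b)))"
    unfolding lborel_eq[where 'a='a]
    by (subst integrable_distr_eq[OF T m]) (simp add: eq product_integrable_prod f)
qed

section \<open>Functions with a bound for the square integral\<close>

lemma ennreal_power2_le_imp_le:
  fixes x :: ennreal
  assumes "x\<^sup>2 \<le> ennreal (r\<^sup>2)" "0 \<le> r"
  shows "x \<le> ennreal r"
proof (cases x)
  case (real s)
  with assms have "s\<^sup>2 \<le> r\<^sup>2" by (simp add: ennreal_power)
  then show ?thesis using real assms(2) by (auto intro!: ennreal_leI dest: power2_le_imp_le)
next
  case top
  with assms show ?thesis by (simp add: ennreal_power power2_eq_square ennreal_mult_top top_unique)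
qed

lemma norm_integral_le_nn_integral:
  fixes f :: "'b \<Rightarrow> 'c::{banach, second_countable_topology}"
  shows "ennreal (norm (\<integral>x. f x \<partial>M)) \<le> (\<integral>\<^sup>+x. ennreal (norm (f x)) \<partial>M)"
  by (cases "integrable M f") (auto intro: integral_norm_bound_ennreal simp: not_integrable_integral_eq)

lemma Cauchy_Schwarz_bound:
  fixes f g :: "'b \<Rightarrow> ennreal"
  assumes [measurable]: "f \<in> borel_measurable M" "g \<in> borel_measurable M"
    and "(\<integral>\<^sup>+x. (f x)\<^sup>2 \<partial>M) \<le> ennreal (a\<^sup>2)" "(\<integral>\<^sup>+x. (g x)\<^sup>2 \<partial>M) \<le> ennreal (b\<^sup>2)"
    and "0 \<le> a" "0 \<le> b"
  shows "(\<integral>\<^sup>+x. f x * g x \<partial>M) \<le> ennreal (a * b)"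
proof (rule ennreal_power2_le_imp_le)
  have "(\<integral>\<^sup>+x. f x * g x \<partial>M)\<^sup>2 \<le> (\<integral>\<^sup>+x. (f x)\<^sup>2 \<partial>M) * (\<integral>\<^sup>+x. (g x)\<^sup>2 \<partial>M)"
    by (rule Cauchy_Schwarz_nn_integral) auto
  also have "\<dots> \<le> ennreal (a\<^sup>2) * ennreal (b\<^sup>2)"
    using assms by (intro mult_mono) auto
  also have "\<dots> = ennreal ((a * b)\<^sup>2)" by (simp add: ennreal_mult power_mult_distrib)
  finally show "(\<integral>\<^sup>+x. f x * g x \<partial>M)\<^sup>2 \<le> ennreal ((a * b)\<^sup>2)" .
qed (use assms in auto)

text \<open>
  Estimates below carry upper bounds \<open>a\<close> for \<open>L\<^sup>2\<close> norms instead of the norms themselves. A product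
  of such bounds then needs neither square roots in the extended reals nor a separate proof of
  finiteness.
\<close>

definition l2_le :: "('a::euclidean_space \<Rightarrow> complex) \<Rightarrow> real \<Rightarrow> bool" where
  "l2_le f a \<longleftrightarrow> f \<in> borel_measurable borel \<and> 0 \<le> a \<and>
     (\<integral>\<^sup>+x. ennreal ((cmod (f x))\<^sup>2) \<partial>lborel) \<le> ennreal (a\<^sup>2)"

lemma l2_leD:
  assumes "l2_le f a"
  shows l2_le_measurable: "f \<in> borel_measurable borel" and l2_le_nonneg: "0 \<le> a"
    and l2_le_bound: "(\<integral>\<^sup>+x. ennreal ((cmod (f x))\<^sup>2) \<partial>lborel) \<le> ennreal (a\<^sup>2)"
    and l2_le_bound': "(\<integral>\<^sup>+x. (ennreal (cmod (f x)))\<^sup>2 \<partial>lborel) \<le> ennreal (a\<^sup>2)"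
  using assms by (auto simp: l2_le_def ennreal_power)

lemma l2_le_dominated:
  assumes g: "l2_le g a" and [measurable]: "f \<in> borel_measurable borel"
    and le: "\<And>x. cmod (f x) \<le> cmod (g x)"
  shows "l2_le f a"
proof -
  have "(\<integral>\<^sup>+x. ennreal ((cmod (f x))\<^sup>2) \<partial>lborel) \<le> (\<integral>\<^sup>+x. ennreal ((cmod (g x))\<^sup>2) \<partial>lborel)"
    by (intro nn_integral_mono ennreal_leI power_mono le) auto
  with g show ?thesis by (auto simp: l2_le_def)
qed

lemma l2_le_cmult:
  assumes "l2_le f a" shows "l2_le (\<lambda>x. c * f x) (cmod c * a)"
proof -
  note [measurable] = l2_le_measurable[OF assms]
  have "(\<integral>\<^sup>+x. ennreal ((cmod (c * f x))\<^sup>2) \<partial>lborel) =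
      ennreal ((cmod c)\<^sup>2) * (\<integral>\<^sup>+x. ennreal ((cmod (f x))\<^sup>2) \<partial>lborel)"
    by (simp add: norm_mult power_mult_distrib ennreal_mult nn_integral_cmult)
  also have "\<dots> \<le> ennreal ((cmod c)\<^sup>2) * ennreal (a\<^sup>2)"
    by (intro mult_left_mono l2_le_bound assms) auto
  finally show ?thesis
    using l2_le_nonneg[OF assms] by (simp add: l2_le_def power_mult_distrib ennreal_mult)
qed

lemma l2_le_affine:
  fixes f :: "'a::euclidean_space \<Rightarrow> complex"
  assumes "l2_le f a"
  shows "l2_le (\<lambda>x. f (x + v)) a" "l2_le (\<lambda>x. f (x - v)) a" "l2_le (\<lambda>x. f (v - x)) a"
proof -
  note [measurable] = l2_le_measurable[OF assms]
  have "(\<lambda>x. ennreal ((cmod (f x))\<^sup>2)) \<in> borel_measurable borel" by measurable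
  note nn_integral_lborel_translate[OF this, of v]
  then show "l2_le (\<lambda>x. f (x + v)) a" "l2_le (\<lambda>x. f (x - v)) a" "l2_le (\<lambda>x. f (v - x)) a"
    using assms unfolding l2_le_def by simp_all
qed

lemma l2_le_mult_nn_integral:
  assumes "l2_le f a" "l2_le g b"
  shows "(\<integral>\<^sup>+x. ennreal (cmod (f x) * cmod (g x)) \<partial>lborel) \<le> ennreal (a * b)"
proof -
  note [measurable] = assms[THEN l2_le_measurable]
  have "(\<integral>\<^sup>+x. ennreal (cmod (f x) * cmod (g x)) \<partial>lborel) =
      (\<integral>\<^sup>+x. ennreal (cmod (f x)) * ennreal (cmod (g x)) \<partial>lborel)"
    by (simp add: ennreal_mult)
  also have "\<dots> \<le> ennreal (a * b)"
    using assms by (intro Cauchy_Schwarz_bound) (auto simp: l2_le_bound' l2_le_nonneg)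
  finally show ?thesis .
qed

lemma l2_le_mult:
  assumes "l2_le f a" "l2_le g b"
  shows l2_le_integrable_mult: "integrable lborel (\<lambda>x. f x * g x)"
    and l2_le_integral_mult: "cmod (\<integral>x. f x * g x \<partial>lborel) \<le> a * b"
proof -
  note [measurable] = assms[THEN l2_le_measurable]
  have n: "(\<integral>\<^sup>+x. ennreal (cmod (f x * g x)) \<partial>lborel) \<le> ennreal (a * b)"
    using l2_le_mult_nn_integral[OF assms] by (simp add: norm_mult)
  then show "integrable lborel (\<lambda>x. f x * g x)"
    by (intro integrableI_bounded) (auto intro: le_less_trans)
  have "ennreal (cmod (\<integral>x. f x * g x \<partial>lborel)) \<le> ennreal (a * b)"
    using norm_integral_le_nn_integral n by (rule order_trans)
  then show "cmod (\<integral>x. f x * g x \<partial>lborel) \<le> a * b"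
    using assms[THEN l2_le_nonneg] by (simp add: ennreal_le_iff)
qed

lemma measurable_cnj [measurable]: "cnj \<in> borel_measurable borel"
  by (intro borel_measurable_continuous_onI continuous_on_cnj continuous_on_id)

lemma l2_le_cnj: "l2_le f a \<Longrightarrow> l2_le (\<lambda>x. cnj (f x)) a"
  by (rule l2_le_dominated) (auto simp: l2_le_def)

lemma l2_le_add:
  assumes "l2_le f a" "l2_le g b"
  shows "l2_le (\<lambda>x. f x + g x) (a + b)"
proof -
  note [measurable] = assms[THEN l2_le_measurable]
  have "(\<integral>\<^sup>+x. ennreal ((cmod (f x + g x))\<^sup>2) \<partial>lborel) \<le>
      (\<integral>\<^sup>+x. ennreal ((cmod (f x))\<^sup>2) + 2 * ennreal (cmod (f x) * cmod (g x)) + ennreal ((cmod (g x))\<^sup>2) \<partial>lborel)"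
  proof (intro nn_integral_mono)
    fix x
    have "(cmod (f x + g x))\<^sup>2 \<le> (cmod (f x) + cmod (g x))\<^sup>2"
      by (intro power_mono norm_triangle_ineq) auto
    also have "\<dots> = (cmod (f x))\<^sup>2 + 2 * (cmod (f x) * cmod (g x)) + (cmod (g x))\<^sup>2"
      by (simp add: power2_sum)
    finally have "ennreal ((cmod (f x + g x))\<^sup>2) \<le>
        ennreal ((cmod (f x))\<^sup>2 + 2 * (cmod (f x) * cmod (g x)) + (cmod (g x))\<^sup>2)" by (rule ennreal_leI)
    also have "\<dots> = ennreal ((cmod (f x))\<^sup>2) + 2 * ennreal (cmod (f x) * cmod (g x)) + ennreal ((cmod (g x))\<^sup>2)"
      by (simp add: ennreal_plus ennreal_mult)
    finally show "ennreal ((cmod (f x + g x))\<^sup>2) \<le> \<dots>" .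
  qed
  also have "\<dots> = (\<integral>\<^sup>+x. ennreal ((cmod (f x))\<^sup>2) \<partial>lborel) +
      2 * (\<integral>\<^sup>+x. ennreal (cmod (f x) * cmod (g x)) \<partial>lborel) + (\<integral>\<^sup>+x. ennreal ((cmod (g x))\<^sup>2) \<partial>lborel)"
    by (simp add: nn_integral_add nn_integral_cmult)
  also have "\<dots> \<le> ennreal (a\<^sup>2) + 2 * ennreal (a * b) + ennreal (b\<^sup>2)"
    by (intro add_mono mult_left_mono l2_le_bound l2_le_mult_nn_integral assms) auto
  also have "\<dots> = ennreal (a\<^sup>2 + 2 * (a * b) + b\<^sup>2)"
    using assms[THEN l2_le_nonneg] by (simp add: ennreal_plus ennreal_mult)
  also have "a\<^sup>2 + 2 * (a * b) + b\<^sup>2 = (a + b)\<^sup>2" by (simp add: power2_sum)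
  finally show ?thesis using assms[THEN l2_le_nonneg] by (simp add: l2_le_def)
qed

lemma l2_le_limit:
  assumes "\<And>n::nat. l2_le f (a n)" "a \<longlonglongrightarrow> b"
  shows "l2_le f b"
proof -
  have "(\<integral>\<^sup>+x. ennreal ((cmod (f x))\<^sup>2) \<partial>lborel) \<le> ennreal (b\<^sup>2)"
  proof (rule LIMSEQ_le_const)
    show "(\<lambda>n. ennreal ((a n)\<^sup>2)) \<longlonglongrightarrow> ennreal (b\<^sup>2)"
      by (intro tendsto_ennrealI tendsto_intros assms)
  qed (use assms in \<open>auto simp: l2_le_def\<close>)
  moreover have "0 \<le> b"
    by (rule LIMSEQ_le_const[OF assms(2)]) (use assms in \<open>auto simp: l2_le_def\<close>)
  ultimately show ?thesis using assms(1) by (auto simp: l2_le_def)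
qed

text \<open>
  Young's inequality \<open>L\<^sup>1 * L\<^sup>2 \<subseteq> L\<^sup>2\<close>: write \<open>\<bar>k\<bar>\<close> as a product of two square roots, apply
  Cauchy-Schwarz at each \<open>x\<close>, and integrate in \<open>x\<close> by Fubini.
\<close>

lemma l2_le_convolution:
  fixes k f :: "'a::euclidean_space \<Rightarrow> complex"
  assumes [measurable]: "k \<in> borel_measurable borel"
    and k: "(\<integral>\<^sup>+z. ennreal (cmod (k z)) \<partial>lborel) \<le> ennreal A" and "0 \<le> A" and f: "l2_le f a"
  shows "l2_le (\<lambda>x. \<integral>z. k z * f (x - z) \<partial>lborel) (A * a)"
proof -
  note [measurable] = l2_le_measurable[OF f]
  have "(\<integral>\<^sup>+x. ennreal ((cmod (\<integral>z. k z * f (x - z) \<partial>lborel))\<^sup>2) \<partial>lborel) \<le>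
      (\<integral>\<^sup>+x. ennreal A * (\<integral>\<^sup>+z. ennreal (cmod (k z)) * ennreal ((cmod (f (x - z)))\<^sup>2) \<partial>lborel) \<partial>lborel)"
  proof (intro nn_integral_mono)
    fix x
    have "ennreal (cmod (\<integral>z. k z * f (x - z) \<partial>lborel)) \<le>
        (\<integral>\<^sup>+z. ennreal (cmod (k z * f (x - z))) \<partial>lborel)"
      by (rule norm_integral_le_nn_integral)
    also have "\<dots> = (\<integral>\<^sup>+z. ennreal (sqrt (cmod (k z))) * ennreal (sqrt (cmod (k z)) * cmod (f (x - z))) \<partial>lborel)"
      by (intro nn_integral_cong) (simp add: norm_mult flip: ennreal_mult mult.assoc)
    finally have "ennreal ((cmod (\<integral>z. k z * f (x - z) \<partial>lborel))\<^sup>2) \<le>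
      (\<integral>\<^sup>+z. ennreal (sqrt (cmod (k z))) * ennreal (sqrt (cmod (k z)) * cmod (f (x - z))) \<partial>lborel)\<^sup>2"
      by (simp add: power_mono flip: ennreal_power)
    also have "\<dots> \<le> (\<integral>\<^sup>+z. (ennreal (sqrt (cmod (k z))))\<^sup>2 \<partial>lborel) *
        (\<integral>\<^sup>+z. (ennreal (sqrt (cmod (k z)) * cmod (f (x - z))))\<^sup>2 \<partial>lborel)"
      by (rule Cauchy_Schwarz_nn_integral) measurable
    also have "\<dots> = (\<integral>\<^sup>+z. ennreal (cmod (k z)) \<partial>lborel) *
        (\<integral>\<^sup>+z. ennreal (cmod (k z)) * ennreal ((cmod (f (x - z)))\<^sup>2) \<partial>lborel)"
      by (simp add: ennreal_power power_mult_distrib ennreal_mult)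
    also have "\<dots> \<le> ennreal A * (\<integral>\<^sup>+z. ennreal (cmod (k z)) * ennreal ((cmod (f (x - z)))\<^sup>2) \<partial>lborel)"
      by (intro mult_right_mono k) auto
    finally show "ennreal ((cmod (\<integral>z. k z * f (x - z) \<partial>lborel))\<^sup>2) \<le> \<dots>" .
  qed
  also have "\<dots> = ennreal A * (\<integral>\<^sup>+x. (\<integral>\<^sup>+z. ennreal (cmod (k z)) * ennreal ((cmod (f (x - z)))\<^sup>2) \<partial>lborel) \<partial>lborel)"
    by (simp add: nn_integral_cmult)
  also have "(\<integral>\<^sup>+x. (\<integral>\<^sup>+z. ennreal (cmod (k z)) * ennreal ((cmod (f (x - z)))\<^sup>2) \<partial>lborel) \<partial>lborel) =
     (\<integral>\<^sup>+z. (\<integral>\<^sup>+x. ennreal (cmod (k z)) * ennreal ((cmod (f (x - z)))\<^sup>2) \<partial>lborel) \<partial>lborel)"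
    by (rule nn_integral_lborel_swap) measurable
  also have "\<dots> = (\<integral>\<^sup>+z. ennreal (cmod (k z)) * (\<integral>\<^sup>+x. ennreal ((cmod (f (x - z)))\<^sup>2) \<partial>lborel) \<partial>lborel)"
    by (simp add: nn_integral_cmult)
  also have "\<dots> = (\<integral>\<^sup>+z. ennreal (cmod (k z)) \<partial>lborel) * (\<integral>\<^sup>+x. ennreal ((cmod (f x))\<^sup>2) \<partial>lborel)"
    by (simp add: nn_integral_lborel_translate[where f = "\<lambda>x. ennreal ((cmod (f x))\<^sup>2)"] nn_integral_multc)
  also have "ennreal A * \<dots> \<le> ennreal A * (ennreal A * ennreal (a\<^sup>2))"
    by (intro mult_left_mono mult_mono k l2_le_bound f) auto
  also have "\<dots> = ennreal ((A * a)\<^sup>2)"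
    using \<open>0 \<le> A\<close> by (simp add: power2_eq_square ac_simps flip: ennreal_mult)
  finally show ?thesis
    using \<open>0 \<le> A\<close> l2_le_nonneg[OF f] by (simp add: l2_le_def)
qed

section \<open>The Fourier transform and the Gaussian\<close>

lemma measurable_fourier [measurable]:
  assumes [measurable]: "f \<in> borel_measurable borel"
  shows "fourier f \<in> borel_measurable borel"
  unfolding fourier_ee[abs_def] by measurable

lemma norm_fourier_le: "ennreal (cmod (fourier f \<xi>)) \<le> (\<integral>\<^sup>+x. ennreal (cmod (f x)) \<partial>lborel)"
  using norm_integral_le_nn_integral[of lborel "\<lambda>x. f x * ee (- (x \<bullet> \<xi>))"]
  by (simp add: fourier_ee norm_mult)

lemma norm_fourier_le_integral:
  "integrable lborel f \<Longrightarrow> cmod (fourier f \<xi>) \<le> (\<integral>x. cmod (f x) \<partial>lborel)"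
  using norm_fourier_le[of f \<xi>] by (simp add: nn_integral_eq_integral ennreal_le_iff)

lemma integrable_mult_ee:
  fixes f :: "'a::euclidean_space \<Rightarrow> complex"
  assumes "integrable lborel f" and [measurable]: "h \<in> borel_measurable borel"
  shows "integrable lborel (\<lambda>x. f x * ee (h x))" "integrable lborel (\<lambda>x. ee (h x) * f x)"
proof -
  note [measurable] = borel_measurable_integrable[OF assms(1)]
  show "integrable lborel (\<lambda>x. f x * ee (h x))"
    by (rule Bochner_Integration.integrable_bound[OF assms(1)]) (auto simp: norm_mult)
  then show "integrable lborel (\<lambda>x. ee (h x) * f x)" by (simp add: mult.commute)
qed

lemma ee_sum: "finite A \<Longrightarrow> ee (\<Sum>i\<in>A. f i) = (\<Prod>i\<in>A. ee (f i))"
  by (induction A rule: finite_induct) (auto simp: ee_add)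

text \<open>
  This is the characteristic function of the standard normal distribution, rescaled.
\<close>

lemma gauss_fourier_real:
  assumes e: "e > 0"
  shows "(\<integral>t. of_real (exp (- pi * e\<^sup>2 * t\<^sup>2)) * ee (u * t) \<partial>lborel) = of_real (exp (- pi * u\<^sup>2 / e\<^sup>2) / e)"
    and "integrable lborel (\<lambda>t. complex_of_real (exp (- pi * e\<^sup>2 * t\<^sup>2)) * ee (u * t))"
proof -
  define c where "c = sqrt (2 * pi) * e"
  define T where "T = sqrt (2 * pi) * u / e"
  have c: "c \<noteq> 0" "c > 0" using e by (auto simp: c_def)
  have c2: "c\<^sup>2 = 2 * pi * e\<^sup>2" by (simp add: c_def power_mult_distrib)
  have cT: "T * c = 2 * pi * u" using e by (simp add: c_def T_def)
  have T2: "T\<^sup>2 = 2 * pi * u\<^sup>2 / e\<^sup>2" by (simp add: T_def power_mult_distrib power_divide)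
  let ?g = "\<lambda>x. std_normal_density x *\<^sub>R iexp (T * x)"
  have int: "integrable lborel ?g"
  proof (rule Bochner_Integration.integrable_bound)
    show "integrable lborel std_normal_density"
      by (rule integrable_normal_density) simp
  qed auto
  have g: "?g (c * t) = of_real (1 / sqrt (2 * pi)) * (of_real (exp (- pi * e\<^sup>2 * t\<^sup>2)) * ee (u * t))" for t
  proof -
    have a: "(c * t)\<^sup>2 = 2 * (pi * e\<^sup>2 * t\<^sup>2)" by (simp add: power_mult_distrib c2)
    have D: "std_normal_density (c * t) = 1 / sqrt (2 * pi) * exp (- pi * e\<^sup>2 * t\<^sup>2)"
      unfolding normal_density_def by (simp add: a)
    have "T * (c * t) = T * c * t" by simp
    also have "\<dots> = 2 * pi * (u * t)" unfolding cT by simp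
    finally have b: "T * (c * t) = 2 * pi * (u * t)" .
    have E: "iexp (T * (c * t)) = ee (u * t)"
      unfolding b ee_def by (simp add: ac_simps)
    show ?thesis unfolding D E by (simp add: scaleR_conv_of_real)
  qed
  have "integrable lborel (\<lambda>t. ?g (0 + c * t))"
    by (rule lborel_integrable_real_affine[OF int c(1)])
  then have "integrable lborel (\<lambda>t. of_real (1 / sqrt (2 * pi)) * (of_real (exp (- pi * e\<^sup>2 * t\<^sup>2)) * ee (u * t)))"
    unfolding add_0 g .
  from integrable_mult_right[OF this, of "of_real (sqrt (2 * pi))"]
  show "integrable lborel (\<lambda>t. complex_of_real (exp (- pi * e\<^sup>2 * t\<^sup>2)) * ee (u * t))"
    by (simp add: field_simps del: of_real_mult)
  have "of_real (exp (- T\<^sup>2 / 2)) = char std_normal_distribution T"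
    by (simp add: char_std_normal_distribution)
  also have "\<dots> = (\<integral>x. ?g x \<partial>lborel)"
    unfolding char_def by (subst integral_density) auto
  also have "\<dots> = \<bar>c\<bar> *\<^sub>R (\<integral>t. ?g (0 + c * t) \<partial>lborel)"
    by (rule lborel_integral_real_affine[OF c(1)])
  also have "\<dots> = of_real (c / sqrt (2 * pi)) * (\<integral>t. of_real (exp (- pi * e\<^sup>2 * t\<^sup>2)) * ee (u * t) \<partial>lborel)"
    unfolding add_0 g using c by (simp add: scaleR_conv_of_real)
  also have "c / sqrt (2 * pi) = e" by (simp add: c_def)
  finally show "(\<integral>t. of_real (exp (- pi * e\<^sup>2 * t\<^sup>2)) * ee (u * t) \<partial>lborel) = of_real (exp (- pi * u\<^sup>2 / e\<^sup>2) / e)"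
    using e by (simp add: T2 field_simps)
qed

definition gauss :: "'a::euclidean_space \<Rightarrow> real" where
  "gauss x = exp (- pi * (norm x)\<^sup>2)"

lemma gauss_nonneg: "gauss x \<ge> 0" and gauss_le_1: "gauss x \<le> 1"
  and gauss_0 [simp]: "gauss 0 = 1"
  by (auto simp: gauss_def)

lemma continuous_gauss: "continuous_on A gauss"
  unfolding gauss_def[abs_def] by (intro continuous_intros)

lemma measurable_gauss [measurable]: "gauss \<in> borel_measurable borel"
  by (intro borel_measurable_continuous_onI continuous_gauss)

lemma gauss_fourier:
  fixes v :: "'a::euclidean_space"
  assumes e: "e > 0"
  shows "(\<integral>x. of_real (gauss (e *\<^sub>R x)) * ee (v \<bullet> x) \<partial>lborel) = of_real (gauss (v /\<^sub>R e) / e ^ DIM('a))"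
    and "integrable lborel (\<lambda>x. complex_of_real (gauss (e *\<^sub>R x)) * ee (v \<bullet> x))"
proof -
  have n2: "(norm x)\<^sup>2 = (\<Sum>b\<in>Basis. (x \<bullet> b)\<^sup>2)" for x :: 'a
    unfolding power2_norm_eq_inner by (subst euclidean_inner) (simp add: power2_eq_square)
  have eq: "complex_of_real (gauss (e *\<^sub>R x)) * ee (v \<bullet> x) =
      (\<Prod>b\<in>Basis. of_real (exp (- pi * e\<^sup>2 * (x \<bullet> b)\<^sup>2)) * ee ((v \<bullet> b) * (x \<bullet> b)))" for x :: 'a
  proof -
    have "gauss (e *\<^sub>R x) = exp (\<Sum>b\<in>Basis. - pi * e\<^sup>2 * (x \<bullet> b)\<^sup>2)"
      unfolding gauss_def n2 by (simp add: sum_distrib_left power_mult_distrib sum_negf algebra_simps)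
    moreover have "ee (v \<bullet> x) = (\<Prod>b\<in>Basis. ee ((v \<bullet> b) * (x \<bullet> b)))"
      by (subst euclidean_inner) (simp add: ee_sum)
    ultimately show ?thesis by (simp add: exp_sum prod.distrib)
  qed
  show "integrable lborel (\<lambda>x. complex_of_real (gauss (e *\<^sub>R x)) * ee (v \<bullet> x))"
    unfolding eq by (rule integral_lborel_prod_Basis(2)) (rule gauss_fourier_real(2)[OF e])
  have "(\<integral>x. of_real (gauss (e *\<^sub>R x)) * ee (v \<bullet> x) \<partial>lborel) =
      (\<Prod>b\<in>(Basis::'a set). of_real (exp (- pi * (v \<bullet> b)\<^sup>2 / e\<^sup>2) / e))"
    unfolding eq
    by (subst integral_lborel_prod_Basis(1)) (simp_all only: gauss_fourier_real[OF e] not_False_eq_True)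
  also have "\<dots> = of_real (\<Prod>b\<in>(Basis::'a set). exp (- pi * (v \<bullet> b)\<^sup>2 / e\<^sup>2) / e)"
    by simp
  also have "(\<Prod>b\<in>(Basis::'a set). exp (- pi * (v \<bullet> b)\<^sup>2 / e\<^sup>2) / e) = exp (\<Sum>b\<in>Basis. - pi * (v \<bullet> b)\<^sup>2 / e\<^sup>2) / e ^ DIM('a)"
    by (simp add: prod_dividef exp_sum)
  also have "(\<Sum>b\<in>Basis. - pi * (v \<bullet> b)\<^sup>2 / e\<^sup>2) = - pi * (norm (v /\<^sub>R e))\<^sup>2"
    unfolding n2 by (simp add: sum_distrib_left power_mult_distrib sum_negf sum_divide_distrib field_simps)
  finally show "(\<integral>x. of_real (gauss (e *\<^sub>R x)) * ee (v \<bullet> x) \<partial>lborel) = of_real (gauss (v /\<^sub>R e) / e ^ DIM('a))"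
    by (simp add: gauss_def)
qed

lemma integral_gauss:
  "integrable lborel (gauss :: 'a::euclidean_space \<Rightarrow> real)" "(\<integral>x. gauss (x::'a) \<partial>lborel) = 1"
proof -
  have i: "integrable lborel (\<lambda>x::'a. complex_of_real (gauss x))"
    using gauss_fourier(2)[of 1 "0::'a"] by simp
  then show "integrable lborel (gauss :: 'a \<Rightarrow> real)"
    using complex_of_real_integrable_eq by blast
  have "complex_of_real (\<integral>x. gauss (x::'a) \<partial>lborel) = 1"
    using gauss_fourier(1)[of 1 "0::'a"] by simp
  then show "(\<integral>x. gauss (x::'a) \<partial>lborel) = 1" by (simp only: of_real_eq_1_iff)
qed

section \<open>The inequalities of Bessel and Plancherel\<close>

text \<open>
  The Fourier transform of \<open>autocorr f\<close> is \<open>\<bar>fourier f\<bar>\<^sup>2\<close> up to the sign of the frequency. This turns an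
  integral of \<open>\<bar>fourier f\<bar>\<^sup>2\<close> against a Gaussian into an average of \<open>autocorr f\<close> over small shifts.
\<close>

definition autocorr :: "('a::euclidean_space \<Rightarrow> complex) \<Rightarrow> 'a \<Rightarrow> complex" where
  "autocorr f v = (\<integral>x. f x * cnj (f (x + v)) \<partial>lborel)"

lemma measurable_autocorr [measurable]:
  assumes [measurable]: "f \<in> borel_measurable borel"
  shows "autocorr f \<in> borel_measurable borel"
  unfolding autocorr_def[abs_def] by measurable

lemma autocorr_le:
  assumes "l2_le f a" shows "cmod (autocorr f v) \<le> a\<^sup>2"
  unfolding autocorr_def power2_eq_square
  by (intro l2_le_integral_mult assms l2_le_cnj l2_le_affine)

lemma nn_integral_autocorr:
  fixes f :: "'a::euclidean_space \<Rightarrow> complex"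
  assumes [measurable]: "f \<in> borel_measurable borel"
  shows "(\<integral>\<^sup>+x. \<integral>\<^sup>+v. ennreal (cmod (f x)) * ennreal (cmod (f (x + v))) \<partial>lborel \<partial>lborel) =
    (\<integral>\<^sup>+x. ennreal (cmod (f x)) \<partial>lborel)\<^sup>2"
proof -
  have m: "(\<lambda>x. ennreal (cmod (f x))) \<in> borel_measurable borel" by measurable
  show ?thesis
    by (simp add: nn_integral_cmult nn_integral_lborel_translate[OF m] nn_integral_multc power2_eq_square)
qed

lemma integrable_autocorr:
  fixes f :: "'a::euclidean_space \<Rightarrow> complex"
  assumes f: "integrable lborel f"
  shows "integrable lborel (autocorr f)"
proof -
  note [measurable] = borel_measurable_integrable[OF f, simplified]
  have "(\<integral>\<^sup>+x. \<integral>\<^sup>+v. ennreal (norm (f x * cnj (f (x + v)))) \<partial>lborel \<partial>lborel) < \<infinity>"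
    using f nn_integral_autocorr[of f]
    by (simp add: norm_mult ennreal_mult integrable_iff_bounded power2_eq_square ennreal_mult_less_top)
  from integrable_lborel_snd[OF _ this] show ?thesis
    unfolding autocorr_def[abs_def] by simp
qed

lemma norm_fourier_power2:
  fixes f :: "'a::euclidean_space \<Rightarrow> complex"
  assumes f: "integrable lborel f"
  shows "of_real ((cmod (fourier f \<xi>))\<^sup>2) = (\<integral>v. autocorr f v * ee (v \<bullet> \<xi>) \<partial>lborel)"
proof -
  note [measurable] = borel_measurable_integrable[OF f, simplified]
  have c: "cnj (fourier f \<xi>) = (\<integral>v. cnj (f (x + v)) * ee ((x + v) \<bullet> \<xi>) \<partial>lborel)" for x
  proof -
    have "cnj (fourier f \<xi>) = (\<integral>y. cnj (f y) * ee (y \<bullet> \<xi>) \<partial>lborel)"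
      unfolding fourier_ee by (simp flip: Bochner_Integration.integral_cnj)
    also have "\<dots> = (\<integral>v. cnj (f (x + v)) * ee ((x + v) \<bullet> \<xi>) \<partial>lborel)"
      by (rule integral_lborel_translate(1)[symmetric])
    finally show ?thesis .
  qed
  have "(\<integral>\<^sup>+x. \<integral>\<^sup>+v. ennreal (norm (f x * cnj (f (x + v)) * ee (v \<bullet> \<xi>))) \<partial>lborel \<partial>lborel) < \<infinity>"
    using f nn_integral_autocorr[of f]
    by (simp add: norm_mult ennreal_mult integrable_iff_bounded power2_eq_square ennreal_mult_less_top)
  note swap = integral_lborel_swap[OF _ this]
  have "of_real ((cmod (fourier f \<xi>))\<^sup>2) = fourier f \<xi> * cnj (fourier f \<xi>)"
    by (rule complex_norm_square)
  also have "\<dots> = (\<integral>x. f x * ee (- (x \<bullet> \<xi>)) * cnj (fourier f \<xi>) \<partial>lborel)"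
    unfolding fourier_ee[of f \<xi>] by simp
  also have "\<dots> = (\<integral>x. \<integral>v. f x * cnj (f (x + v)) * ee (v \<bullet> \<xi>) \<partial>lborel \<partial>lborel)"
  proof (rule Bochner_Integration.integral_cong[OF refl])
    fix x
    have "f x * ee (- (x \<bullet> \<xi>)) * cnj (fourier f \<xi>) =
        (\<integral>v. f x * ee (- (x \<bullet> \<xi>)) * (cnj (f (x + v)) * ee ((x + v) \<bullet> \<xi>)) \<partial>lborel)"
      by (subst c[of x]) simp
    also have "\<dots> = (\<integral>v. f x * cnj (f (x + v)) * ee (v \<bullet> \<xi>) \<partial>lborel)"
      by (intro Bochner_Integration.integral_cong[OF refl]) (simp add: inner_add_left ee_add ac_simps)
    finally show "f x * ee (- (x \<bullet> \<xi>)) * cnj (fourier f \<xi>) = \<dots>" .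
  qed
  also have "\<dots> = (\<integral>v. \<integral>x. f x * cnj (f (x + v)) * ee (v \<bullet> \<xi>) \<partial>lborel \<partial>lborel)"
    by (rule swap) measurable
  also have "\<dots> = (\<integral>v. autocorr f v * ee (v \<bullet> \<xi>) \<partial>lborel)"
    unfolding autocorr_def by simp
  finally show ?thesis .
qed

text \<open>
  As \<open>e\<close> tends to 0 the left-hand side grows to the integral of \<open>\<bar>fourier f\<bar>\<^sup>2\<close>, while the right-hand
  side is at most \<open>sup \<bar>autocorr f\<bar>\<close> and, where \<open>autocorr f\<close> is continuous at 0, tends to
  \<open>autocorr f 0\<close>, the square of the norm of \<open>f\<close>. The first fact gives Bessel's inequality, the second
  one the converse.
\<close>

lemma gauss_plancherel:
  fixes f :: "'a::euclidean_space \<Rightarrow> complex"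
  assumes f: "integrable lborel f" and e: "e > 0"
  shows "of_real (\<integral>\<xi>. (cmod (fourier f \<xi>))\<^sup>2 * gauss (e *\<^sub>R \<xi>) \<partial>lborel) =
      (\<integral>z. autocorr f (e *\<^sub>R z) * of_real (gauss z) \<partial>lborel)"
    and "integrable lborel (\<lambda>\<xi>. (cmod (fourier f \<xi>))\<^sup>2 * gauss (e *\<^sub>R \<xi>))"
proof -
  note [measurable] = borel_measurable_integrable[OF f, simplified]
  have gi: "integrable lborel (\<lambda>\<xi>::'a. gauss (e *\<^sub>R \<xi>))"
    using integrable_lborel_affine[OF integral_gauss(1), of e 0] e by simp
  have gn: "(\<integral>\<^sup>+\<xi>. ennreal (gauss (e *\<^sub>R (\<xi>::'a))) \<partial>lborel) < \<infinity>"
    using gi by (simp add: integrable_iff_bounded gauss_nonneg)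
  have A: "(\<integral>\<^sup>+v. ennreal (cmod (autocorr f v)) \<partial>lborel) < \<infinity>"
    using integrable_autocorr[OF f] by (simp add: integrable_iff_bounded)
  show "integrable lborel (\<lambda>\<xi>. (cmod (fourier f \<xi>))\<^sup>2 * gauss (e *\<^sub>R \<xi>))"
  proof (rule Bochner_Integration.integrable_bound)
    show "integrable lborel (\<lambda>\<xi>::'a. (\<integral>x. cmod (f x) \<partial>lborel)\<^sup>2 * gauss (e *\<^sub>R \<xi>))"
      using gi by simp
    show "AE \<xi> in lborel. norm ((cmod (fourier f \<xi>))\<^sup>2 * gauss (e *\<^sub>R \<xi>)) \<le>
        norm ((\<integral>x. cmod (f x) \<partial>lborel)\<^sup>2 * gauss (e *\<^sub>R \<xi>))"
      using norm_fourier_le_integral[OF f]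
      by (intro AE_I2) (simp add: abs_mult gauss_nonneg power_mono mult_right_mono)
  qed measurable
  have "(\<integral>\<^sup>+\<xi>. \<integral>\<^sup>+v. ennreal (norm (autocorr f v * ee (v \<bullet> \<xi>) * of_real (gauss (e *\<^sub>R \<xi>)))) \<partial>lborel \<partial>lborel) < \<infinity>"
    using A gn by (simp add: norm_mult ennreal_mult gauss_nonneg nn_integral_multc nn_integral_cmult ennreal_mult_less_top)
  note swap = integral_lborel_swap[OF _ this]
  have "complex_of_real (\<integral>\<xi>. (cmod (fourier f \<xi>))\<^sup>2 * gauss (e *\<^sub>R \<xi>) \<partial>lborel) =
      (\<integral>\<xi>. of_real ((cmod (fourier f \<xi>))\<^sup>2) * of_real (gauss (e *\<^sub>R \<xi>)) \<partial>lborel)"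
    by (subst integral_complex_of_real[symmetric]) simp
  also have "\<dots> = (\<integral>\<xi>. \<integral>v. autocorr f v * ee (v \<bullet> \<xi>) * of_real (gauss (e *\<^sub>R \<xi>)) \<partial>lborel \<partial>lborel)"
    unfolding norm_fourier_power2[OF f] by simp
  also have "\<dots> = (\<integral>v. \<integral>\<xi>. autocorr f v * ee (v \<bullet> \<xi>) * of_real (gauss (e *\<^sub>R \<xi>)) \<partial>lborel \<partial>lborel)"
    by (rule swap) measurable
  also have "\<dots> = (\<integral>v. autocorr f v * (\<integral>\<xi>. of_real (gauss (e *\<^sub>R \<xi>)) * ee (v \<bullet> \<xi>) \<partial>lborel) \<partial>lborel)"
    by (simp add: mult.assoc) (simp only: mult.commute[of "ee _"])
  also have "\<dots> = (\<integral>v. autocorr f v * of_real (gauss (v /\<^sub>R e) / e ^ DIM('a)) \<partial>lborel)"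
    by (simp only: gauss_fourier(1)[OF e])
  also have "\<dots> = \<bar>e\<bar> ^ DIM('a) *\<^sub>R (\<integral>z. autocorr f (0 + e *\<^sub>R z) * of_real (gauss ((0 + e *\<^sub>R z) /\<^sub>R e) / e ^ DIM('a)) \<partial>lborel)"
    using e by (intro integral_lborel_affine) simp
  also have "\<dots> = (\<integral>z. autocorr f (e *\<^sub>R z) * of_real (gauss z) \<partial>lborel)"
    using e by (simp add: scaleR_conv_of_real)
  finally show "of_real (\<integral>\<xi>. (cmod (fourier f \<xi>))\<^sup>2 * gauss (e *\<^sub>R \<xi>) \<partial>lborel) =
      (\<integral>z. autocorr f (e *\<^sub>R z) * of_real (gauss z) \<partial>lborel)" .
qed

lemma Bessel:
  fixes f :: "'a::euclidean_space \<Rightarrow> complex"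
  assumes f: "integrable lborel f" and a: "l2_le f a"
  shows "l2_le (fourier f) a"
proof -
  note [measurable] = borel_measurable_integrable[OF f, simplified]
  have le: "(\<integral>\<^sup>+\<xi>. ennreal ((cmod (fourier f \<xi>))\<^sup>2 * gauss (e *\<^sub>R \<xi>)) \<partial>lborel) \<le> ennreal (a\<^sup>2)" if e: "e > 0" for e
  proof -
    have "cmod (\<integral>z. autocorr f (e *\<^sub>R z) * of_real (gauss z) \<partial>lborel) \<le> (\<integral>z. a\<^sup>2 * gauss (z::'a) \<partial>lborel)"
    proof (rule Bochner_Integration.integral_norm_bound_integral)
      show i: "integrable lborel (\<lambda>z. a\<^sup>2 * gauss (z::'a))" by (simp add: integral_gauss)
      show "integrable lborel (\<lambda>z. autocorr f (e *\<^sub>R z) * complex_of_real (gauss z))"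
        by (rule Bochner_Integration.integrable_bound[OF i], measurable)
           (auto simp: norm_mult gauss_nonneg autocorr_le[OF a] intro!: mult_right_mono)
    qed (auto simp: norm_mult gauss_nonneg autocorr_le[OF a] intro!: mult_right_mono)
    also have "\<dots> = a\<^sup>2" by (simp add: integral_gauss)
    finally have "cmod (of_real (\<integral>\<xi>. (cmod (fourier f \<xi>))\<^sup>2 * gauss (e *\<^sub>R \<xi>) \<partial>lborel)) \<le> a\<^sup>2"
      unfolding gauss_plancherel(1)[OF f e] .
    then have "(\<integral>\<xi>. (cmod (fourier f \<xi>))\<^sup>2 * gauss (e *\<^sub>R \<xi>) \<partial>lborel) \<le> a\<^sup>2"
      by (simp only: norm_of_real abs_le_iff)
    then show ?thesis
      by (subst nn_integral_eq_integral[OF gauss_plancherel(2)[OF f e]])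
         (auto simp: gauss_nonneg intro!: ennreal_leI)
  qed
  have "(\<integral>\<^sup>+\<xi>. ennreal ((cmod (fourier f \<xi>))\<^sup>2) \<partial>lborel) =
      (\<integral>\<^sup>+\<xi>. liminf (\<lambda>n. ennreal ((cmod (fourier f \<xi>))\<^sup>2 * gauss ((1 / real (Suc n)) *\<^sub>R \<xi>))) \<partial>lborel)"
  proof (intro nn_integral_cong)
    fix \<xi> :: 'a
    have "(\<lambda>n. (1 / real (Suc n)) *\<^sub>R \<xi>) \<longlonglongrightarrow> 0 *\<^sub>R \<xi>"
      by (intro tendsto_intros) (use LIMSEQ_inverse_real_of_nat in \<open>simp add: inverse_eq_divide\<close>)
    then have "(\<lambda>n. gauss ((1 / real (Suc n)) *\<^sub>R \<xi>)) \<longlonglongrightarrow> gauss (0 *\<^sub>R \<xi>)"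
      by (rule continuous_on_tendsto_compose[OF continuous_gauss[of UNIV]]) auto
    then have "(\<lambda>n. ennreal ((cmod (fourier f \<xi>))\<^sup>2 * gauss ((1 / real (Suc n)) *\<^sub>R \<xi>))) \<longlonglongrightarrow>
        ennreal ((cmod (fourier f \<xi>))\<^sup>2 * gauss (0 *\<^sub>R \<xi>))"
      by (intro tendsto_ennrealI tendsto_intros)
    from lim_imp_Liminf[OF _ this]
    show "ennreal ((cmod (fourier f \<xi>))\<^sup>2) =
        liminf (\<lambda>n. ennreal ((cmod (fourier f \<xi>))\<^sup>2 * gauss ((1 / real (Suc n)) *\<^sub>R \<xi>)))"
      by simp
  qed
  also have "\<dots> \<le> liminf (\<lambda>n. \<integral>\<^sup>+\<xi>. ennreal ((cmod (fourier f \<xi>))\<^sup>2 * gauss ((1 / real (Suc n)) *\<^sub>R \<xi>)) \<partial>lborel)"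
    by (rule nn_integral_liminf) measurable
  also have "\<dots> \<le> liminf (\<lambda>n::nat. ennreal (a\<^sup>2))"
    by (intro Liminf_mono always_eventually allI le) auto
  also have "\<dots> = ennreal (a\<^sup>2)" by (simp add: Liminf_const)
  finally show ?thesis using l2_le_nonneg[OF a] by (simp add: l2_le_def)
qed

lemma bounded_support_l2:
  fixes f :: "'a::euclidean_space \<Rightarrow> complex"
  assumes [measurable]: "f \<in> borel_measurable borel"
    and B: "\<And>x. cmod (f x) \<le> B" and r: "\<And>x. norm x > r \<Longrightarrow> f x = 0"
  shows "integrable lborel f" "l2_le f (B * sqrt (measure lborel (cball (0::'a) r)))"
proof -
  have B0: "0 \<le> B" using B[of 0] norm_ge_zero order_trans by blast
  have fin: "emeasure lborel (cball (0::'a) r) < \<infinity>"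
    by (rule emeasure_lborel_cball_finite)
  have le: "cmod (f x) \<le> B * indicator (cball 0 r) x" for x
    using B[of x] r[of x] by (auto simp: indicator_def)
  show "integrable lborel f"
  proof (rule Bochner_Integration.integrable_bound)
    show "integrable lborel (\<lambda>x. B * indicator (cball (0::'a) r) x :: real)"
      using fin by (intro integrable_mult_right integrable_real_indicator) auto
    show "AE x in lborel. norm (f x) \<le> norm (B * indicator (cball 0 r) x)"
      using le B0 by (auto simp: abs_mult)
  qed simp
  have "(\<integral>\<^sup>+x. ennreal ((cmod (f x))\<^sup>2) \<partial>lborel) \<le> (\<integral>\<^sup>+x. ennreal (B\<^sup>2) * indicator (cball (0::'a) r) x \<partial>lborel)"
  proof (intro nn_integral_mono)
    fix x
    have "(cmod (f x))\<^sup>2 \<le> (B * indicator (cball 0 r) x)\<^sup>2"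
      by (intro power_mono le) auto
    then show "ennreal ((cmod (f x))\<^sup>2) \<le> ennreal (B\<^sup>2) * indicator (cball 0 r) x"
      by (auto simp: indicator_def intro: ennreal_leI split: if_splits)
  qed
  also have "\<dots> = ennreal (B\<^sup>2) * emeasure lborel (cball (0::'a) r)"
    by (rule nn_integral_cmult_indicator) auto
  also have "\<dots> = ennreal ((B * sqrt (measure lborel (cball (0::'a) r)))\<^sup>2)"
    using fin by (simp add: emeasure_eq_ennreal_measure power_mult_distrib ennreal_mult less_top)
  finally show "l2_le f (B * sqrt (measure lborel (cball (0::'a) r)))"
    using B0 by (simp add: l2_le_def)
qed

lemma Plancherel_continuous:
  fixes f :: "'a::euclidean_space \<Rightarrow> complex"
  assumes cont: "continuous_on UNIV f"
    and B: "\<And>x. cmod (f x) \<le> B" and r: "\<And>x. norm x > r \<Longrightarrow> f x = 0"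
    and a: "l2_le (fourier f) a"
  shows "l2_le f a"
proof -
  have [measurable]: "f \<in> borel_measurable borel" by (rule borel_measurable_continuous_onI[OF cont])
  have f: "integrable lborel f" using bounded_support_l2(1)[of f B r] B r by auto
  obtain b where b: "l2_le f b" using bounded_support_l2(2)[of f B r] B r by auto
  have lim0: "(\<lambda>n. (1 / real (Suc n)) *\<^sub>R z) \<longlonglongrightarrow> 0" for z :: 'a
  proof -
    have "(\<lambda>n. (1 / real (Suc n)) *\<^sub>R z) \<longlonglongrightarrow> 0 *\<^sub>R z"
      by (intro tendsto_intros) (use LIMSEQ_inverse_real_of_nat in \<open>simp add: inverse_eq_divide\<close>)
    then show ?thesis by simp
  qed
  have A: "(\<lambda>n. autocorr f ((1 / real (Suc n)) *\<^sub>R z)) \<longlonglongrightarrow> autocorr f 0" for z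
    unfolding autocorr_def
  proof (rule integral_dominated_convergence[where w = "\<lambda>x. B * cmod (f x)"])
    show "integrable lborel (\<lambda>x. B * cmod (f x))" using f by simp
    show "AE x in lborel. (\<lambda>n. f x * cnj (f (x + (1 / real (Suc n)) *\<^sub>R z))) \<longlonglongrightarrow> f x * cnj (f (x + 0))"
    proof (intro AE_I2)
      fix x
      have "(\<lambda>n. x + (1 / real (Suc n)) *\<^sub>R z) \<longlonglongrightarrow> x + 0" by (intro tendsto_intros lim0)
      then have "(\<lambda>n. f (x + (1 / real (Suc n)) *\<^sub>R z)) \<longlonglongrightarrow> f (x + 0)"
        by (rule continuous_on_tendsto_compose[OF cont]) auto
      then show "(\<lambda>n. f x * cnj (f (x + (1 / real (Suc n)) *\<^sub>R z))) \<longlonglongrightarrow> f x * cnj (f (x + 0))"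
        by (intro tendsto_intros)
    qed
    show "AE x in lborel. norm (f x * cnj (f (x + (1 / real (Suc n)) *\<^sub>R z))) \<le> B * cmod (f x)" for n
    proof (intro AE_I2)
      fix x
      show "norm (f x * cnj (f (x + (1 / real (Suc n)) *\<^sub>R z))) \<le> B * cmod (f x)"
        using mult_left_mono[OF B[of "x + (1 / real (Suc n)) *\<^sub>R z"] norm_ge_zero[of "f x"]]
        by (simp add: norm_mult mult.commute)
    qed
  qed measurable
  have "(\<lambda>n. \<integral>z. autocorr f ((1 / real (Suc n)) *\<^sub>R z) * of_real (gauss z) \<partial>lborel) \<longlonglongrightarrow>
      (\<integral>z. autocorr f 0 * of_real (gauss (z::'a)) \<partial>lborel)"
  proof (rule integral_dominated_convergence[where w = "\<lambda>z. b\<^sup>2 * gauss z"])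
    show "integrable lborel (\<lambda>z::'a. b\<^sup>2 * gauss z)" by (simp add: integral_gauss)
    show "AE z in lborel. (\<lambda>n. autocorr f ((1 / real (Suc n)) *\<^sub>R z) * of_real (gauss z)) \<longlonglongrightarrow> autocorr f 0 * of_real (gauss z)"
      by (intro AE_I2 tendsto_intros A)
    show "AE z in lborel. norm (autocorr f ((1 / real (Suc n)) *\<^sub>R z) * complex_of_real (gauss z)) \<le> b\<^sup>2 * gauss z" for n
      by (intro AE_I2) (simp add: norm_mult gauss_nonneg autocorr_le[OF b] mult_right_mono)
  qed measurable
  moreover have "(\<integral>z. autocorr f 0 * of_real (gauss (z::'a)) \<partial>lborel) = autocorr f 0"
    by (simp add: integral_gauss)
  ultimately have "(\<lambda>n. \<integral>z. autocorr f ((1 / real (Suc n)) *\<^sub>R z) * of_real (gauss z) \<partial>lborel) \<longlonglongrightarrow> autocorr f 0"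
    by (simp only:)
  from tendsto_norm[OF this] have lim: "(\<lambda>n. cmod (\<integral>z. autocorr f ((1 / real (Suc n)) *\<^sub>R z) * of_real (gauss z) \<partial>lborel)) \<longlonglongrightarrow> cmod (autocorr f 0)" .
  have "cmod (autocorr f 0) \<le> a\<^sup>2"
  proof (rule LIMSEQ_le_const2[OF lim], intro exI allI impI)
    fix n :: nat
    let ?e = "1 / real (Suc n)"
    have e: "?e > 0" by simp
    have "ennreal (\<integral>\<xi>. (cmod (fourier f \<xi>))\<^sup>2 * gauss (?e *\<^sub>R \<xi>) \<partial>lborel) =
        (\<integral>\<^sup>+\<xi>. ennreal ((cmod (fourier f \<xi>))\<^sup>2 * gauss (?e *\<^sub>R \<xi>)) \<partial>lborel)"
      by (subst nn_integral_eq_integral[OF gauss_plancherel(2)[OF f e]]) (auto simp: gauss_nonneg)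
    also have "\<dots> \<le> (\<integral>\<^sup>+\<xi>. ennreal ((cmod (fourier f \<xi>))\<^sup>2) \<partial>lborel)"
      by (intro nn_integral_mono ennreal_leI mult_left_le gauss_le_1) auto
    also have "\<dots> \<le> ennreal (a\<^sup>2)" by (rule l2_le_bound[OF a])
    finally have "(\<integral>\<xi>. (cmod (fourier f \<xi>))\<^sup>2 * gauss (?e *\<^sub>R \<xi>) \<partial>lborel) \<le> a\<^sup>2"
      by (simp add: ennreal_le_iff)
    moreover have "0 \<le> (\<integral>\<xi>. (cmod (fourier f \<xi>))\<^sup>2 * gauss (?e *\<^sub>R \<xi>) \<partial>lborel)"
      by (intro integral_nonneg_AE AE_I2 mult_nonneg_nonneg gauss_nonneg) auto
    ultimately show "cmod (\<integral>z. autocorr f (?e *\<^sub>R z) * of_real (gauss z) \<partial>lborel) \<le> a\<^sup>2"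
      unfolding gauss_plancherel(1)[OF f e, symmetric] by simp
  qed
  moreover have "autocorr f 0 = of_real (\<integral>x. (cmod (f x))\<^sup>2 \<partial>lborel)"
    unfolding autocorr_def by (subst integral_complex_of_real[symmetric]) (simp add: complex_norm_square[symmetric] del: of_real_power)
  ultimately have "(\<integral>x. (cmod (f x))\<^sup>2 \<partial>lborel) \<le> a\<^sup>2" by simp
  moreover have "integrable lborel (\<lambda>x. (cmod (f x))\<^sup>2)"
    using l2_leD[OF b] by (intro integrableI_bounded) (auto intro: le_less_trans)
  ultimately have "(\<integral>\<^sup>+x. ennreal ((cmod (f x))\<^sup>2) \<partial>lborel) \<le> ennreal (a\<^sup>2)"
    by (simp add: nn_integral_eq_integral ennreal_leI)
  then show ?thesis using a by (simp add: l2_le_def)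
qed

text \<open>
  A bounded Borel function is almost everywhere a limit of continuous functions. Projecting these to
  the ball of radius \<open>B\<close> and multiplying by a cut-off keeps the limit and makes dominated
  convergence applicable.
\<close>

lemma continuous_approximation:
  fixes f :: "'a::euclidean_space \<Rightarrow> complex"
  assumes [measurable]: "f \<in> borel_measurable borel"
    and B: "\<And>x. cmod (f x) \<le> B" and r: "\<And>x. norm x > r \<Longrightarrow> f x = 0"
  obtains h \<delta> where "\<And>n::nat. continuous_on UNIV (h n)" "\<And>n x. cmod (h n x) \<le> B"
    "\<And>n x. norm x > r + 1 \<Longrightarrow> h n x = 0" "\<And>n. l2_le (\<lambda>x. f x - h n x) (\<delta> n)" "\<delta> \<longlonglongrightarrow> 0"
proof -
  have B0: "0 \<le> B" using B[of 0] norm_ge_zero order_trans by blast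
  have "f \<in> borel_measurable lebesgue" by (simp add: measurable_completion)
  then have "f measurable_on UNIV" by (rule lebesgue_measurable_imp_measurable_on) simp
  then obtain N g where N: "negligible N" and g: "\<And>n. continuous_on UNIV (g n)"
    and lim: "\<And>x. x \<notin> N \<Longrightarrow> (\<lambda>n. g n x) \<longlonglongrightarrow> f x"
    unfolding measurable_on_def by auto
  define c where "c x = max 0 (min 1 (r + 1 - norm x))" for x :: 'a
  define h where "h n x = c x *\<^sub>R closest_point (cball 0 B) (g n x)" for n :: nat and x
  have c01: "0 \<le> c x" "c x \<le> 1" for x by (auto simp: c_def)
  have contp: "continuous_on A (closest_point (cball (0::complex) B))" for A
    using B0 by (intro continuous_on_closest_point) auto
  have hc: "continuous_on UNIV (h n)" for n
    unfolding h_def c_def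
    by (intro continuous_intros continuous_on_compose2[OF contp[of UNIV]] g) auto
  then have [measurable]: "h n \<in> borel_measurable borel" for n
    by (rule borel_measurable_continuous_onI)
  have pB: "closest_point (cball (0::complex) B) y \<in> cball 0 B" for y
    using B0 by (intro closest_point_in_set) auto
  have hB: "cmod (h n x) \<le> B" for n x
  proof -
    have "cmod (h n x) \<le> 1 * B"
      unfolding h_def norm_scaleR using c01[of x] pB[of "g n x"] B0 by (intro mult_mono) auto
    then show ?thesis by simp
  qed
  have hr: "h n x = 0" if "norm x > r + 1" for n x
    using that by (simp add: h_def c_def)
  have hlim: "(\<lambda>n. h n x) \<longlonglongrightarrow> f x" if "x \<notin> N" for x
  proof -
    have "(\<lambda>n. closest_point (cball 0 B) (g n x)) \<longlonglongrightarrow> closest_point (cball 0 B) (f x)"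
      by (rule continuous_on_tendsto_compose[OF contp[of UNIV] lim[OF that]]) auto
    also have "closest_point (cball 0 B) (f x) = f x"
      using B[of x] by (intro closest_point_self) auto
    finally have "(\<lambda>n. h n x) \<longlonglongrightarrow> c x *\<^sub>R f x"
      unfolding h_def by (intro tendsto_intros)
    moreover have "c x *\<^sub>R f x = f x"
      using r[of x] by (cases "norm x > r") (auto simp: c_def)
    ultimately show ?thesis by simp
  qed
  have db: "cmod (f x - h n x) \<le> 2 * B" for n x
    using norm_triangle_ineq4[of "f x" "h n x"] B[of x] hB[of n x] by simp
  have dr: "f x - h n x = 0" if "norm x > r + 1" for n x
    using hr[OF that] r[of x] that by simp
  have "(\<lambda>n. \<integral>x. (cmod (f x - h n x))\<^sup>2 \<partial>lborel) \<longlonglongrightarrow> (\<integral>x. 0 \<partial>(lborel::'a measure))"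
  proof (rule integral_dominated_convergence[where w = "\<lambda>x. (2 * B)\<^sup>2 * indicator (cball 0 (r + 1)) x"])
    show "integrable lborel (\<lambda>x. (2 * B)\<^sup>2 * indicator (cball (0::'a) (r + 1)) x :: real)"
      using emeasure_lborel_cball_finite[of "0::'a" "r+1"]
      by (intro integrable_mult_right integrable_real_indicator) auto
    have "AE x in lborel. x \<notin> N"
      using N by (auto simp: negligible_iff_null_sets null_sets_completion_iff2 intro: AE_I')
    then show "AE x in lborel. (\<lambda>n. (cmod (f x - h n x))\<^sup>2) \<longlonglongrightarrow> 0"
    proof eventually_elim
      case (elim x)
      have "(\<lambda>n. (cmod (f x - h n x))\<^sup>2) \<longlonglongrightarrow> (cmod (f x - f x))\<^sup>2"
        by (intro tendsto_intros hlim elim)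
      then show ?case by simp
    qed
    show "AE x in lborel. norm ((cmod (f x - h n x))\<^sup>2) \<le> (2 * B)\<^sup>2 * indicator (cball 0 (r + 1)) x" for n
    proof (intro AE_I2)
      fix x
      show "norm ((cmod (f x - h n x))\<^sup>2) \<le> (2 * B)\<^sup>2 * indicator (cball 0 (r + 1)) x"
        using power_mono[OF db[of x n] norm_ge_zero, of 2] dr[of x n] by (cases "norm x > r + 1") (auto simp: indicator_def)
    qed
  qed measurable
  then have d: "(\<lambda>n. sqrt (\<integral>x. (cmod (f x - h n x))\<^sup>2 \<partial>lborel)) \<longlonglongrightarrow> 0"
    using tendsto_real_sqrt by fastforce
  have dl: "l2_le (\<lambda>x. f x - h n x) (sqrt (\<integral>x. (cmod (f x - h n x))\<^sup>2 \<partial>lborel))" for n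
  proof -
    obtain b where b: "l2_le (\<lambda>x. f x - h n x) b"
      using bounded_support_l2(2)[of "\<lambda>x. f x - h n x" "2 * B" "r + 1"] db dr by auto
    have i: "integrable lborel (\<lambda>x. (cmod (f x - h n x))\<^sup>2)"
      using l2_leD[OF b] by (intro integrableI_bounded) (auto intro: le_less_trans)
    show ?thesis using nn_integral_eq_integral[OF i] by (simp add: l2_le_def)
  qed
  from hc hB hr dl d show ?thesis by (rule that)
qed

lemma fourier_diff:
  assumes "integrable lborel f" "integrable lborel g"
  shows "fourier (\<lambda>x. f x - g x) \<xi> = fourier f \<xi> - fourier g \<xi>"
  unfolding fourier_ee left_diff_distrib
  by (intro Bochner_Integration.integral_diff integrable_mult_ee assms) measurable

text \<open>
  The bound passes from continuous functions to the limit, because Bessel's inequality controls the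
  Fourier transforms of the differences.
\<close>

theorem Plancherel_le:
  fixes f :: "'a::euclidean_space \<Rightarrow> complex"
  assumes [measurable]: "f \<in> borel_measurable borel"
    and B: "\<And>x. cmod (f x) \<le> B" and r: "\<And>x. norm x > r \<Longrightarrow> f x = 0"
    and a: "l2_le (fourier f) a"
  shows "l2_le f a"
proof -
  obtain h \<delta> where h: "\<And>n::nat. continuous_on UNIV (h n)" "\<And>n x. cmod (h n x) \<le> B"
    "\<And>n x. norm x > r + 1 \<Longrightarrow> h n x = 0" "\<And>n. l2_le (\<lambda>x. f x - h n x) (\<delta> n)" "\<delta> \<longlonglongrightarrow> 0"
    by (rule continuous_approximation[OF _ B r]) auto
  have [measurable]: "h n \<in> borel_measurable borel" for n
    by (rule borel_measurable_continuous_onI[OF h(1)])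
  have fi: "integrable lborel f" using bounded_support_l2(1)[of f B r] B r by auto
  have hi: "integrable lborel (h n)" for n
    using bounded_support_l2(1)[of "h n" B "r + 1"] h(2,3) by auto
  have "l2_le f (\<delta> n + (a + \<delta> n))" for n
  proof -
    have "l2_le (fourier (\<lambda>x. f x - h n x)) (\<delta> n)"
      by (intro Bessel h) (simp add: fi hi)
    from l2_le_add[OF a l2_le_cmult[OF this, of "-1"]]
    have "l2_le (fourier (h n)) (a + \<delta> n)"
      by (simp add: fourier_diff[OF fi hi])
    then have "l2_le (h n) (a + \<delta> n)"
      using h(1-3) by - (rule Plancherel_continuous[where B = B and r = "r + 1"], auto)
    from l2_le_add[OF h(4)[of n] this] show ?thesis by simp
  qed
  moreover have "(\<lambda>n. \<delta> n + (a + \<delta> n)) \<longlonglongrightarrow> 0 + (a + 0)" by (intro tendsto_intros h(5))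
  ultimately show ?thesis using l2_le_limit by fastforce
qed

section \<open>Convolution and frequency truncation\<close>

lemma l2_le_integrable:
  fixes f :: "'a::euclidean_space \<Rightarrow> complex"
  assumes f: "l2_le f a" and r: "\<And>x. norm x > r \<Longrightarrow> f x = 0"
  shows "integrable lborel f"
proof -
  have "l2_le (indicator (cball (0::'a) r) :: 'a \<Rightarrow> complex) (1 * sqrt (measure lborel (cball (0::'a) r)))"
    by (rule bounded_support_l2) (auto simp: indicator_def[abs_def] intro!: measurable_If_set)
  from l2_le_integrable_mult[OF f this]
  show ?thesis
    by (rule Bochner_Integration.integrable_bound)
       (use r l2_le_measurable[OF f] in \<open>auto simp: indicator_def not_le\<close>)
qed

text \<open>
  The third part says that the second one is the smallest admissible bound; it is what makes exact
  identities between square integrals available.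
\<close>

lemma l2_le_sharp:
  assumes "l2_le f a"
  shows "integrable lborel (\<lambda>x. (cmod (f x))\<^sup>2)" "l2_le f (sqrt (\<integral>x. (cmod (f x))\<^sup>2 \<partial>lborel))"
    "(\<integral>x. (cmod (f x))\<^sup>2 \<partial>lborel) \<le> a\<^sup>2"
proof -
  show i: "integrable lborel (\<lambda>x. (cmod (f x))\<^sup>2)"
    using l2_leD[OF assms] by (intro integrableI_bounded) (auto intro: le_less_trans)
  note e = nn_integral_eq_integral[OF i]
  from e show "l2_le f (sqrt (\<integral>x. (cmod (f x))\<^sup>2 \<partial>lborel))"
    using assms by (simp add: l2_le_def)
  from e l2_le_bound[OF assms] show "(\<integral>x. (cmod (f x))\<^sup>2 \<partial>lborel) \<le> a\<^sup>2"
    by (simp add: ennreal_le_iff)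
qed

lemma convolution_support:
  fixes k f :: "'a::euclidean_space \<Rightarrow> complex"
  assumes r: "\<And>x. norm x > r \<Longrightarrow> k x = 0" and s: "\<And>x. norm x > s \<Longrightarrow> f x = 0"
    and x: "norm x > r + s"
  shows "(\<integral>z. k z * f (x - z) \<partial>lborel) = 0"
proof -
  have "k z * f (x - z) = 0" for z
  proof (cases "norm z > r")
    case False
    have "norm x \<le> norm z + norm (x - z)" using norm_triangle_ineq[of z "x - z"] by simp
    with False x have "norm (x - z) > s" by simp
    then show ?thesis by (simp add: s)
  qed (simp add: r)
  then have "(\<lambda>z. k z * f (x - z)) = (\<lambda>z. 0)" by (rule ext)
  then show ?thesis by (simp only: Bochner_Integration.integral_zero)
qed

lemma convolution_bound:
  assumes k: "l2_le k b" and f: "l2_le f a"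
  shows "cmod (\<integral>z. k z * f (x - z) \<partial>lborel) \<le> b * a"
  by (rule l2_le_integral_mult[OF k]) (rule l2_le_affine[OF f])

lemma ee_inner_add: "ee (- ((x + z) \<bullet> \<xi>)) = ee (- (x \<bullet> \<xi>)) * ee (- (z \<bullet> \<xi>))"
  by (simp add: inner_add_left flip: ee_add)

lemma fourier_convolution:
  fixes k f :: "'a::euclidean_space \<Rightarrow> complex"
  assumes k: "integrable lborel k" and f: "integrable lborel f"
  shows "fourier (\<lambda>x. \<integral>z. k z * f (x - z) \<partial>lborel) \<xi> = fourier k \<xi> * fourier f \<xi>"
proof -
  note [measurable] = borel_measurable_integrable[OF k, simplified] borel_measurable_integrable[OF f, simplified]
  have m: "(\<lambda>x. ennreal (cmod (f x))) \<in> borel_measurable borel" by measurable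
  have "(\<integral>\<^sup>+z. \<integral>\<^sup>+x. ennreal (norm (k z * f (x - z) * ee (- (x \<bullet> \<xi>)))) \<partial>lborel \<partial>lborel) < \<infinity>"
    using f k
    by (simp add: norm_mult ennreal_mult nn_integral_cmult nn_integral_lborel_translate(3)[OF m]
      nn_integral_multc integrable_iff_bounded ennreal_mult_less_top)
  note swap = integral_lborel_swap[OF _ this]
  have "fourier (\<lambda>x. \<integral>z. k z * f (x - z) \<partial>lborel) \<xi> =
      (\<integral>x. \<integral>z. k z * f (x - z) * ee (- (x \<bullet> \<xi>)) \<partial>lborel \<partial>lborel)"
    unfolding fourier_ee by simp
  also have "\<dots> = (\<integral>z. \<integral>x. k z * f (x - z) * ee (- (x \<bullet> \<xi>)) \<partial>lborel \<partial>lborel)"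
    by (rule swap[symmetric]) measurable
  also have "\<dots> = (\<integral>z. k z * ee (- (z \<bullet> \<xi>)) * fourier f \<xi> \<partial>lborel)"
  proof (intro Bochner_Integration.integral_cong refl)
    fix z
    have "(\<integral>x. k z * f (x - z) * ee (- (x \<bullet> \<xi>)) \<partial>lborel) =
        (\<integral>x. k z * f (x + z - z) * ee (- ((x + z) \<bullet> \<xi>)) \<partial>lborel)"
      by (rule integral_lborel_translate(2)[symmetric])
    also have "\<dots> = (\<integral>x. k z * ee (- (z \<bullet> \<xi>)) * (f x * ee (- (x \<bullet> \<xi>))) \<partial>lborel)"
      by (intro Bochner_Integration.integral_cong refl) (simp only: ee_inner_add add_diff_cancel ac_simps)
    also have "\<dots> = k z * ee (- (z \<bullet> \<xi>)) * fourier f \<xi>"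
      unfolding fourier_ee by simp
    finally show "(\<integral>x. k z * f (x - z) * ee (- (x \<bullet> \<xi>)) \<partial>lborel) = \<dots>" .
  qed
  also have "\<dots> = fourier k \<xi> * fourier f \<xi>"
    unfolding fourier_ee[of k] by simp
  finally show ?thesis .
qed

text \<open>
  Convolution with \<open>k\<close> multiplies the Fourier transform by a function of modulus at most \<open>m\<close>. The
  convolution is bounded with bounded support, so the Plancherel inequality applies to it.
\<close>

lemma l2_le_convolution_fourier:
  fixes k f :: "'a::euclidean_space \<Rightarrow> complex"
  assumes k: "l2_le k b" and r: "\<And>x. norm x > r \<Longrightarrow> k x = 0"
    and f: "l2_le f a" and s: "\<And>x. norm x > s \<Longrightarrow> f x = 0"
    and m: "\<And>\<xi>. cmod (fourier k \<xi>) \<le> m"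
  shows "l2_le (\<lambda>x. \<integral>z. k z * f (x - z) \<partial>lborel) (m * a)"
proof (rule Plancherel_le)
  note [measurable] = l2_le_measurable[OF k] l2_le_measurable[OF f]
  have ki: "integrable lborel k" by (rule l2_le_integrable[OF k r])
  have fi: "integrable lborel f" by (rule l2_le_integrable[OF f s])
  show "(\<lambda>x. \<integral>z. k z * f (x - z) \<partial>lborel) \<in> borel_measurable borel" by measurable
  show "cmod (\<integral>z. k z * f (x - z) \<partial>lborel) \<le> b * a" for x
    by (rule convolution_bound[OF k f])
  show "norm x > r + s \<Longrightarrow> (\<integral>z. k z * f (x - z) \<partial>lborel) = 0" for x
    by (rule convolution_support[OF r s])
  have m0: "0 \<le> m" using m norm_ge_zero order_trans by blast
  have "l2_le (\<lambda>\<xi>. of_real m * fourier f \<xi>) (cmod (of_real m) * a)"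
    by (intro l2_le_cmult Bessel fi f)
  then have "l2_le (\<lambda>\<xi>. of_real m * fourier f \<xi>) (m * a)" using m0 by simp
  then show "l2_le (fourier (\<lambda>x. \<integral>z. k z * f (x - z) \<partial>lborel)) (m * a)"
    unfolding fourier_convolution[OF ki fi, abs_def]
    by (rule l2_le_dominated) (use m m0 in \<open>auto simp: norm_mult intro!: mult_right_mono\<close>)
qed

text \<open>
  Let \<open>v\<close> be the part of \<open>u\<close> with frequencies in \<open>S\<close>. Its inner product with \<open>u\<close> is exactly the integral of
  \<open>\<bar>fourier u\<bar>\<^sup>2\<close> over \<open>S\<close>, and its squared norm is at most that integral. Expanding the square of
  \<open>u - v\<close> leaves at most the integral over the complement of \<open>S\<close>.
\<close>

lemma Plancherel_truncation:
  fixes u :: "'a::euclidean_space \<Rightarrow> complex"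
  assumes [measurable]: "u \<in> borel_measurable borel"
    and B: "\<And>x. cmod (u x) \<le> B" and r: "\<And>x. norm x > r \<Longrightarrow> u x = 0"
    and S[measurable]: "S \<in> sets borel" and S_fin: "emeasure lborel S < \<infinity>"
  shows "(\<integral>\<^sup>+x. ennreal ((cmod (u x - (\<integral>\<xi>. indicator S \<xi> * fourier u \<xi> * ee (x \<bullet> \<xi>) \<partial>lborel)))\<^sup>2) \<partial>lborel)
    \<le> (\<integral>\<^sup>+\<xi>. ennreal ((cmod (fourier u \<xi>))\<^sup>2) * indicator (- S) \<xi> \<partial>lborel)"
proof -
  have ui: "integrable lborel u" using bounded_support_l2(1)[of u B r] B r by auto
  obtain b where b: "l2_le u b" using bounded_support_l2(2)[of u B r] B r by auto
  define F where "F \<xi> = indicator S \<xi> * fourier u \<xi>" for \<xi>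
  have [measurable]: "F \<in> borel_measurable borel" unfolding F_def by measurable
  define v where "v x = (\<integral>\<xi>. F \<xi> * ee (x \<bullet> \<xi>) \<partial>lborel)" for x
  have fu: "l2_le (fourier u) b" by (rule Bessel[OF ui b])
  have F2: "l2_le F b" by (rule l2_le_dominated[OF fu]) (auto simp: F_def indicator_def)
  have ind: "l2_le (indicator S) (sqrt (measure lborel S))"
  proof -
    have "(\<integral>\<^sup>+x. ennreal ((cmod (indicator S x))\<^sup>2) \<partial>lborel) = (\<integral>\<^sup>+x. indicator S x \<partial>lborel)"
      by (intro nn_integral_cong) (auto simp: indicator_def)
    also have "\<dots> = ennreal ((sqrt (measure lborel S))\<^sup>2)"
      using S_fin by (simp add: emeasure_eq_ennreal_measure less_top)
    finally show ?thesis using S by (simp add: l2_le_def borel_measurable_indicator)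
  qed
  have Fi: "integrable lborel F"
    unfolding F_def by (rule l2_le_integrable_mult[OF ind fu])
  have v_eq: "v x = fourier F (- x)" for x
    by (simp add: v_def fourier_ee inner_commute)
  have [measurable]: "v \<in> borel_measurable borel" unfolding v_eq[abs_def] by measurable
  note F2' = l2_le_sharp[OF F2]
  have "l2_le (fourier F) (sqrt (\<integral>\<xi>. (cmod (F \<xi>))\<^sup>2 \<partial>lborel))" by (rule Bessel[OF Fi F2'(2)])
  from l2_le_affine(3)[OF this, of 0]
  have v2: "l2_le v (sqrt (\<integral>\<xi>. (cmod (F \<xi>))\<^sup>2 \<partial>lborel))" by (simp add: v_eq[abs_def])
  have uv: "(\<integral>x. u x * cnj (v x) \<partial>lborel) = of_real (\<integral>\<xi>. (cmod (F \<xi>))\<^sup>2 \<partial>lborel)"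
  proof -
    have "(\<integral>\<^sup>+x. \<integral>\<^sup>+\<xi>. ennreal (norm (u x * (cnj (F \<xi>) * ee (- (x \<bullet> \<xi>))))) \<partial>lborel \<partial>lborel) < \<infinity>"
      using ui Fi by (simp add: norm_mult ennreal_mult nn_integral_cmult nn_integral_multc integrable_iff_bounded ennreal_mult_less_top)
    note swap = integral_lborel_swap[OF _ this]
    have "(\<integral>x. u x * cnj (v x) \<partial>lborel) = (\<integral>x. \<integral>\<xi>. u x * (cnj (F \<xi>) * ee (- (x \<bullet> \<xi>))) \<partial>lborel \<partial>lborel)"
      unfolding v_def by (simp flip: Bochner_Integration.integral_cnj)
    also have "\<dots> = (\<integral>\<xi>. \<integral>x. u x * (cnj (F \<xi>) * ee (- (x \<bullet> \<xi>))) \<partial>lborel \<partial>lborel)"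
      by (rule swap) measurable
    also have "\<dots> = (\<integral>\<xi>. cnj (F \<xi>) * fourier u \<xi> \<partial>lborel)"
    proof (intro Bochner_Integration.integral_cong refl)
      fix \<xi>
      have "(\<integral>x. u x * (cnj (F \<xi>) * ee (- (x \<bullet> \<xi>))) \<partial>lborel) = (\<integral>x. cnj (F \<xi>) * (u x * ee (- (x \<bullet> \<xi>))) \<partial>lborel)"
        by (intro Bochner_Integration.integral_cong refl) (simp add: ac_simps)
      then show "(\<integral>x. u x * (cnj (F \<xi>) * ee (- (x \<bullet> \<xi>))) \<partial>lborel) = cnj (F \<xi>) * fourier u \<xi>"
        unfolding fourier_ee by simp
    qed
    also have "\<dots> = (\<integral>\<xi>. of_real ((cmod (F \<xi>))\<^sup>2) \<partial>lborel)"
      by (intro Bochner_Integration.integral_cong refl)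
         (auto simp: F_def indicator_def complex_norm_square mult.commute simp del: of_real_power)
    finally show ?thesis by (simp only: integral_complex_of_real)
  qed
  define U where "U = (\<integral>x. (cmod (u x))\<^sup>2 \<partial>lborel)"
  define W where "W = (\<integral>\<xi>. (cmod (fourier u \<xi>))\<^sup>2 \<partial>lborel)"
  define Q where "Q = (\<integral>\<xi>. (cmod (F \<xi>))\<^sup>2 \<partial>lborel)"
  have W0: "0 \<le> W" unfolding W_def by (intro integral_nonneg_AE) auto
  have Q0: "0 \<le> Q" unfolding Q_def by (intro integral_nonneg_AE) auto
  have UW: "U \<le> W"
  proof -
    have "l2_le u (sqrt W)"
      by (rule Plancherel_le[OF _ B r]) (auto simp: W_def intro: l2_le_sharp(2)[OF fu])
    from l2_le_sharp(3)[OF this] show ?thesis using W0 by (simp add: U_def)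
  qed
  have vQ: "(\<integral>x. (cmod (v x))\<^sup>2 \<partial>lborel) \<le> Q"
    using l2_le_sharp(3)[OF v2] Q0 by (simp add: Q_def)
  have uvi: "integrable lborel (\<lambda>x. u x * cnj (v x))"
    by (rule l2_le_integrable_mult[OF b l2_le_cnj[OF v2]])
  define p where "p x = u x * cnj (v x)" for x
  have pi: "integrable lborel p" using uvi unfolding p_def .
  have exp: "(cmod (u x - v x))\<^sup>2 = (cmod (u x))\<^sup>2 - 2 * Re (p x) + (cmod (v x))\<^sup>2" for x
    unfolding cmod_power2 p_def by (simp add: power2_eq_square algebra_simps)
  have int: "integrable lborel (\<lambda>x. (cmod (u x - v x))\<^sup>2)"
    unfolding exp using pi l2_le_sharp(1)[OF b] l2_le_sharp(1)[OF v2] by auto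
  have "(\<integral>x. (cmod (u x - v x))\<^sup>2 \<partial>lborel) = U - 2 * Re (\<integral>x. p x \<partial>lborel) + (\<integral>x. (cmod (v x))\<^sup>2 \<partial>lborel)"
    unfolding exp U_def using pi l2_le_sharp(1)[OF b] l2_le_sharp(1)[OF v2]
    by (simp add: Bochner_Integration.integral_add Bochner_Integration.integral_diff)
  also have "\<dots> \<le> W - Q"
    using UW vQ by (simp add: p_def uv flip: Q_def)
  also have "W - Q = (\<integral>\<xi>. (cmod (fourier u \<xi>))\<^sup>2 - (cmod (F \<xi>))\<^sup>2 \<partial>lborel)"
    unfolding W_def Q_def using l2_le_sharp(1)[OF fu] l2_le_sharp(1)[OF F2]
    by (simp add: Bochner_Integration.integral_diff)
  also have "\<dots> = (\<integral>\<xi>. (cmod (fourier u \<xi>))\<^sup>2 * indicator (- S) \<xi> \<partial>lborel)"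
    by (intro Bochner_Integration.integral_cong refl) (auto simp: F_def indicator_def)
  finally have le: "(\<integral>x. (cmod (u x - v x))\<^sup>2 \<partial>lborel) \<le> (\<integral>\<xi>. (cmod (fourier u \<xi>))\<^sup>2 * indicator (- S) \<xi> \<partial>lborel)" .
  have i2: "integrable lborel (\<lambda>\<xi>. (cmod (fourier u \<xi>))\<^sup>2 * indicator (- S) \<xi>)"
    by (rule Bochner_Integration.integrable_bound[OF l2_le_sharp(1)[OF fu]]) (auto simp: indicator_def)
  have "(\<integral>\<^sup>+x. ennreal ((cmod (u x - v x))\<^sup>2) \<partial>lborel) \<le>
      (\<integral>\<^sup>+\<xi>. ennreal ((cmod (fourier u \<xi>))\<^sup>2 * indicator (- S) \<xi>) \<partial>lborel)"
    using le by (simp add: nn_integral_eq_integral[OF int] nn_integral_eq_integral[OF i2] ennreal_leI)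
  also have "\<dots> = (\<integral>\<^sup>+\<xi>. ennreal ((cmod (fourier u \<xi>))\<^sup>2) * indicator (- S) \<xi> \<partial>lborel)"
    by (intro nn_integral_cong) (auto simp: indicator_def)
  finally show ?thesis unfolding v_def F_def .
qed

section \<open>A trilinear estimate for three square integrable functions\<close>

definition bilinear_op ::
  "('a \<times> 'a \<Rightarrow> complex) \<Rightarrow> ('a::euclidean_space \<Rightarrow> complex) \<Rightarrow> ('a \<Rightarrow> complex) \<Rightarrow> 'a \<Rightarrow> complex" where
  "bilinear_op K f g x = (\<integral>(y, w). K (y, w) * f (x - y) * g (x - w) \<partial>lborel)"

text \<open>
  The letter \<open>V\<close> stands for the volume of the ball of radius 2, which contains the support of every
  slice of \<open>K\<close>.
\<close>

locale unit_kernel =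
  fixes K :: "'a::euclidean_space \<times> 'a \<Rightarrow> complex" and V :: real
  assumes V_def: "V = measure lborel (cball (0::'a) 2)"
    and K_measurable [measurable]: "K \<in> borel_measurable borel"
    and K_le_1: "cmod (K p) \<le> 1"
    and K_support: "norm p > 2 \<Longrightarrow> K p = 0"
begin

lemma V_nonneg: "0 \<le> V"
  by (simp add: V_def)

text \<open>
  The Fourier transform of \<open>K\<close> in its first variable only. The second variable stays in physical space,
  where the support of \<open>K\<close> is bounded.
\<close>

definition khat :: "'a \<Rightarrow> 'a \<Rightarrow> complex" where
  "khat \<xi> w = fourier (\<lambda>y. K (y, w)) \<xi>"

lemma measurable_khat [measurable]: "(\<lambda>(\<xi>, w). khat \<xi> w) \<in> borel_measurable (borel \<Otimes>\<^sub>M borel)"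
  unfolding khat_def fourier_ee by measurable

lemma K_slice_support: "norm y > 2 \<Longrightarrow> K (y, w) = 0" "norm w > 2 \<Longrightarrow> K (y, w) = 0"
  using K_support[of "(y, w)"] norm_fst_le[of y w] norm_snd_le[of w y] by auto

lemma K_slice:
  "integrable lborel (\<lambda>y. K (y, w))" "l2_le (\<lambda>y. K (y, w)) (sqrt V)"
  using bounded_support_l2[of "\<lambda>y. K (y, w)" 1 2] K_le_1 K_slice_support by (auto simp: V_def)

lemma K_integrable: "integrable lborel K"
  using bounded_support_l2(1)[of K 1 2] K_le_1 K_support by auto

lemma K_slice_nn: "(\<integral>\<^sup>+y. ennreal (cmod (K (y, w))) \<partial>lborel) \<le> ennreal (V * indicator (cball 0 2) w)"
proof (cases "norm w > 2")
  case False
  have "(\<integral>\<^sup>+y. ennreal (cmod (K (y, w))) \<partial>lborel) \<le> (\<integral>\<^sup>+y. indicator (cball (0::'a) 2) y \<partial>lborel)"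
    using K_le_1 K_slice_support by (intro nn_integral_mono) (auto simp: indicator_def not_le intro: order_trans)
  also have "\<dots> = ennreal V"
    using emeasure_lborel_cball_finite[of "0::'a" 2] by (simp add: V_def emeasure_eq_ennreal_measure less_top)
  finally show ?thesis using False by (simp add: indicator_def)
qed (simp add: K_slice_support)

lemma khat_bound: "cmod (khat \<xi> w) \<le> V * indicator (cball 0 2) w"
proof -
  have "ennreal (cmod (khat \<xi> w)) \<le> ennreal (V * indicator (cball 0 2) w)"
    unfolding khat_def using norm_fourier_le K_slice_nn by (rule order_trans)
  then show ?thesis by (subst (asm) ennreal_le_iff) (simp_all add: V_nonneg)
qed

lemma khat_support: "norm w > 2 \<Longrightarrow> khat \<xi> w = 0"
  using khat_bound[of \<xi> w] by simp

lemma khat_le: "cmod (khat \<xi> w) \<le> V"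
  using khat_bound[of \<xi> w] V_nonneg by (cases "norm w \<le> 2") (auto simp: indicator_def)

lemma khat_l2: "l2_le (khat \<xi>) (V * sqrt V)"
  unfolding V_def[THEN arg_cong[where f = sqrt]]
  by (rule bounded_support_l2(2)) (auto simp: khat_le khat_support)

lemma fourier_khat: "fourier (khat \<xi>) \<eta> = fourier K (\<xi>, \<eta>)"
proof -
  let ?f = "\<lambda>y w. K (y, w) * ee (- (y \<bullet> \<xi>)) * ee (- (w \<bullet> \<eta>))"
  have "integrable (lborel \<Otimes>\<^sub>M lborel) (\<lambda>p. K p * ee (- (p \<bullet> (\<xi>, \<eta>))))"
    unfolding lborel_prod by (rule integrable_mult_ee[OF K_integrable]) measurable
  moreover have eq: "K p * ee (- (p \<bullet> (\<xi>, \<eta>))) = case_prod ?f p" for p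
    by (cases p) (simp add: inner_prod_def ee_add[symmetric] mult.assoc)
  ultimately have i: "integrable (lborel \<Otimes>\<^sub>M lborel) (case_prod ?f)" by simp
  have "fourier K (\<xi>, \<eta>) = (\<integral>p. case_prod ?f p \<partial>(lborel \<Otimes>\<^sub>M lborel))"
    unfolding fourier_ee lborel_prod eq ..
  also have "\<dots> = (\<integral>w. \<integral>y. ?f y w \<partial>lborel \<partial>lborel)"
    using lborel_pair.integral_snd[OF i] by simp
  also have "\<dots> = fourier (khat \<xi>) \<eta>"
    unfolding fourier_ee[of "khat \<xi>"] khat_def fourier_ee[of "\<lambda>y. K (y, _)"] by simp
  finally show ?thesis ..
qed

lemma bilinear_op_eq:
  assumes f: "integrable lborel f" and g: "integrable lborel g"
  shows "bilinear_op K f g x = (\<integral>w. (\<integral>y. K (y, w) * f (x - y) \<partial>lborel) * g (x - w) \<partial>lborel)"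
proof -
  note [measurable] = borel_measurable_integrable[OF f, simplified] borel_measurable_integrable[OF g, simplified]
  let ?f = "\<lambda>y w. K (y, w) * f (x - y) * g (x - w)"
  have m: "(\<lambda>x. ennreal (cmod (f x))) \<in> borel_measurable borel" "(\<lambda>x. ennreal (cmod (g x))) \<in> borel_measurable borel"
    by measurable
  have "(\<integral>\<^sup>+y. \<integral>\<^sup>+w. ennreal (norm (?f y w)) \<partial>lborel \<partial>lborel) \<le>
      (\<integral>\<^sup>+y. \<integral>\<^sup>+w. ennreal (cmod (f (x - y))) * ennreal (cmod (g (x - w))) \<partial>lborel \<partial>lborel)"
  proof (intro nn_integral_mono)
    fix y w
    have "norm (?f y w) \<le> 1 * cmod (f (x - y)) * cmod (g (x - w))"
      unfolding norm_mult by (intro mult_right_mono K_le_1) auto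
    then show "ennreal (norm (?f y w)) \<le> ennreal (cmod (f (x - y))) * ennreal (cmod (g (x - w)))"
      by (simp flip: ennreal_mult add: ennreal_leI)
  qed
  also have "\<dots> < \<infinity>"
    using f g by (simp add: nn_integral_cmult nn_integral_multc nn_integral_lborel_translate(4)[OF m(1)]
      nn_integral_lborel_translate(4)[OF m(2)] integrable_iff_bounded ennreal_mult_less_top)
  finally have i: "integrable (lborel \<Otimes>\<^sub>M lborel) (case_prod ?f)"
    by (intro integrable_lborel_pairI) measurable
  have "bilinear_op K f g x = (\<integral>p. case_prod ?f p \<partial>(lborel \<Otimes>\<^sub>M lborel))"
    unfolding bilinear_op_def lborel_prod ..
  also have "\<dots> = (\<integral>w. \<integral>y. ?f y w \<partial>lborel \<partial>lborel)"
    using lborel_pair.integral_snd[OF i] by simp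
  also have "\<dots> = (\<integral>w. (\<integral>y. K (y, w) * f (x - y) \<partial>lborel) * g (x - w) \<partial>lborel)"
    by simp
  finally show ?thesis .
qed

lemma pair_l2_product:
  fixes g2 g3 :: "'a \<Rightarrow> complex"
  assumes g2: "l2_le g2 b2" and g3: "l2_le g3 b3"
    and [measurable]: "D \<in> borel_measurable (borel \<Otimes>\<^sub>M borel)"
    and D: "(\<integral>\<^sup>+x. \<integral>\<^sup>+w. ennreal ((cmod (D (x, w)))\<^sup>2) \<partial>lborel \<partial>lborel) \<le> ennreal (E\<^sup>2)" and "0 \<le> E"
  shows "(\<integral>\<^sup>+x. \<integral>\<^sup>+w. ennreal (cmod (D (x, w) * g2 (x - w) * cnj (g3 x))) \<partial>lborel \<partial>lborel) \<le> ennreal (E * (b2 * b3))"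
proof -
  note [measurable] = l2_le_measurable[OF g2] l2_le_measurable[OF g3]
  let ?M = "lborel \<Otimes>\<^sub>M lborel :: ('a \<times> 'a) measure"
  have m: "(\<lambda>x. ennreal ((cmod (g2 x))\<^sup>2)) \<in> borel_measurable borel" by measurable
  have "(\<integral>\<^sup>+p. ennreal (cmod (D p)) * ennreal (cmod (g2 (fst p - snd p)) * cmod (g3 (fst p))) \<partial>?M)
      \<le> ennreal (E * (b2 * b3))"
  proof (rule Cauchy_Schwarz_bound)
    have "(\<integral>\<^sup>+p. (ennreal (cmod (D p)))\<^sup>2 \<partial>?M) = (\<integral>\<^sup>+x. \<integral>\<^sup>+w. ennreal ((cmod (D (x, w)))\<^sup>2) \<partial>lborel \<partial>lborel)"
      by (subst lborel.nn_integral_fst[symmetric]) (auto simp: ennreal_power)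
    then show "(\<integral>\<^sup>+p. (ennreal (cmod (D p)))\<^sup>2 \<partial>?M) \<le> ennreal (E\<^sup>2)" using D by simp
    have "(\<integral>\<^sup>+p. (ennreal (cmod (g2 (fst p - snd p)) * cmod (g3 (fst p))))\<^sup>2 \<partial>?M) =
        (\<integral>\<^sup>+x. \<integral>\<^sup>+w. ennreal ((cmod (g2 (x - w)))\<^sup>2) * ennreal ((cmod (g3 x))\<^sup>2) \<partial>lborel \<partial>lborel)"
      by (subst lborel.nn_integral_fst[symmetric]) (auto simp: ennreal_power power_mult_distrib ennreal_mult)
    also have "\<dots> = (\<integral>\<^sup>+x. ennreal ((cmod (g2 x))\<^sup>2) \<partial>lborel) * (\<integral>\<^sup>+x. ennreal ((cmod (g3 x))\<^sup>2) \<partial>lborel)"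
      by (simp add: nn_integral_multc nn_integral_lborel_translate(4)[OF m] nn_integral_cmult)
    also have "\<dots> \<le> ennreal (b2\<^sup>2) * ennreal (b3\<^sup>2)"
      by (intro mult_mono l2_le_bound g2 g3) auto
    also have "\<dots> = ennreal ((b2 * b3)\<^sup>2)" by (simp add: power_mult_distrib ennreal_mult)
    finally show "(\<integral>\<^sup>+p. (ennreal (cmod (g2 (fst p - snd p)) * cmod (g3 (fst p))))\<^sup>2 \<partial>?M) \<le> ennreal ((b2 * b3)\<^sup>2)" .
  qed (use \<open>0 \<le> E\<close> l2_le_nonneg[OF g2] l2_le_nonneg[OF g3] in auto)
  also have "(\<integral>\<^sup>+p. ennreal (cmod (D p)) * ennreal (cmod (g2 (fst p - snd p)) * cmod (g3 (fst p))) \<partial>?M) =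
      (\<integral>\<^sup>+x. \<integral>\<^sup>+w. ennreal (cmod (D (x, w) * g2 (x - w) * cnj (g3 x))) \<partial>lborel \<partial>lborel)"
    by (subst lborel.nn_integral_fst[symmetric]) (auto simp: norm_mult ennreal_mult mult.assoc)
  finally show ?thesis .
qed

text \<open>
  Split \<open>h\<close> at the frequency set \<open>S\<close>. Over \<open>S\<close>, the function \<open>h\<close> is a superposition of characters. If \<open>h\<close>
  is a single character of frequency \<open>\<xi>\<close>, then \<open>bilinear_op K h g2\<close> is this character times the convolution of
  \<open>g2\<close> with \<open>khat \<xi>\<close>, and this convolution has operator norm at most \<open>m\<close> on \<open>L\<^sup>2\<close>; integrating over \<open>S\<close>
  costs the square root of its measure. Outside \<open>S\<close> the Hilbert-Schmidt norm of the kernel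
  \<open>(x, w) \<mapsto> (h * K(\<cdot>, w))(x)\<close> is computed by the Plancherel inequality in \<open>x\<close> for each \<open>w\<close>.
\<close>

lemma trilinear_split:
  assumes h: "l2_le h a" and hr: "\<And>x. norm x > r1 \<Longrightarrow> h x = 0"
    and g2: "l2_le g2 b2" and g2r: "\<And>x. norm x > r2 \<Longrightarrow> g2 x = 0"
    and g3: "l2_le g3 b3" and g3r: "\<And>x. norm x > r3 \<Longrightarrow> g3 x = 0"
    and S[measurable]: "S \<in> sets borel" and S_fin: "emeasure lborel S \<le> ennreal (s\<^sup>2)" and s0: "0 \<le> s"
    and m: "\<And>\<xi> \<eta>. \<xi> \<in> S \<Longrightarrow> cmod (fourier K (\<xi>, \<eta>)) \<le> m"
    and E: "(\<integral>\<^sup>+\<xi>. ennreal ((cmod (fourier h \<xi>))\<^sup>2) * (\<integral>\<^sup>+w. ennreal ((cmod (khat \<xi> w))\<^sup>2) \<partial>lborel) * indicator (- S) \<xi> \<partial>lborel) \<le> ennreal (E\<^sup>2)"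
    and E0: "0 \<le> E" and m0: "0 \<le> m"
  shows "cmod (L2_pairing (bilinear_op K h g2) g3) \<le> (E + m * s * a) * b2 * b3"
proof -
  note [measurable] = l2_le_measurable[OF h] l2_le_measurable[OF g2] l2_le_measurable[OF g3]
  have hi: "integrable lborel h" by (rule l2_le_integrable[OF h hr])
  have g2i: "integrable lborel g2" by (rule l2_le_integrable[OF g2 g2r])
  have g3i: "integrable lborel g3" by (rule l2_le_integrable[OF g3 g3r])
  have a0: "0 \<le> a" and b0: "0 \<le> b2" "0 \<le> b3" using h g2 g3 by (auto dest: l2_le_nonneg)
  have SI: "emeasure lborel S < \<infinity>" using S_fin by (rule le_less_trans) simp
  \<comment> \<open>For fixed \<open>w\<close>, \<open>v\<close> is the part of \<open>k\<close> with frequencies in \<open>S\<close>.\<close>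
  define k where "k x w = (\<integral>y. K (y, w) * h (x - y) \<partial>lborel)" for x w
  have [measurable]: "(\<lambda>(x, w). k x w) \<in> borel_measurable (borel \<Otimes>\<^sub>M borel)" unfolding k_def by measurable
  define v where "v x w = (\<integral>\<xi>. indicator S \<xi> * (khat \<xi> w * fourier h \<xi>) * ee (x \<bullet> \<xi>) \<partial>lborel)" for x w
  have [measurable]: "(\<lambda>(x, w). v x w) \<in> borel_measurable (borel \<Otimes>\<^sub>M borel)" unfolding v_def by measurable
  have fk: "fourier (\<lambda>x. k x w) \<xi> = khat \<xi> w * fourier h \<xi>" for w \<xi>
    unfolding k_def khat_def by (rule fourier_convolution[OF K_slice(1) hi])
  have "(\<integral>\<^sup>+x. \<integral>\<^sup>+w. ennreal ((cmod (k x w - v x w))\<^sup>2) \<partial>lborel \<partial>lborel) =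
     (\<integral>\<^sup>+w. \<integral>\<^sup>+x. ennreal ((cmod (k x w - v x w))\<^sup>2) \<partial>lborel \<partial>lborel)"
    by (rule nn_integral_lborel_swap) measurable
  also have "\<dots> \<le> (\<integral>\<^sup>+w. \<integral>\<^sup>+\<xi>. ennreal ((cmod (fourier (\<lambda>x. k x w) \<xi>))\<^sup>2) * indicator (- S) \<xi> \<partial>lborel \<partial>lborel)"
  proof (rule nn_integral_mono)
    fix w
    have b: "cmod (k x w) \<le> sqrt V * a" for x
      unfolding k_def by (rule convolution_bound[OF K_slice(2) h])
    have c: "norm x > 2 + r1 \<Longrightarrow> k x w = 0" for x
      unfolding k_def by (rule convolution_support[OF K_slice_support(1) hr])
    have "(\<lambda>x. k x w) \<in> borel_measurable borel" by measurable
    from Plancherel_truncation[OF this b c S SI]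
    show "(\<integral>\<^sup>+x. ennreal ((cmod (k x w - v x w))\<^sup>2) \<partial>lborel) \<le>
        (\<integral>\<^sup>+\<xi>. ennreal ((cmod (fourier (\<lambda>x. k x w) \<xi>))\<^sup>2) * indicator (- S) \<xi> \<partial>lborel)"
      unfolding v_def fk .
  qed
  also have "\<dots> = (\<integral>\<^sup>+\<xi>. \<integral>\<^sup>+w. ennreal ((cmod (fourier h \<xi>))\<^sup>2) * ennreal ((cmod (khat \<xi> w))\<^sup>2) * indicator (- S) \<xi> \<partial>lborel \<partial>lborel)"
    unfolding fk norm_mult power_mult_distrib
    by (subst nn_integral_lborel_swap) (auto simp: ennreal_mult ac_simps)
  also have "\<dots> = (\<integral>\<^sup>+\<xi>. ennreal ((cmod (fourier h \<xi>))\<^sup>2) * (\<integral>\<^sup>+w. ennreal ((cmod (khat \<xi> w))\<^sup>2) \<partial>lborel) * indicator (- S) \<xi> \<partial>lborel)"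
    by (simp add: nn_integral_cmult nn_integral_multc)
  also note E
  finally have D: "(\<integral>\<^sup>+x. \<integral>\<^sup>+w. ennreal ((cmod (case_prod (\<lambda>x w. k x w - v x w) (x, w)))\<^sup>2) \<partial>lborel \<partial>lborel) \<le> ennreal (E\<^sup>2)"
    by simp
  have m1: "(\<lambda>(x, w). k x w - v x w) \<in> borel_measurable (borel \<Otimes>\<^sub>M borel)" by measurable
  from pair_l2_product[OF g2 g3 m1 D E0]
  have rest: "(\<integral>\<^sup>+x. \<integral>\<^sup>+w. ennreal (cmod ((k x w - v x w) * g2 (x - w) * cnj (g3 x))) \<partial>lborel \<partial>lborel) \<le> ennreal (E * (b2 * b3))"
    by simp
  \<comment> \<open>\<open>A \<xi>\<close> is the form with \<open>h\<close> replaced by the character of frequency \<open>\<xi>\<close>.\<close>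
  define A where "A \<xi> = (\<integral>x. (\<integral>w. khat \<xi> w * g2 (x - w) \<partial>lborel) * (ee (x \<bullet> \<xi>) * cnj (g3 x)) \<partial>lborel)" for \<xi>
  have A: "cmod (A \<xi>) \<le> m * b2 * b3" if "\<xi> \<in> S" for \<xi>
  proof -
    have "l2_le (\<lambda>x. \<integral>w. khat \<xi> w * g2 (x - w) \<partial>lborel) (m * b2)"
      by (rule l2_le_convolution_fourier[OF khat_l2 khat_support g2 g2r]) (auto simp: fourier_khat m that)
    moreover have "l2_le (\<lambda>x. ee (x \<bullet> \<xi>) * cnj (g3 x)) b3"
      by (rule l2_le_dominated[OF g3]) (auto simp: norm_mult)
    ultimately show ?thesis
      unfolding A_def by (rule l2_le_integral_mult)
  qed
  have SH: "(\<integral>\<^sup>+\<xi>. indicator S \<xi> * ennreal (cmod (fourier h \<xi>)) \<partial>lborel) \<le> ennreal (s * a)"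
  proof (rule Cauchy_Schwarz_bound)
    have "(\<integral>\<^sup>+\<xi>. (indicator S \<xi>)\<^sup>2 \<partial>lborel) = (\<integral>\<^sup>+\<xi>. indicator S \<xi> \<partial>lborel)"
      by (intro nn_integral_cong) (auto simp: indicator_def)
    then show "(\<integral>\<^sup>+\<xi>. (indicator S \<xi> :: ennreal)\<^sup>2 \<partial>lborel) \<le> ennreal (s\<^sup>2)" using S_fin by simp
    show "(\<integral>\<^sup>+\<xi>. (ennreal (cmod (fourier h \<xi>)))\<^sup>2 \<partial>lborel) \<le> ennreal (a\<^sup>2)"
      by (rule l2_le_bound'[OF Bessel[OF hi h]])
  qed (use s0 a0 in auto)
  let ?t = "\<lambda>x w \<xi>. indicator S \<xi> * (khat \<xi> w * fourier h \<xi>) * ee (x \<bullet> \<xi>) * g2 (x - w) * cnj (g3 x)"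
  have mg: "(\<lambda>x. ennreal (cmod (g2 x))) \<in> borel_measurable borel" by measurable
  have fin: "(\<integral>\<^sup>+x. \<integral>\<^sup>+w. \<integral>\<^sup>+\<xi>. ennreal (cmod (?t x w \<xi>)) \<partial>lborel \<partial>lborel \<partial>lborel) < \<infinity>"
  proof -
    have "(\<integral>\<^sup>+x. \<integral>\<^sup>+w. \<integral>\<^sup>+\<xi>. ennreal (cmod (?t x w \<xi>)) \<partial>lborel \<partial>lborel \<partial>lborel) \<le>
        (\<integral>\<^sup>+x. \<integral>\<^sup>+w. \<integral>\<^sup>+\<xi>. ennreal V * (indicator S \<xi> * ennreal (cmod (fourier h \<xi>))) * ennreal (cmod (g2 (x - w))) * ennreal (cmod (g3 x)) \<partial>lborel \<partial>lborel \<partial>lborel)"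
    proof (intro nn_integral_mono)
      fix x w \<xi>
      have "cmod (?t x w \<xi>) \<le> V * (indicator S \<xi> * cmod (fourier h \<xi>)) * cmod (g2 (x - w)) * cmod (g3 x)"
        using khat_le[of \<xi> w] by (auto simp: norm_mult indicator_def intro!: mult_right_mono)
      then have "ennreal (cmod (?t x w \<xi>)) \<le> ennreal (V * (indicator S \<xi> * cmod (fourier h \<xi>)) * cmod (g2 (x - w)) * cmod (g3 x))"
        by (rule ennreal_leI)
      then show "ennreal (cmod (?t x w \<xi>)) \<le> ennreal V * (indicator S \<xi> * ennreal (cmod (fourier h \<xi>))) * ennreal (cmod (g2 (x - w))) * ennreal (cmod (g3 x))"
        by (simp add: ennreal_mult ennreal_indicator V_nonneg)
    qed
    also have "\<dots> = ennreal V * (\<integral>\<^sup>+\<xi>. indicator S \<xi> * ennreal (cmod (fourier h \<xi>)) \<partial>lborel) *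
        (\<integral>\<^sup>+x. ennreal (cmod (g2 x)) \<partial>lborel) * (\<integral>\<^sup>+x. ennreal (cmod (g3 x)) \<partial>lborel)"
      by (simp add: nn_integral_multc nn_integral_cmult nn_integral_lborel_translate(4)[OF mg])
    also have "\<dots> < \<infinity>"
      using g2i g3i le_less_trans[OF SH] by (simp add: integrable_iff_bounded ennreal_mult_less_top)
    finally show ?thesis .
  qed
  have sub: "(\<integral>w. v x w * g2 (x - w) * cnj (g3 x) \<partial>lborel) =
      (\<integral>\<xi>. indicator S \<xi> * fourier h \<xi> * ((\<integral>w. khat \<xi> w * g2 (x - w) \<partial>lborel) * (ee (x \<bullet> \<xi>) * cnj (g3 x))) \<partial>lborel)"
    if f: "(\<integral>\<^sup>+w. \<integral>\<^sup>+\<xi>. ennreal (cmod (?t x w \<xi>)) \<partial>lborel \<partial>lborel) < \<infinity>" for x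
  proof -
    have "(\<integral>w. v x w * g2 (x - w) * cnj (g3 x) \<partial>lborel) = (\<integral>w. \<integral>\<xi>. ?t x w \<xi> \<partial>lborel \<partial>lborel)"
      unfolding v_def by simp
    also have "\<dots> = (\<integral>\<xi>. \<integral>w. ?t x w \<xi> \<partial>lborel \<partial>lborel)"
      by (rule integral_lborel_swap[OF _ f]) measurable
    also have "\<dots> = (\<integral>\<xi>. \<integral>w. (indicator S \<xi> * fourier h \<xi> * (ee (x \<bullet> \<xi>) * cnj (g3 x))) * (khat \<xi> w * g2 (x - w)) \<partial>lborel \<partial>lborel)"
      by (simp add: ac_simps)
    also have "\<dots> = (\<integral>\<xi>. indicator S \<xi> * fourier h \<xi> * ((\<integral>w. khat \<xi> w * g2 (x - w) \<partial>lborel) * (ee (x \<bullet> \<xi>) * cnj (g3 x))) \<partial>lborel)"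
      by (simp add: ac_simps)
    finally show ?thesis .
  qed
  have AEf: "AE x in lborel. (\<integral>\<^sup>+w. \<integral>\<^sup>+\<xi>. ennreal (cmod (?t x w \<xi>)) \<partial>lborel \<partial>lborel) < \<infinity>"
    using nn_integral_PInf_AE[OF _ fin[THEN less_imp_neq]] by (simp add: less_top)
  have main: "cmod (\<integral>x. \<integral>w. v x w * g2 (x - w) * cnj (g3 x) \<partial>lborel \<partial>lborel) \<le> m * s * a * b2 * b3"
  proof -
    let ?q = "\<lambda>x \<xi>. indicator S \<xi> * fourier h \<xi> * ((\<integral>w. khat \<xi> w * g2 (x - w) \<partial>lborel) * (ee (x \<bullet> \<xi>) * cnj (g3 x)))"
    have qf: "(\<integral>\<^sup>+x. \<integral>\<^sup>+\<xi>. ennreal (cmod (?q x \<xi>)) \<partial>lborel \<partial>lborel) < \<infinity>"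
    proof -
      have "(\<integral>\<^sup>+x. \<integral>\<^sup>+\<xi>. ennreal (cmod (?q x \<xi>)) \<partial>lborel \<partial>lborel) \<le> (\<integral>\<^sup>+x. \<integral>\<^sup>+\<xi>. \<integral>\<^sup>+w. ennreal (cmod (?t x w \<xi>)) \<partial>lborel \<partial>lborel \<partial>lborel)"
      proof (intro nn_integral_mono)
        fix x \<xi>
        have "?q x \<xi> = (\<integral>w. (indicator S \<xi> * fourier h \<xi> * (ee (x \<bullet> \<xi>) * cnj (g3 x))) * (khat \<xi> w * g2 (x - w)) \<partial>lborel)"
          by (simp add: ac_simps)
        also have "\<dots> = (\<integral>w. ?t x w \<xi> \<partial>lborel)" by (simp add: ac_simps)
        finally have "?q x \<xi> = (\<integral>w. ?t x w \<xi> \<partial>lborel)" .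
        then show "ennreal (cmod (?q x \<xi>)) \<le> (\<integral>\<^sup>+w. ennreal (cmod (?t x w \<xi>)) \<partial>lborel)"
          by (simp only: norm_integral_le_nn_integral)
      qed
      also have "\<dots> = (\<integral>\<^sup>+x. \<integral>\<^sup>+w. \<integral>\<^sup>+\<xi>. ennreal (cmod (?t x w \<xi>)) \<partial>lborel \<partial>lborel \<partial>lborel)"
        by (intro nn_integral_cong nn_integral_lborel_swap) measurable
      finally show ?thesis using fin by simp
    qed
    have "(\<integral>x. \<integral>w. v x w * g2 (x - w) * cnj (g3 x) \<partial>lborel \<partial>lborel) = (\<integral>x. \<integral>\<xi>. ?q x \<xi> \<partial>lborel \<partial>lborel)"
    proof (rule integral_cong_AE)
      show "AE x in lborel. (\<integral>w. v x w * g2 (x - w) * cnj (g3 x) \<partial>lborel) = (\<integral>\<xi>. ?q x \<xi> \<partial>lborel)"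
        using AEf by eventually_elim (rule sub)
    qed measurable
    also have "\<dots> = (\<integral>\<xi>. \<integral>x. ?q x \<xi> \<partial>lborel \<partial>lborel)"
      by (rule integral_lborel_swap[OF _ qf]) measurable
    also have "\<dots> = (\<integral>\<xi>. indicator S \<xi> * fourier h \<xi> * A \<xi> \<partial>lborel)"
      unfolding A_def by simp
    finally have eq: "(\<integral>x. \<integral>w. v x w * g2 (x - w) * cnj (g3 x) \<partial>lborel \<partial>lborel) = (\<integral>\<xi>. indicator S \<xi> * fourier h \<xi> * A \<xi> \<partial>lborel)" .
    have "ennreal (cmod (\<integral>\<xi>. indicator S \<xi> * fourier h \<xi> * A \<xi> \<partial>lborel)) \<le>
        (\<integral>\<^sup>+\<xi>. ennreal (cmod (indicator S \<xi> * fourier h \<xi> * A \<xi>)) \<partial>lborel)"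
      by (rule norm_integral_le_nn_integral)
    also have "\<dots> \<le> (\<integral>\<^sup>+\<xi>. (indicator S \<xi> * ennreal (cmod (fourier h \<xi>))) * ennreal (m * b2 * b3) \<partial>lborel)"
    proof (intro nn_integral_mono)
      fix \<xi>
      show "ennreal (cmod (indicator S \<xi> * fourier h \<xi> * A \<xi>)) \<le> (indicator S \<xi> * ennreal (cmod (fourier h \<xi>))) * ennreal (m * b2 * b3)"
        using A[of \<xi>] m0 b0 by (cases "\<xi> \<in> S") (auto simp: norm_mult simp flip: ennreal_mult intro!: ennreal_leI mult_left_mono)
    qed
    also have "\<dots> = (\<integral>\<^sup>+\<xi>. indicator S \<xi> * ennreal (cmod (fourier h \<xi>)) \<partial>lborel) * ennreal (m * b2 * b3)"
      by (rule nn_integral_multc) measurable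
    also have "\<dots> \<le> ennreal (s * a) * ennreal (m * b2 * b3)" by (intro mult_right_mono SH) auto
    also have "\<dots> = ennreal (m * s * a * b2 * b3)"
      using m0 b0 s0 a0 by (simp add: ac_simps flip: ennreal_mult)
    finally show ?thesis using m0 b0 s0 a0 unfolding eq by (subst (asm) ennreal_le_iff) auto
  qed
  have vf: "(\<integral>\<^sup>+x. \<integral>\<^sup>+w. ennreal (cmod (v x w * g2 (x - w) * cnj (g3 x))) \<partial>lborel \<partial>lborel) < \<infinity>"
  proof -
    have "(\<integral>\<^sup>+x. \<integral>\<^sup>+w. ennreal (cmod (v x w * g2 (x - w) * cnj (g3 x))) \<partial>lborel \<partial>lborel) \<le>
       (\<integral>\<^sup>+x. \<integral>\<^sup>+w. \<integral>\<^sup>+\<xi>. ennreal (cmod (?t x w \<xi>)) \<partial>lborel \<partial>lborel \<partial>lborel)"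
    proof (intro nn_integral_mono)
      fix x w
      have "v x w * g2 (x - w) * cnj (g3 x) = (\<integral>\<xi>. ?t x w \<xi> \<partial>lborel)" unfolding v_def by simp
      then show "ennreal (cmod (v x w * g2 (x - w) * cnj (g3 x))) \<le> (\<integral>\<^sup>+\<xi>. ennreal (cmod (?t x w \<xi>)) \<partial>lborel)"
        by (simp only: norm_integral_le_nn_integral)
    qed
    then show ?thesis using fin by (rule le_less_trans)
  qed
  let ?r = "\<lambda>x w. (k x w - v x w) * g2 (x - w) * cnj (g3 x)"
  let ?v = "\<lambda>x w. v x w * g2 (x - w) * cnj (g3 x)"
  have mr: "case_prod ?r \<in> borel_measurable (borel \<Otimes>\<^sub>M borel)" and mv: "case_prod ?v \<in> borel_measurable (borel \<Otimes>\<^sub>M borel)"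
    by measurable
  have rf: "(\<integral>\<^sup>+x. \<integral>\<^sup>+w. ennreal (cmod (?r x w)) \<partial>lborel \<partial>lborel) < \<infinity>"
    using rest by (rule le_less_trans) simp
  have R_le: "cmod (\<integral>x. \<integral>w. ?r x w \<partial>lborel \<partial>lborel) \<le> E * (b2 * b3)"
  proof -
    have "ennreal (cmod (\<integral>x. \<integral>w. ?r x w \<partial>lborel \<partial>lborel)) \<le> (\<integral>\<^sup>+x. ennreal (cmod (\<integral>w. ?r x w \<partial>lborel)) \<partial>lborel)"
      by (rule norm_integral_le_nn_integral)
    also have "\<dots> \<le> (\<integral>\<^sup>+x. \<integral>\<^sup>+w. ennreal (cmod (?r x w)) \<partial>lborel \<partial>lborel)"
      by (rule nn_integral_mono) (rule norm_integral_le_nn_integral)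
    also have "\<dots> \<le> ennreal (E * (b2 * b3))" by (rule rest)
    finally show ?thesis
      using E0 b0 by (simp add: ennreal_le_iff)
  qed
  have "L2_pairing (bilinear_op K h g2) g3 = (\<integral>x. \<integral>w. k x w * g2 (x - w) * cnj (g3 x) \<partial>lborel \<partial>lborel)"
    unfolding L2_pairing_def bilinear_op_eq[OF hi g2i] k_def by simp
  also have "\<dots> = (\<integral>x. (\<integral>w. ?r x w \<partial>lborel) + (\<integral>w. ?v x w \<partial>lborel) \<partial>lborel)"
  proof (rule integral_cong_AE)
    show "AE x in lborel. (\<integral>w. k x w * g2 (x - w) * cnj (g3 x) \<partial>lborel) = (\<integral>w. ?r x w \<partial>lborel) + (\<integral>w. ?v x w \<partial>lborel)"
      using AE_integrable_lborel_fst[OF mr rf] AE_integrable_lborel_fst[OF mv vf]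
    proof eventually_elim
      case (elim x)
      then show ?case
        by (subst Bochner_Integration.integral_add[symmetric]) (auto simp: algebra_simps)
    qed
  qed measurable
  also have "\<dots> = (\<integral>x. \<integral>w. ?r x w \<partial>lborel \<partial>lborel) + (\<integral>x. \<integral>w. ?v x w \<partial>lborel \<partial>lborel)"
    by (intro Bochner_Integration.integral_add integrable_lborel_fst[OF mr rf] integrable_lborel_fst[OF mv vf])
  finally have "cmod (L2_pairing (bilinear_op K h g2) g3) \<le>
      cmod (\<integral>x. \<integral>w. ?r x w \<partial>lborel \<partial>lborel) + cmod (\<integral>x. \<integral>w. ?v x w \<partial>lborel \<partial>lborel)"
    by (simp only: norm_triangle_ineq)
  also have "\<dots> \<le> E * (b2 * b3) + m * s * a * b2 * b3"
    by (rule add_mono[OF R_le main])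
  also have "\<dots> = (E + m * s * a) * b2 * b3" by (simp add: algebra_simps)
  finally show ?thesis .
qed

end

section \<open>The trilinear form\<close>

text \<open>
  Lets the measurability prover treat the projections of a pair with the Borel structure of the
  product space.
\<close>

lemma borel_measurable_fst_snd [measurable (raw)]:
  fixes f :: "'c \<Rightarrow> 'a::euclidean_space \<times> 'b::euclidean_space"
  assumes "f \<in> borel_measurable M"
  shows "(\<lambda>x. fst (f x)) \<in> borel_measurable M" "(\<lambda>x. snd (f x)) \<in> borel_measurable M"
  using assms measurable_fst measurable_snd unfolding borel_prod[symmetric]
  by (auto intro: measurable_compose)

definition trilinear ::
  "('a \<times> 'a \<Rightarrow> complex) \<Rightarrow> ('a::euclidean_space \<Rightarrow> complex) \<Rightarrow> ('a \<Rightarrow> complex) \<Rightarrow> ('a \<Rightarrow> complex) \<Rightarrow> complex" where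
  "trilinear K f g h = (\<integral>x. \<integral>p. K p * f (x - fst p) * g (x - snd p) * cnj (h x) \<partial>lborel \<partial>lborel)"

lemma trilinear_eq: "trilinear K f g h = L2_pairing (bilinear_op K f g) h"
  by (simp add: trilinear_def L2_pairing_def bilinear_op_def case_prod_unfold)

text \<open>
  The last two functions enter the trilinear estimates only through products of a translate of one
  with the other. A bound for these products covers at once the two cases in which one function is
  square integrable and the other one bounded. The local conditions make the norms on balls finite.
\<close>

definition l2_pair :: "('a::euclidean_space \<Rightarrow> complex) \<Rightarrow> ('a \<Rightarrow> complex) \<Rightarrow> real \<Rightarrow> bool" where
  "l2_pair g h B \<longleftrightarrow> g \<in> borel_measurable borel \<and> h \<in> borel_measurable borel \<and>
     (\<forall>v. l2_le (\<lambda>x. g (x - v) * h x) B) \<and>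
     (\<forall>z r. (\<integral>\<^sup>+x. ennreal ((cmod (g x))\<^sup>2) * indicator (cball 0 r) (x - z) \<partial>lborel) < \<infinity>) \<and>
     (\<forall>z r. (\<integral>\<^sup>+x. ennreal ((cmod (h x))\<^sup>2) * indicator (cball 0 r) (x - z) \<partial>lborel) < \<infinity>)"

text \<open>
  For fixed \<open>p\<close> the integral in \<open>x\<close> pairs a translate of \<open>f\<close> with a product controlled by \<open>l2_pair\<close>.
\<close>

lemma trilinear_nn:
  fixes K :: "'a::euclidean_space \<times> 'a \<Rightarrow> complex"
  assumes [measurable]: "K \<in> borel_measurable borel" and K: "(\<integral>\<^sup>+p. ennreal (cmod (K p)) \<partial>lborel) \<le> ennreal W" and W: "0 \<le> W"
    and f: "l2_le f a" and gh: "l2_pair g h B"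
  shows "(\<integral>\<^sup>+x. \<integral>\<^sup>+p. ennreal (cmod (K p * f (x - fst p) * g (x - snd p) * cnj (h x))) \<partial>lborel \<partial>lborel) \<le> ennreal (W * a * B)"
proof -
  have [measurable]: "f \<in> borel_measurable borel" "g \<in> borel_measurable borel" "h \<in> borel_measurable borel"
    using f gh by (auto simp: l2_pair_def l2_le_def)
  have l: "l2_le (\<lambda>x. g (x - v) * h x) B" for v using gh by (simp add: l2_pair_def)
  have a0: "0 \<le> a" "0 \<le> B" using l2_le_nonneg[OF f] l2_le_nonneg[OF l] by auto
  have "(\<integral>\<^sup>+x. \<integral>\<^sup>+p. ennreal (cmod (K p * f (x - fst p) * g (x - snd p) * cnj (h x))) \<partial>lborel \<partial>lborel) =
      (\<integral>\<^sup>+p. \<integral>\<^sup>+x. ennreal (cmod (K p * f (x - fst p) * g (x - snd p) * cnj (h x))) \<partial>lborel \<partial>lborel)"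
    by (rule nn_integral_lborel_swap) measurable
  also have "\<dots> = (\<integral>\<^sup>+p. ennreal (cmod (K p)) * (\<integral>\<^sup>+x. ennreal (cmod (f (x - fst p)) * cmod (g (x - snd p) * h x)) \<partial>lborel) \<partial>lborel)"
    by (subst nn_integral_cmult[symmetric]) (auto simp: norm_mult mult.assoc simp flip: ennreal_mult)
  also have "\<dots> \<le> (\<integral>\<^sup>+p. ennreal (cmod (K p)) * ennreal (a * B) \<partial>lborel)"
    by (intro nn_integral_mono mult_left_mono l2_le_mult_nn_integral l2_le_affine f l) auto
  also have "\<dots> = (\<integral>\<^sup>+p. ennreal (cmod (K p)) \<partial>lborel) * ennreal (a * B)"
    by (rule nn_integral_multc) measurable
  also have "\<dots> \<le> ennreal W * ennreal (a * B)" by (intro mult_right_mono K) auto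
  also have "\<dots> = ennreal (W * a * B)" using W a0 by (simp add: mult.assoc flip: ennreal_mult)
  finally show ?thesis .
qed

lemma trilinear_bound:
  fixes K :: "'a::euclidean_space \<times> 'a \<Rightarrow> complex"
  assumes "K \<in> borel_measurable borel" "(\<integral>\<^sup>+p. ennreal (cmod (K p)) \<partial>lborel) \<le> ennreal W" and W: "0 \<le> W"
    and f: "l2_le f a" and gh: "l2_pair g h B"
  shows "cmod (trilinear K f g h) \<le> W * a * B"
proof -
  have l: "l2_le (\<lambda>x. g (x - 0) * h x) B" using gh unfolding l2_pair_def by blast
  have "ennreal (cmod (trilinear K f g h)) \<le> (\<integral>\<^sup>+x. ennreal (cmod (\<integral>p. K p * f (x - fst p) * g (x - snd p) * cnj (h x) \<partial>lborel)) \<partial>lborel)"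
    unfolding trilinear_def by (rule norm_integral_le_nn_integral)
  also have "\<dots> \<le> (\<integral>\<^sup>+x. \<integral>\<^sup>+p. ennreal (cmod (K p * f (x - fst p) * g (x - snd p) * cnj (h x))) \<partial>lborel \<partial>lborel)"
    by (rule nn_integral_mono) (rule norm_integral_le_nn_integral)
  also have "\<dots> \<le> ennreal (W * a * B)" by (rule trilinear_nn[OF assms])
  finally show ?thesis
    using W l2_le_nonneg[OF f] l2_le_nonneg[OF l] by (simp add: ennreal_le_iff)
qed

lemma integral_pair_add:
  fixes P Q :: "'a::euclidean_space \<Rightarrow> 'b::euclidean_space \<Rightarrow> complex"
  assumes [measurable]: "case_prod P \<in> borel_measurable (borel \<Otimes>\<^sub>M borel)" "case_prod Q \<in> borel_measurable (borel \<Otimes>\<^sub>M borel)"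
    and P: "(\<integral>\<^sup>+x. \<integral>\<^sup>+y. ennreal (cmod (P x y)) \<partial>lborel \<partial>lborel) < \<infinity>"
    and Q: "(\<integral>\<^sup>+x. \<integral>\<^sup>+y. ennreal (cmod (Q x y)) \<partial>lborel \<partial>lborel) < \<infinity>"
  shows "(\<integral>x. \<integral>y. P x y + Q x y \<partial>lborel \<partial>lborel) = (\<integral>x. \<integral>y. P x y \<partial>lborel \<partial>lborel) + (\<integral>x. \<integral>y. Q x y \<partial>lborel \<partial>lborel)"
proof -
  note P' = AE_integrable_lborel_fst[OF _ P] integrable_lborel_fst[OF _ P]
  note Q' = AE_integrable_lborel_fst[OF _ Q] integrable_lborel_fst[OF _ Q]
  have "AE x in lborel. integrable lborel (P x)" "AE x in lborel. integrable lborel (Q x)"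
    by (rule P'(1), measurable, rule Q'(1), measurable)
  then have "AE x in lborel. (\<integral>y. P x y + Q x y \<partial>lborel) = (\<integral>y. P x y \<partial>lborel) + (\<integral>y. Q x y \<partial>lborel)"
    by eventually_elim (rule Bochner_Integration.integral_add)
  then have "(\<integral>x. \<integral>y. P x y + Q x y \<partial>lborel \<partial>lborel) = (\<integral>x. (\<integral>y. P x y \<partial>lborel) + (\<integral>y. Q x y \<partial>lborel) \<partial>lborel)"
    by (intro integral_cong_AE) measurable
  also have "\<dots> = (\<integral>x. \<integral>y. P x y \<partial>lborel \<partial>lborel) + (\<integral>x. \<integral>y. Q x y \<partial>lborel \<partial>lborel)"
    by (rule Bochner_Integration.integral_add) (rule P'(2) Q'(2), measurable)+
  finally show ?thesis .
qed

lemma trilinear_add_left: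
  fixes K :: "'a::euclidean_space \<times> 'a \<Rightarrow> complex"
  assumes [measurable]: "K \<in> borel_measurable borel" and K: "(\<integral>\<^sup>+p. ennreal (cmod (K p)) \<partial>lborel) \<le> ennreal W" and W: "0 \<le> W"
    and f: "l2_le f a" "l2_le f' a'" and gh: "l2_pair g h B"
  shows "trilinear K (\<lambda>x. f x + f' x) g h = trilinear K f g h + trilinear K f' g h"
proof -
  have [measurable]: "f \<in> borel_measurable borel" "f' \<in> borel_measurable borel" "g \<in> borel_measurable borel" "h \<in> borel_measurable borel"
    using f gh by (auto simp: l2_pair_def l2_le_def)
  have *: "(\<integral>\<^sup>+x. \<integral>\<^sup>+p. ennreal (cmod (K p * f (x - fst p) * g (x - snd p) * cnj (h x))) \<partial>lborel \<partial>lborel) < \<infinity>"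
    by (rule le_less_trans[OF trilinear_nn[OF _ K W f(1) gh]]) auto
  have **: "(\<integral>\<^sup>+x. \<integral>\<^sup>+p. ennreal (cmod (K p * f' (x - fst p) * g (x - snd p) * cnj (h x))) \<partial>lborel \<partial>lborel) < \<infinity>"
    by (rule le_less_trans[OF trilinear_nn[OF _ K W f(2) gh]]) auto
  have "trilinear K (\<lambda>x. f x + f' x) g h = (\<integral>x. \<integral>p. K p * f (x - fst p) * g (x - snd p) * cnj (h x) +
      K p * f' (x - fst p) * g (x - snd p) * cnj (h x) \<partial>lborel \<partial>lborel)"
    unfolding trilinear_def by (simp add: algebra_simps)
  also have "\<dots> = trilinear K f g h + trilinear K f' g h"
    unfolding trilinear_def by (rule integral_pair_add[OF _ _ * **]) measurable
  finally show ?thesis .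
qed

lemma trilinear_add_kernel:
  fixes K K' :: "'a::euclidean_space \<times> 'a \<Rightarrow> complex"
  assumes [measurable]: "K \<in> borel_measurable borel" "K' \<in> borel_measurable borel"
    and K: "(\<integral>\<^sup>+p. ennreal (cmod (K p)) \<partial>lborel) \<le> ennreal W" and W: "0 \<le> W"
    and K': "(\<integral>\<^sup>+p. ennreal (cmod (K' p)) \<partial>lborel) \<le> ennreal W'" and W': "0 \<le> W'"
    and f: "l2_le f a" and gh: "l2_pair g h B"
  shows "trilinear (\<lambda>p. K p + K' p) f g h = trilinear K f g h + trilinear K' f g h"
proof -
  have [measurable]: "f \<in> borel_measurable borel" "g \<in> borel_measurable borel" "h \<in> borel_measurable borel"
    using f gh by (auto simp: l2_pair_def l2_le_def)
  have *: "(\<integral>\<^sup>+x. \<integral>\<^sup>+p. ennreal (cmod (K p * f (x - fst p) * g (x - snd p) * cnj (h x))) \<partial>lborel \<partial>lborel) < \<infinity>"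
    by (rule le_less_trans[OF trilinear_nn[OF _ K W f gh]]) auto
  have **: "(\<integral>\<^sup>+x. \<integral>\<^sup>+p. ennreal (cmod (K' p * f (x - fst p) * g (x - snd p) * cnj (h x))) \<partial>lborel \<partial>lborel) < \<infinity>"
    by (rule le_less_trans[OF trilinear_nn[OF _ K' W' f gh]]) auto
  have "trilinear (\<lambda>p. K p + K' p) f g h = (\<integral>x. \<integral>p. K p * f (x - fst p) * g (x - snd p) * cnj (h x) +
      K' p * f (x - fst p) * g (x - snd p) * cnj (h x) \<partial>lborel \<partial>lborel)"
    unfolding trilinear_def by (simp add: algebra_simps)
  also have "\<dots> = trilinear K f g h + trilinear K' f g h"
    unfolding trilinear_def by (rule integral_pair_add[OF _ _ * **]) measurable
  finally show ?thesis .
qed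

lemma trilinear_cmult_kernel: "trilinear (\<lambda>p. c * K p) f g h = c * trilinear K f g h"
  unfolding trilinear_def by (simp add: mult.assoc)

section \<open>Choice of the frequency set\<close>

context unit_kernel begin

definition slice_energy :: "'a \<Rightarrow> ennreal" where
  "slice_energy \<xi> = (\<integral>\<^sup>+w. ennreal ((cmod (khat \<xi> w))\<^sup>2) \<partial>lborel)"

lemma measurable_slice_energy [measurable]: "slice_energy \<in> borel_measurable borel"
  unfolding slice_energy_def[abs_def] by measurable

lemma slice_energy_le: "slice_energy \<xi> \<le> ennreal ((V * sqrt V)\<^sup>2)"
  unfolding slice_energy_def by (rule l2_le_bound[OF khat_l2])

lemma nn_integral_slice_energy: "(\<integral>\<^sup>+\<xi>. slice_energy \<xi> \<partial>lborel) \<le> ennreal (V\<^sup>2)"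
proof -
  have "(\<integral>\<^sup>+\<xi>. slice_energy \<xi> \<partial>lborel) = (\<integral>\<^sup>+w. \<integral>\<^sup>+\<xi>. ennreal ((cmod (khat \<xi> w))\<^sup>2) \<partial>lborel \<partial>lborel)"
    unfolding slice_energy_def by (rule nn_integral_lborel_swap) measurable
  also have "\<dots> \<le> (\<integral>\<^sup>+w. ennreal V * indicator (cball (0::'a) 2) w \<partial>lborel)"
  proof (rule nn_integral_mono)
    fix w :: 'a
    show "(\<integral>\<^sup>+\<xi>. ennreal ((cmod (khat \<xi> w))\<^sup>2) \<partial>lborel) \<le> ennreal V * indicator (cball 0 2) w"
    proof (cases "norm w > 2")
      case False
      have "(\<integral>\<^sup>+\<xi>. ennreal ((cmod (khat \<xi> w))\<^sup>2) \<partial>lborel) \<le> ennreal ((sqrt V)\<^sup>2)"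
        unfolding khat_def by (rule l2_le_bound[OF Bessel[OF K_slice]])
      with False show ?thesis by (simp add: V_nonneg indicator_def)
    qed (simp add: khat_support)
  qed
  also have "\<dots> = ennreal V * emeasure lborel (cball (0::'a) 2)"
    by (rule nn_integral_cmult_indicator) simp
  also have "\<dots> = ennreal (V\<^sup>2)"
    using emeasure_lborel_cball_finite[of "0::'a" 2]
    by (simp add: emeasure_eq_ennreal_measure less_top power2_eq_square V_nonneg ennreal_mult flip: V_def)
  finally show ?thesis .
qed

text \<open>
  The set \<open>S\<close> consists of the frequencies \<open>\<xi>\<close> of size at least \<open>R\<close> at which \<open>slice_energy\<close> exceeds \<open>\<tau>\<^sup>2\<close>.
  By Chebyshev's inequality it has measure at most \<open>(V / \<tau>)\<^sup>2\<close>, and the decay of \<open>fourier K\<close> holds on it. On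
  the complement either \<open>slice_energy\<close> is small or \<open>\<xi>\<close> is a low frequency, at which \<open>h\<close> is small by
  assumption.
\<close>

lemma trilinear_decay:
  assumes decay: "\<And>\<zeta>. \<zeta> \<noteq> 0 \<Longrightarrow> cmod (fourier K \<zeta>) \<le> Cd / sqrt (norm \<zeta>)" and Cd: "0 \<le> Cd"
    and h: "l2_le h a" and hr: "\<And>x. norm x > r1 \<Longrightarrow> h x = 0"
    and g2: "l2_le g2 b2" and g2r: "\<And>x. norm x > r2 \<Longrightarrow> g2 x = 0"
    and g3: "l2_le g3 b3" and g3r: "\<And>x. norm x > r3 \<Longrightarrow> g3 x = 0"
    and R: "0 < R" and \<tau>: "0 < \<tau>" and \<rho>: "0 \<le> \<rho>"
    and low: "(\<integral>\<^sup>+\<xi>. ennreal ((cmod (fourier h \<xi>))\<^sup>2) * indicator (ball 0 R) \<xi> \<partial>lborel) \<le> ennreal (\<rho>\<^sup>2)"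
  shows "cmod (trilinear K h g2 g3) \<le> (V * sqrt V * \<rho> + \<tau> * a + Cd / sqrt R * (V / \<tau>) * a) * b2 * b3"
proof -
  note [measurable] = l2_le_measurable[OF h]
  have hi: "integrable lborel h" by (rule l2_le_integrable[OF h hr])
  have a0: "0 \<le> a" by (rule l2_le_nonneg[OF h])
  define S where "S = {\<xi>. R \<le> norm \<xi> \<and> ennreal (\<tau>\<^sup>2) < slice_energy \<xi>}"
  have S[measurable]: "S \<in> sets borel" unfolding S_def by measurable
  have S_fin: "emeasure lborel S \<le> ennreal ((V / \<tau>)\<^sup>2)"
  proof -
    have "ennreal (\<tau>\<^sup>2) * emeasure lborel S = (\<integral>\<^sup>+\<xi>. ennreal (\<tau>\<^sup>2) * indicator S \<xi> \<partial>lborel)"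
      by (simp add: nn_integral_cmult_indicator)
    also have "\<dots> \<le> (\<integral>\<^sup>+\<xi>. slice_energy \<xi> \<partial>lborel)"
      by (intro nn_integral_mono) (auto simp: S_def indicator_def)
    also note nn_integral_slice_energy
    finally have "ennreal (1 / \<tau>\<^sup>2) * (ennreal (\<tau>\<^sup>2) * emeasure lborel S) \<le> ennreal (1 / \<tau>\<^sup>2) * ennreal (V\<^sup>2)"
      by (rule mult_left_mono) simp
    then show ?thesis
      using \<tau> by (simp add: power_divide flip: mult.assoc ennreal_mult)
  qed
  have m: "cmod (fourier K (\<xi>, \<eta>)) \<le> Cd / sqrt R" if "\<xi> \<in> S" for \<xi> \<eta>
  proof -
    have n: "R \<le> norm (\<xi>, \<eta>)" using that norm_fst_le[of \<xi> \<eta>] by (auto simp: S_def)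
    then have "(\<xi>, \<eta>) \<noteq> 0" using R by auto
    then have "cmod (fourier K (\<xi>, \<eta>)) \<le> Cd / sqrt (norm (\<xi>, \<eta>))" by (rule decay)
    also have "\<dots> \<le> Cd / sqrt R" using n R Cd by (intro divide_left_mono mult_pos_pos real_sqrt_gt_zero real_sqrt_le_mono) (auto intro: less_le_trans)
    finally show ?thesis .
  qed
  define E where "E = V * sqrt V * \<rho> + \<tau> * a"
  have E: "(\<integral>\<^sup>+\<xi>. ennreal ((cmod (fourier h \<xi>))\<^sup>2) * (\<integral>\<^sup>+w. ennreal ((cmod (khat \<xi> w))\<^sup>2) \<partial>lborel) * indicator (- S) \<xi> \<partial>lborel) \<le> ennreal (E\<^sup>2)"
  proof -
    have "(\<integral>\<^sup>+\<xi>. ennreal ((cmod (fourier h \<xi>))\<^sup>2) * (\<integral>\<^sup>+w. ennreal ((cmod (khat \<xi> w))\<^sup>2) \<partial>lborel) * indicator (- S) \<xi> \<partial>lborel) \<le>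
      (\<integral>\<^sup>+\<xi>. ennreal ((V * sqrt V)\<^sup>2) * (ennreal ((cmod (fourier h \<xi>))\<^sup>2) * indicator (ball 0 R) \<xi>) + ennreal (\<tau>\<^sup>2) * ennreal ((cmod (fourier h \<xi>))\<^sup>2) \<partial>lborel)"
    proof (rule nn_integral_mono)
      fix \<xi> :: 'a
      let ?h = "ennreal ((cmod (fourier h \<xi>))\<^sup>2)"
      consider "norm \<xi> < R" | "\<xi> \<in> S" | "slice_energy \<xi> \<le> ennreal (\<tau>\<^sup>2)" "R \<le> norm \<xi>" "\<xi> \<notin> S"
        by (cases "norm \<xi> < R"; cases "ennreal (\<tau>\<^sup>2) < slice_energy \<xi>") (auto simp: S_def not_less)
      then show "?h * (\<integral>\<^sup>+w. ennreal ((cmod (khat \<xi> w))\<^sup>2) \<partial>lborel) * indicator (- S) \<xi> \<le>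
          ennreal ((V * sqrt V)\<^sup>2) * (?h * indicator (ball 0 R) \<xi>) + ennreal (\<tau>\<^sup>2) * ?h"
      proof cases
        case 1
        then have "?h * slice_energy \<xi> * indicator (- S) \<xi> = ?h * slice_energy \<xi>" by (simp add: S_def)
        also have "\<dots> \<le> ?h * ennreal ((V * sqrt V)\<^sup>2)" by (intro mult_left_mono slice_energy_le) auto
        finally show ?thesis using 1 unfolding slice_energy_def[symmetric]
          by (simp add: mult.commute add_increasing2)
      next
        case 3
        then have "?h * slice_energy \<xi> \<le> ?h * ennreal (\<tau>\<^sup>2)" by (intro mult_left_mono) auto
        with 3 show ?thesis unfolding slice_energy_def[symmetric] by (simp add: mult.commute)
      qed simp
    qed
    also have "\<dots> = ennreal ((V * sqrt V)\<^sup>2) * (\<integral>\<^sup>+\<xi>. ennreal ((cmod (fourier h \<xi>))\<^sup>2) * indicator (ball 0 R) \<xi> \<partial>lborel) +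
        ennreal (\<tau>\<^sup>2) * (\<integral>\<^sup>+\<xi>. ennreal ((cmod (fourier h \<xi>))\<^sup>2) \<partial>lborel)"
    proof -
      have [measurable]: "ball (0::'a) R \<in> sets borel" by simp
      show ?thesis by (subst nn_integral_add) (auto simp: nn_integral_cmult)
    qed
    also have "\<dots> \<le> ennreal ((V * sqrt V)\<^sup>2) * ennreal (\<rho>\<^sup>2) + ennreal (\<tau>\<^sup>2) * ennreal (a\<^sup>2)"
      by (intro add_mono mult_left_mono low l2_le_bound[OF Bessel[OF hi h]]) auto
    also have "\<dots> = ennreal ((V * sqrt V * \<rho>)\<^sup>2 + (\<tau> * a)\<^sup>2)"
      by (simp add: power_mult_distrib ennreal_mult ennreal_plus)
    also have "\<dots> \<le> ennreal (E\<^sup>2)"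
      unfolding E_def using V_nonneg \<rho> \<tau> a0 by (intro ennreal_leI) (simp add: power2_sum)
    finally show ?thesis .
  qed
  have "cmod (L2_pairing (bilinear_op K h g2) g3) \<le> (E + Cd / sqrt R * (V / \<tau>) * a) * b2 * b3"
    by (rule trilinear_split[OF h hr g2 g2r g3 g3r S S_fin _ m E]) (use \<tau> V_nonneg \<rho> a0 R Cd in \<open>auto simp: E_def\<close>)
  then show ?thesis by (simp add: E_def trilinear_eq)
qed

end

section \<open>Localisation to unit balls\<close>

lemma ball_sets_borel [measurable]: "ball c r \<in> sets borel" "cball c r \<in> sets borel"
  by auto

lemma emeasure_cball_vol:
  "0 \<le> r \<Longrightarrow> emeasure lborel (cball (c::'a::euclidean_space) r) = ennreal (measure lborel (cball (0::'a) r))"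
  by (simp add: emeasure_cball content_cball)

lemma nn_integral_indicator_ball:
  fixes x :: "'a::euclidean_space"
  assumes "0 \<le> r"
  shows "(\<integral>\<^sup>+z. indicator (cball 0 r) (x - z) \<partial>lborel) = ennreal (measure lborel (cball (0::'a) r))"
    "(\<integral>\<^sup>+z. indicator (cball 0 r) (z - x) \<partial>lborel) = ennreal (measure lborel (cball (0::'a) r))"
proof -
  have m: "indicator (cball (0::'a) r) \<in> borel_measurable borel"
    by (rule borel_measurable_indicator) simp
  show "(\<integral>\<^sup>+z. indicator (cball 0 r) (x - z) \<partial>lborel) = ennreal (measure lborel (cball (0::'a) r))"
    "(\<integral>\<^sup>+z. indicator (cball 0 r) (z - x) \<partial>lborel) = ennreal (measure lborel (cball (0::'a) r))"
    using emeasure_cball_vol[OF assms, of "0::'a"] nn_integral_lborel_translate(3,4)[OF m, of x] by simp_all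
qed

definition local_sq :: "('a::euclidean_space \<Rightarrow> complex) \<Rightarrow> real \<Rightarrow> 'a \<Rightarrow> ennreal" where
  "local_sq f r z = (\<integral>\<^sup>+x. ennreal ((cmod (f x))\<^sup>2) * indicator (cball 0 r) (x - z) \<partial>lborel)"

lemma measurable_local_sq [measurable]:
  assumes [measurable]: "f \<in> borel_measurable borel"
  shows "local_sq f r \<in> borel_measurable borel"
  unfolding local_sq_def[abs_def] by measurable

lemma l2_le_local:
  assumes [measurable]: "f \<in> borel_measurable borel" and fin: "local_sq f r z < \<infinity>"
  shows "l2_le (\<lambda>x. f x * indicator (cball 0 r) (x - z)) (sqrt (enn2real (local_sq f r z)))"
proof -
  have "(\<integral>\<^sup>+x. ennreal ((cmod (f x * indicator (cball 0 r) (x - z)))\<^sup>2) \<partial>lborel) = local_sq f r z"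
    unfolding local_sq_def by (intro nn_integral_cong) (auto simp: indicator_def)
  with fin show ?thesis by (simp add: l2_le_def less_top)
qed

lemma nn_integral_local_sq:
  fixes f :: "'a::euclidean_space \<Rightarrow> complex"
  assumes f: "l2_le f a" and r: "0 \<le> r"
  shows "(\<integral>\<^sup>+z. local_sq f r z \<partial>lborel) \<le> ennreal (measure lborel (cball (0::'a) r) * a\<^sup>2)"
proof -
  note [measurable] = l2_le_measurable[OF f]
  have "(\<integral>\<^sup>+z. local_sq f r z \<partial>lborel) =
      (\<integral>\<^sup>+x. \<integral>\<^sup>+z. ennreal ((cmod (f x))\<^sup>2) * indicator (cball 0 r) (x - z) \<partial>lborel \<partial>lborel)"
    unfolding local_sq_def by (rule nn_integral_lborel_swap) measurable
  also have "\<dots> = (\<integral>\<^sup>+x. ennreal ((cmod (f x))\<^sup>2) \<partial>lborel) * ennreal (measure lborel (cball (0::'a) r))"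
    by (simp add: nn_integral_cmult nn_integral_indicator_ball[OF r] nn_integral_multc)
  also have "\<dots> \<le> ennreal (a\<^sup>2) * ennreal (measure lborel (cball (0::'a) r))"
    by (intro mult_right_mono l2_le_bound f) auto
  finally show ?thesis by (simp add: mult.commute flip: ennreal_mult)
qed

text \<open>
  Points of the two balls around \<open>z\<close> differ by at most 4, so after the substitution \<open>u = x - v\<close> the product
  is an average over \<open>\<bar>v\<bar> \<le> 4\<close> of integrals of \<open>\<bar>g (x - v) h x\<bar>\<^sup>2\<close>.
\<close>

lemma nn_integral_local_sq_pair:
  fixes g h :: "'a::euclidean_space \<Rightarrow> complex"
  assumes gh: "l2_pair g h B"
  shows "(\<integral>\<^sup>+z. local_sq g 3 z * local_sq h 1 z \<partial>lborel) \<le>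
    ennreal (measure lborel (cball (0::'a) 4) * measure lborel (cball (0::'a) 1) * B\<^sup>2)"
proof -
  let ?V1 = "measure lborel (cball (0::'a) 1)" and ?V4 = "measure lborel (cball (0::'a) 4)"
  have [measurable]: "g \<in> borel_measurable borel" "h \<in> borel_measurable borel"
    using gh by (auto simp: l2_pair_def)
  have l: "l2_le (\<lambda>x. g (x - v) * h x) B" for v using gh by (simp add: l2_pair_def)
  let ?g = "\<lambda>x. ennreal ((cmod (g x))\<^sup>2)" and ?h = "\<lambda>x. ennreal ((cmod (h x))\<^sup>2)"
  have "local_sq g 3 z * local_sq h 1 z \<le>
      (\<integral>\<^sup>+x. \<integral>\<^sup>+v. indicator (cball 0 4) v * (?g (x - v) * ?h x) * indicator (cball 0 1) (x - z) \<partial>lborel \<partial>lborel)" for z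
  proof -
    have "local_sq g 3 z * local_sq h 1 z =
        (\<integral>\<^sup>+x. (?h x * indicator (cball 0 1) (x - z)) * (\<integral>\<^sup>+u. ?g u * indicator (cball 0 3) (u - z) \<partial>lborel) \<partial>lborel)"
      unfolding local_sq_def by (subst nn_integral_multc) (auto simp: mult.commute)
    also have "\<dots> = (\<integral>\<^sup>+x. \<integral>\<^sup>+v. (?h x * indicator (cball 0 1) (x - z)) * (?g (x - v) * indicator (cball 0 3) (x - v - z)) \<partial>lborel \<partial>lborel)"
    proof (rule nn_integral_cong)
      fix x
      have "(\<lambda>u. ?g u * indicator (cball 0 3) (u - z)) \<in> borel_measurable borel" by measurable
      from nn_integral_lborel_translate(4)[OF this, of x]
      show "(?h x * indicator (cball 0 1) (x - z)) * (\<integral>\<^sup>+u. ?g u * indicator (cball 0 3) (u - z) \<partial>lborel) =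
        (\<integral>\<^sup>+v. (?h x * indicator (cball 0 1) (x - z)) * (?g (x - v) * indicator (cball 0 3) (x - v - z)) \<partial>lborel)"
        by (subst nn_integral_cmult) auto
    qed
    also have "\<dots> \<le> (\<integral>\<^sup>+x. \<integral>\<^sup>+v. indicator (cball 0 4) v * (?g (x - v) * ?h x) * indicator (cball 0 1) (x - z) \<partial>lborel \<partial>lborel)"
    proof (intro nn_integral_mono)
      fix x v :: 'a
      have "norm v \<le> norm (x - z) + norm (x - v - z)"
        using norm_triangle_ineq4[of "x - z" "x - v - z"] by simp
      then show "(?h x * indicator (cball 0 1) (x - z)) * (?g (x - v) * indicator (cball 0 3) (x - v - z)) \<le>
          indicator (cball 0 4) v * (?g (x - v) * ?h x) * indicator (cball 0 1) (x - z)"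
        by (auto simp: indicator_def mult.commute)
    qed
    finally show ?thesis .
  qed
  then have "(\<integral>\<^sup>+z. local_sq g 3 z * local_sq h 1 z \<partial>lborel) \<le>
      (\<integral>\<^sup>+z. \<integral>\<^sup>+x. \<integral>\<^sup>+v. indicator (cball 0 4) v * (?g (x - v) * ?h x) * indicator (cball 0 1) (x - z) \<partial>lborel \<partial>lborel \<partial>lborel)"
    by (intro nn_integral_mono)
  also have "\<dots> = (\<integral>\<^sup>+x. \<integral>\<^sup>+z. \<integral>\<^sup>+v. indicator (cball 0 4) v * (?g (x - v) * ?h x) * indicator (cball 0 1) (x - z) \<partial>lborel \<partial>lborel \<partial>lborel)"
    by (rule nn_integral_lborel_swap) measurable
  also have "\<dots> = (\<integral>\<^sup>+x. (\<integral>\<^sup>+v. indicator (cball 0 4) v * (?g (x - v) * ?h x) \<partial>lborel) * ennreal ?V1 \<partial>lborel)"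
    by (simp add: nn_integral_multc nn_integral_cmult nn_integral_indicator_ball)
  also have "\<dots> = (\<integral>\<^sup>+x. \<integral>\<^sup>+v. indicator (cball 0 4) v * (?g (x - v) * ?h x) \<partial>lborel \<partial>lborel) * ennreal ?V1"
    by (rule nn_integral_multc) measurable
  also have "(\<integral>\<^sup>+x. \<integral>\<^sup>+v. indicator (cball 0 4) v * (?g (x - v) * ?h x) \<partial>lborel \<partial>lborel) =
      (\<integral>\<^sup>+v. \<integral>\<^sup>+x. indicator (cball 0 4) v * (?g (x - v) * ?h x) \<partial>lborel \<partial>lborel)"
    by (rule nn_integral_lborel_swap) measurable
  also have "\<dots> = (\<integral>\<^sup>+v. indicator (cball 0 4) v * (\<integral>\<^sup>+x. ennreal ((cmod (g (x - v) * h x))\<^sup>2) \<partial>lborel) \<partial>lborel)"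
    by (subst nn_integral_cmult[symmetric]) (auto simp: norm_mult power_mult_distrib ennreal_mult)
  also have "\<dots> \<le> (\<integral>\<^sup>+v. indicator (cball (0::'a) 4) v * ennreal (B\<^sup>2) \<partial>lborel)"
    by (intro nn_integral_mono mult_left_mono l2_le_bound l) auto
  also have "\<dots> = ennreal ?V4 * ennreal (B\<^sup>2)"
    by (subst nn_integral_multc) (auto simp: emeasure_cball_vol)
  finally show ?thesis
    by (simp add: ac_simps mult_right_mono flip: ennreal_mult)
qed

context unit_kernel begin

lemma K_nn: "(\<integral>\<^sup>+p. ennreal (cmod (K p)) \<partial>lborel) \<le> ennreal (measure lborel (cball (0::'a\<times>'a) 2))"
proof -
  have "(\<integral>\<^sup>+p. ennreal (cmod (K p)) \<partial>lborel) \<le> (\<integral>\<^sup>+p. indicator (cball (0::'a\<times>'a) 2) p \<partial>lborel)"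
    using K_le_1 K_support by (intro nn_integral_mono) (auto simp: indicator_def not_le intro: order_trans)
  also have "\<dots> = ennreal (measure lborel (cball (0::'a\<times>'a) 2))"
    by (simp add: emeasure_cball_vol)
  finally show ?thesis .
qed

text \<open>
  Since \<open>K\<close> lives on \<open>\<bar>p\<bar> \<le> 2\<close> and \<open>\<phi>\<close> on the unit ball, the integrand at a point \<open>x\<close> of the unit ball
  around \<open>z\<close> depends only on \<open>f\<close> in the ball of radius 4 and on \<open>g\<close> in the ball of radius 3 around \<open>z\<close>. Hence an
  estimate for functions of bounded support can be applied for each \<open>z\<close> and integrated over \<open>z\<close>,
  using the Cauchy-Schwarz inequality in \<open>z\<close>.
\<close>

lemma trilinear_localize:
  assumes [measurable]: "\<phi> \<in> borel_measurable borel"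
    and \<phi>1: "(\<integral>\<^sup>+z. ennreal (cmod (\<phi> z)) \<partial>lborel) \<le> ennreal 1"
    and \<phi>s: "\<And>z. norm z > 1 \<Longrightarrow> \<phi> z = 0"
    and f: "l2_le f a" and gh: "l2_pair g h B" and \<Gamma>: "0 \<le> \<Gamma>"
    and loc: "\<And>f' g' h' a b c r1 r2 r3. l2_le f' a \<Longrightarrow> l2_le g' b \<Longrightarrow> l2_le h' c \<Longrightarrow>
        (\<And>x. norm x > r1 \<Longrightarrow> f' x = 0) \<Longrightarrow> (\<And>x. norm x > r2 \<Longrightarrow> g' x = 0) \<Longrightarrow> (\<And>x. norm x > r3 \<Longrightarrow> h' x = 0) \<Longrightarrow>
        cmod (trilinear K (\<lambda>x. f' x - (\<integral>z. \<phi> z * f' (x - z) \<partial>lborel)) g' h') \<le> \<Gamma> * a * b * c"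
  shows "cmod (trilinear K (\<lambda>x. f x - (\<integral>z. \<phi> z * f (x - z) \<partial>lborel)) g h) \<le>
    \<Gamma> * measure lborel (cball (0::'a) 4) / sqrt (measure lborel (cball (0::'a) 1)) * a * B"
proof -
  define V1 where "V1 = measure lborel (cball (0::'a) 1)"
  define V4 where "V4 = measure lborel (cball (0::'a) 4)"
  have V1: "V1 > 0" and V4: "V4 \<ge> 0"
    unfolding V1_def V4_def by (auto simp: content_cball unit_ball_vol_pos)
  have [measurable]: "f \<in> borel_measurable borel" "g \<in> borel_measurable borel" "h \<in> borel_measurable borel"
    using f gh by (auto simp: l2_pair_def l2_le_def)
  have l: "l2_le (\<lambda>x. g (x - 0) * h x) B" using gh unfolding l2_pair_def by blast
  have a0: "0 \<le> a" and B0: "0 \<le> B" using l2_le_nonneg[OF f] l2_le_nonneg[OF l] by auto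
  define avg where "avg u x = (\<integral>z. \<phi> z * u (x - z) \<partial>lborel)" for u :: "'a \<Rightarrow> complex" and x
  define F where "F x = f x - avg f x" for x
  have "l2_le (avg f) (1 * a)" unfolding avg_def[abs_def]
    by (rule l2_le_convolution[OF _ \<phi>1 _ f]) auto
  from l2_le_add[OF f l2_le_cmult[OF this, of "-1"]]
  have F2: "l2_le F (2 * a)" by (simp add: F_def[abs_def])
  note [measurable] = l2_le_measurable[OF F2]
  define G where "G x = (\<integral>p. K p * F (x - fst p) * g (x - snd p) * cnj (h x) \<partial>lborel)" for x
  have [measurable]: "G \<in> borel_measurable borel" unfolding G_def[abs_def] by measurable
  have fin: "(\<integral>\<^sup>+x. \<integral>\<^sup>+p. ennreal (cmod (K p * F (x - fst p) * g (x - snd p) * cnj (h x))) \<partial>lborel \<partial>lborel) < \<infinity>"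
    by (rule le_less_trans[OF trilinear_nn[OF K_measurable K_nn _ F2 gh]]) auto
  have Gi: "integrable lborel G"
    unfolding G_def[abs_def] by (rule integrable_lborel_fst[OF _ fin]) measurable
  have tri: "trilinear K F g h = (\<integral>x. G x \<partial>lborel)"
    unfolding trilinear_def G_def ..
  have swapfin: "(\<integral>\<^sup>+z. \<integral>\<^sup>+x. ennreal (cmod (G x * indicator (cball 0 1) (x - z))) \<partial>lborel \<partial>lborel) < \<infinity>"
  proof -
    have "(\<integral>\<^sup>+z. \<integral>\<^sup>+x. ennreal (cmod (G x * indicator (cball 0 1) (x - z))) \<partial>lborel \<partial>lborel) =
        (\<integral>\<^sup>+z. \<integral>\<^sup>+x. ennreal (cmod (G x)) * indicator (cball 0 1) (x - z) \<partial>lborel \<partial>lborel)"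
      by (intro nn_integral_cong) (auto simp: indicator_def)
    also have "\<dots> = (\<integral>\<^sup>+x. \<integral>\<^sup>+z. ennreal (cmod (G x)) * indicator (cball 0 1) (x - z) \<partial>lborel \<partial>lborel)"
      by (rule nn_integral_lborel_swap) measurable
    also have "\<dots> = (\<integral>\<^sup>+x. ennreal (cmod (G x)) \<partial>lborel) * ennreal V1"
      by (simp add: nn_integral_cmult nn_integral_indicator_ball nn_integral_multc V1_def)
    finally show ?thesis using Gi by (simp add: integrable_iff_bounded ennreal_mult_less_top)
  qed
  have ind: "(\<integral>z. indicator (cball 0 1) (x - z) \<partial>lborel) = complex_of_real V1" for x :: 'a
  proof -
    have "(\<integral>z. indicator (cball 0 1) (x - z) \<partial>lborel) = (\<integral>z. indicator (cball (0::'a) 1) z \<partial>lborel :: complex)"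
      by (rule integral_lborel_translate(4))
    also have "\<dots> = (\<integral>z. complex_of_real (indicator (cball (0::'a) 1) z) \<partial>lborel)"
      by (intro Bochner_Integration.integral_cong) (auto simp: indicator_def)
    also have "\<dots> = complex_of_real V1"
      by (simp add: V1_def)
    finally show ?thesis .
  qed
  have "(\<integral>z. \<integral>x. G x * indicator (cball 0 1) (x - z) \<partial>lborel \<partial>lborel) =
      (\<integral>x. \<integral>z. G x * indicator (cball 0 1) (x - z) \<partial>lborel \<partial>lborel)"
    by (rule integral_lborel_swap[OF _ swapfin]) measurable
  also have "\<dots> = (\<integral>x. G x \<partial>lborel) * of_real V1" by (simp add: ind)
  finally have avg: "(\<integral>x. G x \<partial>lborel) * of_real V1 = (\<integral>z. \<integral>x. G x * indicator (cball 0 1) (x - z) \<partial>lborel \<partial>lborel)" ..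
  define \<alpha> where "\<alpha> z = enn2real (local_sq f 4 z)" for z
  define \<beta> where "\<beta> z = enn2real (local_sq g 3 z)" for z
  define \<gamma> where "\<gamma> z = enn2real (local_sq h 1 z)" for z
  have fin1: "local_sq f 4 z < \<infinity>" for z
  proof -
    have "local_sq f 4 z \<le> (\<integral>\<^sup>+x. ennreal ((cmod (f x))\<^sup>2) \<partial>lborel)"
      unfolding local_sq_def by (intro nn_integral_mono) (auto simp: indicator_def)
    also have "\<dots> \<le> ennreal (a\<^sup>2)" by (rule l2_le_bound[OF f])
    finally show ?thesis by (rule le_less_trans) simp
  qed
  have fin2: "local_sq g 3 z < \<infinity>" and fin3: "local_sq h 1 z < \<infinity>" for z
    using gh unfolding l2_pair_def local_sq_def by blast+
  note loc1 = l2_le_local[OF _ fin1, folded \<alpha>_def] and loc2 = l2_le_local[OF _ fin2, folded \<beta>_def]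
    and loc3 = l2_le_local[OF _ fin3, folded \<gamma>_def]
  have local: "cmod (\<integral>x. G x * indicator (cball 0 1) (x - z) \<partial>lborel) \<le> \<Gamma> * sqrt (\<alpha> z) * sqrt (\<beta> z) * sqrt (\<gamma> z)" for z
  proof -
    let ?f = "\<lambda>x. f x * indicator (cball 0 4) (x - z)" and ?g = "\<lambda>x. g x * indicator (cball 0 3) (x - z)"
      and ?h = "\<lambda>x. h x * indicator (cball 0 1) (x - z)"
    have supp: "indicator (cball 0 r) (x - z) = (0::complex)" if "norm x > r + norm z" for r x
      using that norm_triangle_ineq2[of x z] by (auto simp: indicator_def)
    have "G x * indicator (cball 0 1) (x - z) =
        (\<integral>p. K p * (?f (x - fst p) - avg ?f (x - fst p)) * ?g (x - snd p) * cnj (?h x) \<partial>lborel)" for x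
    proof (cases "norm (x - z) \<le> 1")
      case True
      have E: "K p * F (x - fst p) * g (x - snd p) = K p * (?f (x - fst p) - avg ?f (x - fst p)) * ?g (x - snd p)" for p
      proof (cases "norm p \<le> 2")
        case p: True
        then have p2: "norm (fst p) \<le> 2" "norm (snd p) \<le> 2"
          using norm_fst_le[of "fst p" "snd p"] norm_snd_le[of "snd p" "fst p"] by auto
        have 1: "norm (x - fst p - z) \<le> 3"
          using norm_triangle_ineq4[of "x - z" "fst p"] True p2 by (simp add: algebra_simps)
        have 2: "norm (x - snd p - z) \<le> 3"
          using norm_triangle_ineq4[of "x - z" "snd p"] True p2 by (simp add: algebra_simps)
        have 3: "\<phi> u * f (x - fst p - u) = \<phi> u * ?f (x - fst p - u)" for u
        proof (cases "norm u \<le> 1")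
          case True
          then have "norm (x - fst p - u - z) \<le> 4"
            using norm_triangle_ineq4[of "x - fst p - z" u] 1 by (simp add: algebra_simps)
          then show ?thesis by simp
        qed (simp add: \<phi>s)
        have "F (x - fst p) = ?f (x - fst p) - avg ?f (x - fst p)"
          unfolding F_def avg_def 3 using 1 by simp
        moreover have "g (x - snd p) = ?g (x - snd p)" using 2 by simp
        ultimately show ?thesis by simp
      qed (simp add: K_support)
      have hx: "?h x = h x" using True by simp
      show ?thesis unfolding hx E[symmetric] G_def using True by simp
    qed (simp add: indicator_def)
    then have "(\<integral>x. G x * indicator (cball 0 1) (x - z) \<partial>lborel) = trilinear K (\<lambda>x. ?f x - avg ?f x) ?g ?h"
      unfolding trilinear_def by simp
    also have "cmod \<dots> \<le> \<Gamma> * sqrt (\<alpha> z) * sqrt (\<beta> z) * sqrt (\<gamma> z)"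
      unfolding avg_def
      by (rule loc[OF loc1 loc2 loc3, where ?r1.0 = "4 + norm z" and ?r2.0 = "3 + norm z" and ?r3.0 = "1 + norm z"]) (auto simp: supp)
    finally show ?thesis .
  qed
  have "ennreal (cmod ((\<integral>x. G x \<partial>lborel) * of_real V1)) \<le>
      (\<integral>\<^sup>+z. ennreal (cmod (\<integral>x. G x * indicator (cball 0 1) (x - z) \<partial>lborel)) \<partial>lborel)"
    unfolding avg by (rule norm_integral_le_nn_integral)
  also have "\<dots> \<le> (\<integral>\<^sup>+z. ennreal \<Gamma> * (ennreal (sqrt (\<alpha> z)) * ennreal (sqrt (\<beta> z) * sqrt (\<gamma> z))) \<partial>lborel)"
  proof (rule nn_integral_mono)
    fix z
    show "ennreal (cmod (\<integral>x. G x * indicator (cball 0 1) (x - z) \<partial>lborel)) \<le>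
        ennreal \<Gamma> * (ennreal (sqrt (\<alpha> z)) * ennreal (sqrt (\<beta> z) * sqrt (\<gamma> z)))"
      using ennreal_leI[OF local[of z]] \<Gamma> by (simp add: \<alpha>_def \<beta>_def \<gamma>_def mult.assoc flip: ennreal_mult)
  qed
  also have "\<dots> = ennreal \<Gamma> * (\<integral>\<^sup>+z. ennreal (sqrt (\<alpha> z)) * ennreal (sqrt (\<beta> z) * sqrt (\<gamma> z)) \<partial>lborel)"
    unfolding \<alpha>_def \<beta>_def \<gamma>_def by (rule nn_integral_cmult) measurable
  also have "\<dots> \<le> ennreal \<Gamma> * ennreal ((sqrt V4 * a) * (sqrt (V4 * V1) * B))"
  proof (rule mult_left_mono[OF Cauchy_Schwarz_bound])
    have "(\<integral>\<^sup>+z. (ennreal (sqrt (\<alpha> z)))\<^sup>2 \<partial>lborel) = (\<integral>\<^sup>+z. local_sq f 4 z \<partial>lborel)"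
      using fin1 by (intro nn_integral_cong) (simp add: \<alpha>_def ennreal_power less_top)
    also have "\<dots> \<le> ennreal (V4 * a\<^sup>2)" unfolding V4_def by (rule nn_integral_local_sq[OF f]) simp
    finally show "(\<integral>\<^sup>+z. (ennreal (sqrt (\<alpha> z)))\<^sup>2 \<partial>lborel) \<le> ennreal ((sqrt V4 * a)\<^sup>2)"
      using V4 by (simp add: power_mult_distrib)
    have "(\<integral>\<^sup>+z. (ennreal (sqrt (\<beta> z) * sqrt (\<gamma> z)))\<^sup>2 \<partial>lborel) = (\<integral>\<^sup>+z. local_sq g 3 z * local_sq h 1 z \<partial>lborel)"
      using fin2 fin3 by (intro nn_integral_cong) (simp add: \<beta>_def \<gamma>_def ennreal_power power_mult_distrib ennreal_mult less_top)
    also have "\<dots> \<le> ennreal (V4 * V1 * B\<^sup>2)" unfolding V4_def V1_def by (rule nn_integral_local_sq_pair[OF gh])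
    finally show "(\<integral>\<^sup>+z. (ennreal (sqrt (\<beta> z) * sqrt (\<gamma> z)))\<^sup>2 \<partial>lborel) \<le> ennreal ((sqrt (V4 * V1) * B)\<^sup>2)"
      using V4 V1 by (simp add: power_mult_distrib)
  qed (use V4 V1 a0 B0 in \<open>auto simp: \<alpha>_def \<beta>_def \<gamma>_def\<close>)
  also have "\<dots> = ennreal (\<Gamma> * ((sqrt V4 * a) * (sqrt (V4 * V1) * B)))"
    using \<Gamma> V4 V1 a0 B0 by (simp flip: ennreal_mult)
  also have "\<Gamma> * ((sqrt V4 * a) * (sqrt (V4 * V1) * B)) = \<Gamma> * V4 * sqrt V1 * a * B"
    using V4 by (simp add: real_sqrt_mult mult.assoc mult.left_commute)
  finally have "cmod ((\<integral>x. G x \<partial>lborel) * of_real V1) \<le> \<Gamma> * V4 * sqrt V1 * a * B"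
    using \<Gamma> V4 V1 a0 B0 by (subst (asm) ennreal_le_iff) auto
  then have "cmod (\<integral>x. G x \<partial>lborel) * V1 \<le> \<Gamma> * V4 * sqrt V1 * a * B"
    using V1 by (simp add: norm_mult)
  then have "cmod (\<integral>x. G x \<partial>lborel) \<le> \<Gamma> * V4 * sqrt V1 * a * B / V1"
    using V1 by (simp add: pos_le_divide_eq)
  also have "\<dots> = \<Gamma> * V4 / sqrt V1 * a * B"
  proof -
    have "V1 = sqrt V1 * sqrt V1" using V1 by simp
    then have "sqrt V1 / V1 = 1 / sqrt V1" using V1 by (metis divide_divide_eq_left' div_self less_numeral_extra(3) real_sqrt_gt_0_iff)
    moreover have "\<Gamma> * V4 * sqrt V1 * a * B / V1 = \<Gamma> * V4 * a * B * (sqrt V1 / V1)" by simp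
    ultimately show ?thesis by simp
  qed
  finally have "cmod (trilinear K F g h) \<le> \<Gamma> * V4 / sqrt V1 * a * B" unfolding tri .
  then show ?thesis unfolding F_def avg_def V1_def V4_def .
qed

end

section \<open>Gain for functions annihilated by a low-pass kernel\<close>

context unit_kernel begin

text \<open>
  Let \<open>\<phi>\<close> be the restriction of \<open>D\<close> to the unit ball and \<open>\<psi>\<close> the remainder, whose mass is at most the first
  moment \<open>\<delta>\<close>. As \<open>f * D = 0\<close>, the function \<open>f * \<phi> = - f * \<psi>\<close> has norm at most \<open>\<delta> a\<close> and contributes little.
  What is left is \<open>f - f * \<phi>\<close>. It can be localised because \<open>\<phi>\<close> has compact support, and localised copies
  \<open>f'\<close> of \<open>f\<close> satisfy \<open>fourier (f' - f' * \<phi>) = (1 - fourier \<phi>) fourier f'\<close>, which is small at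
  low frequencies although \<open>f'\<close> itself need not be.
\<close>

lemma trilinear_high_frequency:
  fixes D :: "'a \<Rightarrow> real"
  assumes decay: "\<And>\<zeta>. \<zeta> \<noteq> 0 \<Longrightarrow> cmod (fourier K \<zeta>) \<le> Cd / sqrt (norm \<zeta>)" and Cd: "0 \<le> Cd"
    and D0: "\<And>z. 0 \<le> D z" and Di: "integrable lborel D" and D1: "(\<integral>z. D z \<partial>lborel) = 1"
    and mom: "(\<integral>\<^sup>+z. ennreal (norm z * D z) \<partial>lborel) \<le> ennreal \<delta>" and \<delta>: "0 \<le> \<delta>"
    and D2: "l2_le (\<lambda>z. complex_of_real (D z)) d"
    and f: "l2_le f a" and orth: "\<And>x. (\<integral>z. of_real (D z) * f (x - z) \<partial>lborel) = 0"
    and gh: "l2_pair g h B" and R: "0 < R" and \<tau>: "0 < \<tau>"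
  shows "cmod (trilinear K f g h) \<le>
    ((V * sqrt V * ((1 + 2 * pi * R) * \<delta>) + 2 * \<tau> + Cd / sqrt R * (V / \<tau>) * 2) *
       measure lborel (cball (0::'a) 4) / sqrt (measure lborel (cball (0::'a) 1))
     + measure lborel (cball (0::'a\<times>'a) 2) * \<delta>) * a * B"
proof -
  have [measurable]: "D \<in> borel_measurable borel" using Di by auto
  note [measurable] = l2_le_measurable[OF f]
  have a0: "0 \<le> a" by (rule l2_le_nonneg[OF f])
  define \<phi> where "\<phi> z = complex_of_real (D z) * indicator (cball 0 1) z" for z :: 'a
  define \<psi> where "\<psi> z = complex_of_real (D z) * indicator (- cball 0 1) z" for z :: 'a
  have [measurable]: "\<phi> \<in> borel_measurable borel" "\<psi> \<in> borel_measurable borel"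
    unfolding \<phi>_def \<psi>_def by measurable
  have Dn: "(\<integral>\<^sup>+z. ennreal (D z) \<partial>lborel) = 1"
    using nn_integral_eq_integral[OF Di] D0 D1 by simp
  have \<phi>1: "(\<integral>\<^sup>+z. ennreal (cmod (\<phi> z)) \<partial>lborel) \<le> ennreal 1"
  proof -
    have "(\<integral>\<^sup>+z. ennreal (cmod (\<phi> z)) \<partial>lborel) \<le> (\<integral>\<^sup>+z. ennreal (D z) \<partial>lborel)"
      by (intro nn_integral_mono ennreal_leI) (auto simp: \<phi>_def norm_mult D0 indicator_def)
    then show ?thesis by (simp add: Dn)
  qed
  have \<psi>1: "(\<integral>\<^sup>+z. ennreal (cmod (\<psi> z)) \<partial>lborel) \<le> ennreal \<delta>"
  proof -
    have "(\<integral>\<^sup>+z. ennreal (cmod (\<psi> z)) \<partial>lborel) \<le> (\<integral>\<^sup>+z. ennreal (norm z * D z) \<partial>lborel)"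
      using mult_right_mono[of 1 "norm z" "D z" for z] D0
      by (intro nn_integral_mono ennreal_leI) (auto simp: \<psi>_def norm_mult D0 indicator_def)
    then show ?thesis using mom by (rule order_trans)
  qed
  have \<phi>i: "integrable lborel \<phi>" using \<phi>1 by (intro integrableI_bounded) (auto intro: le_less_trans)
  have \<phi>s: "norm z > 1 \<Longrightarrow> \<phi> z = 0" for z by (simp add: \<phi>_def)
  have \<phi>2: "l2_le \<phi> d" and \<psi>2: "l2_le \<psi> d"
    by (rule l2_le_dominated[OF D2]; auto simp: \<phi>_def \<psi>_def norm_mult indicator_def)+
  define p where "p x = (\<integral>z. \<phi> z * f (x - z) \<partial>lborel)" for x
  define q where "q x = (\<integral>z. \<psi> z * f (x - z) \<partial>lborel)" for x
  have pq: "p x = - q x" for x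
  proof -
    have "p x + q x = (\<integral>z. \<phi> z * f (x - z) + \<psi> z * f (x - z) \<partial>lborel)"
      unfolding p_def q_def
      by (rule Bochner_Integration.integral_add[symmetric]; rule l2_le_integrable_mult, (rule \<phi>2 \<psi>2), rule l2_le_affine(3), rule f)
    also have "\<dots> = (\<integral>z. of_real (D z) * f (x - z) \<partial>lborel)"
      by (intro Bochner_Integration.integral_cong refl) (auto simp: \<phi>_def \<psi>_def indicator_def)
    finally show ?thesis by (simp add: orth eq_neg_iff_add_eq_0)
  qed
  have q2: "l2_le q (\<delta> * a)"
    unfolding q_def[abs_def] by (rule l2_le_convolution[OF _ \<psi>1 \<delta> f]) measurable
  have "l2_le p (cmod (-1) * (\<delta> * a))"
    using l2_le_cmult[OF q2, of "-1"] by (simp add: pq[abs_def])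
  then have p2: "l2_le p (\<delta> * a)" by simp
  have F2: "l2_le (\<lambda>x. f x - p x) (a + \<delta> * a)"
    using l2_le_add[OF f q2] by (simp add: pq[abs_def])
  define \<Gamma> where "\<Gamma> = V * sqrt V * ((1 + 2 * pi * R) * \<delta>) + 2 * \<tau> + Cd / sqrt R * (V / \<tau>) * 2"
  have \<Gamma>0: "0 \<le> \<Gamma>" unfolding \<Gamma>_def using V_nonneg \<delta> \<tau> Cd R by (intro add_nonneg_nonneg mult_nonneg_nonneg) auto
  \<comment> \<open>Since \<open>D\<close> has mass 1, this compares the character with 1, which costs at most \<open>2 \<pi> \<bar>z\<bar> R\<close> for \<open>\<bar>z\<bar> \<le> 1\<close>.\<close>
  have symb: "cmod (1 - fourier \<phi> \<xi>) \<le> (1 + 2 * pi * R) * \<delta>" if \<xi>: "norm \<xi> \<le> R" for \<xi>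
  proof -
    have Dc: "integrable lborel (\<lambda>z. complex_of_real (D z))" using Di by simp
    have one: "(1::complex) = (\<integral>z. of_real (D z) \<partial>lborel)" by (simp add: D1)
    have "1 - fourier \<phi> \<xi> = (\<integral>z. of_real (D z) - \<phi> z * ee (- (z \<bullet> \<xi>)) \<partial>lborel)"
      unfolding one fourier_ee
      by (rule Bochner_Integration.integral_diff[symmetric, OF Dc integrable_mult_ee(1)[OF \<phi>i]]) measurable
    then have "ennreal (cmod (1 - fourier \<phi> \<xi>)) \<le> (\<integral>\<^sup>+z. ennreal (cmod (of_real (D z) - \<phi> z * ee (- (z \<bullet> \<xi>)))) \<partial>lborel)"
      by (simp only: norm_integral_le_nn_integral)
    also have "\<dots> \<le> (\<integral>\<^sup>+z. ennreal (1 + 2 * pi * R) * ennreal (norm z * D z) \<partial>lborel)"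
    proof (rule nn_integral_mono)
      fix z
      have R1: "0 \<le> 2 * pi * R" using R by simp
      have "cmod (of_real (D z) - \<phi> z * ee (- (z \<bullet> \<xi>))) \<le> (1 + 2 * pi * R) * (norm z * D z)"
      proof (cases "norm z \<le> 1")
        case True
        have "of_real (D z) - \<phi> z * ee (- (z \<bullet> \<xi>)) = - of_real (D z) * (ee (- (z \<bullet> \<xi>)) - 1)"
          using True by (simp add: \<phi>_def algebra_simps)
        then have "cmod (of_real (D z) - \<phi> z * ee (- (z \<bullet> \<xi>))) = D z * cmod (ee (- (z \<bullet> \<xi>)) - 1)"
          by (simp add: norm_mult D0)
        also have "\<dots> \<le> D z * (2 * pi * (norm z * R))"
        proof (intro mult_left_mono D0)
          have "\<bar>z \<bullet> \<xi>\<bar> \<le> norm z * R"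
            using Cauchy_Schwarz_ineq2[of z \<xi>] mult_left_mono[OF \<xi> norm_ge_zero[of z]] by linarith
          then have "2 * pi * \<bar>- (z \<bullet> \<xi>)\<bar> \<le> 2 * pi * (norm z * R)" by simp
          then show "cmod (ee (- (z \<bullet> \<xi>)) - 1) \<le> 2 * pi * (norm z * R)"
            using ee_diff_1_le[of "- (z \<bullet> \<xi>)"] by linarith
        qed
        also have "\<dots> \<le> (1 + 2 * pi * R) * (norm z * D z)"
          using D0[of z] by (simp add: algebra_simps)
        finally show ?thesis .
      next
        case False
        then have "1 * D z \<le> norm z * D z" by (intro mult_right_mono D0) simp
        also have "\<dots> \<le> (1 + 2 * pi * R) * (norm z * D z)"
          using mult_right_mono[of 1 "1 + 2 * pi * R" "norm z * D z"] R1 D0[of z] by simp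
        finally show ?thesis using False D0[of z] by (simp add: \<phi>_def)
      qed
      then have "ennreal (cmod (of_real (D z) - \<phi> z * ee (- (z \<bullet> \<xi>)))) \<le> ennreal ((1 + 2 * pi * R) * (norm z * D z))"
        by (rule ennreal_leI)
      also have "\<dots> = ennreal (1 + 2 * pi * R) * ennreal (norm z * D z)"
        using R1 D0[of z] by (intro ennreal_mult) auto
      finally show "ennreal (cmod (of_real (D z) - \<phi> z * ee (- (z \<bullet> \<xi>)))) \<le> \<dots>" .
    qed
    also have "\<dots> = ennreal (1 + 2 * pi * R) * (\<integral>\<^sup>+z. ennreal (norm z * D z) \<partial>lborel)"
      by (rule nn_integral_cmult) measurable
    also have "\<dots> \<le> ennreal (1 + 2 * pi * R) * ennreal \<delta>" by (intro mult_left_mono mom) auto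
    also have "\<dots> = ennreal ((1 + 2 * pi * R) * \<delta>)" using R \<delta> by (intro ennreal_mult[symmetric]) auto
    finally show ?thesis using R \<delta> by (subst (asm) ennreal_le_iff) auto
  qed
  have "cmod (trilinear K (\<lambda>x. f x - (\<integral>z. \<phi> z * f (x - z) \<partial>lborel)) g h) \<le>
    \<Gamma> * measure lborel (cball (0::'a) 4) / sqrt (measure lborel (cball (0::'a) 1)) * a * B"
  proof (rule trilinear_localize[OF _ \<phi>1 \<phi>s f gh \<Gamma>0])
    fix f' g' h' :: "'a \<Rightarrow> complex" and a b c r1 r2 r3 :: real
    assume f': "l2_le f' a" and g': "l2_le g' b" and h': "l2_le h' c"
      and r: "\<And>x. norm x > r1 \<Longrightarrow> f' x = 0" "\<And>x. norm x > r2 \<Longrightarrow> g' x = 0" "\<And>x. norm x > r3 \<Longrightarrow> h' x = 0"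
    note [measurable] = l2_le_measurable[OF f']
    have a0: "0 \<le> a" by (rule l2_le_nonneg[OF f'])
    let ?F = "\<lambda>x. f' x - (\<integral>z. \<phi> z * f' (x - z) \<partial>lborel)"
    have c2: "l2_le (\<lambda>x. \<integral>z. \<phi> z * f' (x - z) \<partial>lborel) (1 * a)"
      by (rule l2_le_convolution[OF _ \<phi>1 _ f']) auto
    have F2: "l2_le ?F (2 * a)"
      using l2_le_add[OF f' l2_le_cmult[OF c2, of "-1"]] by simp
    have Fs: "?F x = 0" if x: "norm x > max 0 r1 + 1" for x
    proof -
      have "(\<integral>z. \<phi> z * f' (x - z) \<partial>lborel) = 0"
        by (rule convolution_support[where r = 1 and s = "max 0 r1"]) (use r(1) \<phi>s x in auto)
      with r(1)[of x] x show ?thesis by simp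
    qed
    have f'i: "integrable lborel f'" by (rule l2_le_integrable[OF f' r(1)])
    have ci: "integrable lborel (\<lambda>x. \<integral>z. \<phi> z * f' (x - z) \<partial>lborel)"
    proof (rule l2_le_integrable[OF c2])
      show "norm x > 1 + max 0 r1 \<Longrightarrow> (\<integral>z. \<phi> z * f' (x - z) \<partial>lborel) = 0" for x
        by (rule convolution_support[where r = 1 and s = "max 0 r1"]) (use r(1) \<phi>s in auto)
    qed
    have FF: "fourier ?F \<xi> = (1 - fourier \<phi> \<xi>) * fourier f' \<xi>" for \<xi>
      unfolding fourier_diff[OF f'i ci] fourier_convolution[OF \<phi>i f'i] by (simp add: algebra_simps)
    define \<rho> where "\<rho> = (1 + 2 * pi * R) * \<delta> * a"
    have low: "(\<integral>\<^sup>+\<xi>. ennreal ((cmod (fourier ?F \<xi>))\<^sup>2) * indicator (ball 0 R) \<xi> \<partial>lborel) \<le> ennreal (\<rho>\<^sup>2)"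
    proof -
      have "(\<integral>\<^sup>+\<xi>. ennreal ((cmod (fourier ?F \<xi>))\<^sup>2) * indicator (ball 0 R) \<xi> \<partial>lborel) \<le>
          (\<integral>\<^sup>+\<xi>. ennreal (((1 + 2 * pi * R) * \<delta>)\<^sup>2) * ennreal ((cmod (fourier f' \<xi>))\<^sup>2) \<partial>lborel)"
      proof (rule nn_integral_mono)
        fix \<xi> :: 'a
        show "ennreal ((cmod (fourier ?F \<xi>))\<^sup>2) * indicator (ball 0 R) \<xi> \<le>
            ennreal (((1 + 2 * pi * R) * \<delta>)\<^sup>2) * ennreal ((cmod (fourier f' \<xi>))\<^sup>2)"
        proof (cases "norm \<xi> < R")
          case True
          then have "(cmod (fourier ?F \<xi>))\<^sup>2 \<le> ((1 + 2 * pi * R) * \<delta>)\<^sup>2 * (cmod (fourier f' \<xi>))\<^sup>2"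
            unfolding FF norm_mult power_mult_distrib[of "cmod _"]
            by (intro mult_right_mono power_mono symb) auto
          from ennreal_leI[OF this] show ?thesis using True by (simp add: ennreal_mult)
        qed simp
      qed
      also have "\<dots> = ennreal (((1 + 2 * pi * R) * \<delta>)\<^sup>2) * (\<integral>\<^sup>+\<xi>. ennreal ((cmod (fourier f' \<xi>))\<^sup>2) \<partial>lborel)"
        by (rule nn_integral_cmult) measurable
      also have "\<dots> \<le> ennreal (((1 + 2 * pi * R) * \<delta>)\<^sup>2) * ennreal (a\<^sup>2)"
        by (intro mult_left_mono l2_le_bound[OF Bessel[OF f'i f']]) auto
      also have "\<dots> = ennreal (\<rho>\<^sup>2)" by (simp add: \<rho>_def power_mult_distrib ennreal_mult)
      finally show ?thesis .
    qed
    have \<rho>0: "0 \<le> \<rho>" unfolding \<rho>_def using R \<delta> a0 by (intro mult_nonneg_nonneg add_nonneg_nonneg) auto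
    have "cmod (trilinear K ?F g' h') \<le>
        (V * sqrt V * \<rho> + \<tau> * (2 * a) + Cd / sqrt R * (V / \<tau>) * (2 * a)) * b * c"
      by (rule trilinear_decay[OF decay Cd F2 Fs g' r(2) h' r(3) R \<tau> \<rho>0 low])
    also have "\<dots> = \<Gamma> * a * b * c" by (simp add: \<rho>_def \<Gamma>_def algebra_simps)
    finally show "cmod (trilinear K ?F g' h') \<le> \<Gamma> * a * b * c" .
  qed measurable
  then have main: "cmod (trilinear K (\<lambda>x. f x - p x) g h) \<le>
    \<Gamma> * measure lborel (cball (0::'a) 4) / sqrt (measure lborel (cball (0::'a) 1)) * a * B"
    unfolding p_def .
  have tail: "cmod (trilinear K p g h) \<le> measure lborel (cball (0::'a\<times>'a) 2) * (\<delta> * a) * B"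
    by (rule trilinear_bound[OF K_measurable K_nn _ p2 gh]) simp
  have "trilinear K f g h = trilinear K (\<lambda>x. (f x - p x) + p x) g h" by simp
  also have "\<dots> = trilinear K (\<lambda>x. f x - p x) g h + trilinear K p g h"
    by (rule trilinear_add_left[OF K_measurable K_nn _ F2 p2 gh]) simp
  finally have "cmod (trilinear K f g h) \<le> cmod (trilinear K (\<lambda>x. f x - p x) g h) + cmod (trilinear K p g h)"
    by (simp only: norm_triangle_ineq)
  also have "\<dots> \<le> \<Gamma> * measure lborel (cball (0::'a) 4) / sqrt (measure lborel (cball (0::'a) 1)) * a * B +
      measure lborel (cball (0::'a\<times>'a) 2) * (\<delta> * a) * B"
    by (rule add_mono[OF main tail])
  also have "\<dots> = (\<Gamma> * measure lborel (cball (0::'a) 4) / sqrt (measure lborel (cball (0::'a) 1))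
     + measure lborel (cball (0::'a\<times>'a) 2) * \<delta>) * a * B"
    by (simp add: algebra_simps)
  finally show ?thesis unfolding \<Gamma>_def .
qed

end

section \<open>A band-limited approximate identity\<close>

text \<open>
  The radius 1/4 makes \<open>autocorr tent\<close> vanish outside the ball of radius 1/2. The Lipschitz bound
  gives \<open>fourier tent\<close> a finite second moment.
\<close>

definition tent :: "'a::euclidean_space \<Rightarrow> complex" where
  "tent s = of_real (max 0 (1 / 4 - norm s))"

lemma continuous_tent: "continuous_on A tent"
  unfolding tent_def[abs_def] by (intro continuous_intros)

lemma measurable_tent [measurable]: "tent \<in> borel_measurable borel"
  by (intro borel_measurable_continuous_onI continuous_tent)

lemma tent_le: "cmod (tent s) \<le> 1"
proof -
  have "1 / 4 - norm s \<le> 1" using norm_ge_zero[of s] by linarith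
  then show ?thesis by (auto simp: tent_def max_def)
qed

lemma tent_support: "norm s > 1 / 4 \<Longrightarrow> tent s = 0" by (simp add: tent_def)

lemma tent_lipschitz: "cmod (tent (s + v) - tent s) \<le> norm v"
proof -
  have "cmod (tent (s + v) - tent s) = \<bar>max 0 (1 / 4 - norm (s + v)) - max 0 (1 / 4 - norm s)\<bar>"
    unfolding tent_def by (simp flip: of_real_diff)
  also have "\<dots> \<le> \<bar>norm (s + v) - norm s\<bar>" by (auto simp: max_def)
  also have "\<dots> \<le> norm v" using norm_triangle_ineq3[of "s + v" s] by simp
  finally show ?thesis .
qed

lemma tent_l2: "integrable lborel (tent :: 'a::euclidean_space \<Rightarrow> complex)"
  "l2_le (tent :: 'a \<Rightarrow> complex) (sqrt (measure lborel (cball (0::'a) (1/4))))"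
  using bounded_support_l2[of "tent :: 'a \<Rightarrow> complex" 1 "1/4"] tent_le tent_support by auto

text \<open>
  A nonnegative function whose frequencies lie in the ball of radius 1/2: it is the Fourier transform of
  \<open>autocorr tent\<close>, up to a reflection. It is a many-dimensional relative of the Fejer kernel.
\<close>

definition lowpass :: "'a::euclidean_space \<Rightarrow> real" where
  "lowpass z = (cmod (fourier tent z))\<^sup>2"

lemma lowpass_nonneg: "0 \<le> lowpass z" by (simp add: lowpass_def)

lemma measurable_lowpass [measurable]: "lowpass \<in> borel_measurable borel"
  unfolding lowpass_def[abs_def] by measurable

lemma fourier_tent_l2: "l2_le (fourier tent :: 'a::euclidean_space \<Rightarrow> complex) (sqrt (measure lborel (cball (0::'a) (1/4))))"
  by (rule Bessel[OF tent_l2])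

lemma integrable_lowpass: "integrable lborel (lowpass :: 'a::euclidean_space \<Rightarrow> real)"
  unfolding lowpass_def[abs_def] by (rule l2_le_sharp(1)[OF fourier_tent_l2])

lemma lowpass_l2: "\<exists>d. l2_le (\<lambda>z::'a::euclidean_space. complex_of_real (lowpass z)) d"
proof -
  let ?c = "\<integral>x. cmod (tent (x::'a)) \<partial>lborel"
  have "l2_le (\<lambda>z::'a. of_real ?c * fourier tent z) (cmod (of_real ?c) * sqrt (measure lborel (cball (0::'a) (1/4))))"
    by (rule l2_le_cmult[OF fourier_tent_l2])
  then have "l2_le (\<lambda>z::'a. complex_of_real (lowpass z)) (cmod (of_real ?c) * sqrt (measure lborel (cball (0::'a) (1/4))))"
  proof (rule l2_le_dominated)
    fix z :: 'a
    have "cmod (fourier tent z) * cmod (fourier tent z) \<le> ?c * cmod (fourier tent z)"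
      by (intro mult_right_mono norm_fourier_le_integral tent_l2) auto
    moreover have "0 \<le> ?c" by (rule integral_nonneg_AE) auto
    ultimately show "cmod (complex_of_real (lowpass z)) \<le> cmod (of_real ?c * fourier tent z)"
      by (simp add: lowpass_def norm_mult power2_eq_square)
  qed measurable
  then show ?thesis by blast
qed

text \<open>
  If the integral vanished, then by the Plancherel inequality so would the norm of \<open>tent\<close>.
\<close>

lemma lowpass_integral_pos: "0 < (\<integral>z. lowpass (z::'a::euclidean_space) \<partial>lborel)"
proof (rule ccontr)
  assume "\<not> ?thesis"
  moreover have "0 \<le> (\<integral>z. lowpass (z::'a) \<partial>lborel)"
    by (intro integral_nonneg_AE) (simp add: lowpass_nonneg)
  ultimately have "(\<integral>z. lowpass (z::'a) \<partial>lborel) = 0" by linarith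
  then have "l2_le (fourier tent :: 'a \<Rightarrow> complex) 0"
    using l2_le_sharp(2)[OF fourier_tent_l2[where 'a = 'a]] by (simp add: lowpass_def)
  then have "l2_le (tent :: 'a \<Rightarrow> complex) 0"
    using tent_support by - (rule Plancherel_le[OF measurable_tent tent_le, where r = "1/4"], auto)
  then have "(\<integral>\<^sup>+x. ennreal ((cmod (tent (x::'a)))\<^sup>2) \<partial>lborel) = 0"
    using l2_le_bound by fastforce
  moreover have "ennreal ((1/8)\<^sup>2) * emeasure lborel (ball (0::'a) (1/8)) \<le> (\<integral>\<^sup>+x. ennreal ((cmod (tent (x::'a)))\<^sup>2) \<partial>lborel)"
  proof -
    have "ennreal ((1/8)\<^sup>2) * emeasure lborel (ball (0::'a) (1/8)) = (\<integral>\<^sup>+x. ennreal ((1/8)\<^sup>2) * indicator (ball (0::'a) (1/8)) x \<partial>lborel)"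
      by (rule nn_integral_cmult_indicator[symmetric]) simp
    also have "\<dots> \<le> (\<integral>\<^sup>+x. ennreal ((cmod (tent (x::'a)))\<^sup>2) \<partial>lborel)"
    proof (rule nn_integral_mono)
      fix x :: 'a
      show "ennreal ((1/8)\<^sup>2) * indicator (ball 0 (1/8)) x \<le> ennreal ((cmod (tent x))\<^sup>2)"
      proof (cases "norm x < 1/8")
        case True
        have "cmod (tent x) = max 0 (1/4 - norm x)" by (simp only: tent_def norm_of_real)
          with True have "1/8 \<le> cmod (tent x)" by simp
        then have "(1/8)\<^sup>2 \<le> (cmod (tent x))\<^sup>2" by (intro power_mono) auto
        then show ?thesis using True by (simp add: ennreal_leI)
      qed simp
    qed
    finally show ?thesis .
  qed
  ultimately have "emeasure lborel (ball (0::'a) (1/8)) = 0" by simp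
  then show False using unit_ball_vol_pos[of "real DIM('a)"] by (simp add: emeasure_ball)
qed

lemma fourier_translate:
  "fourier (\<lambda>s. f (s + v)) z = ee (v \<bullet> z) * fourier f z"
proof -
  have "fourier (\<lambda>s. f (s + v)) z = (\<integral>s. f (s - v + v) * ee (- ((s - v) \<bullet> z)) \<partial>lborel)"
    unfolding fourier_ee by (rule integral_lborel_translate(3)[symmetric])
  also have "\<dots> = (\<integral>s. ee (v \<bullet> z) * (f s * ee (- (s \<bullet> z))) \<partial>lborel)"
    by (intro Bochner_Integration.integral_cong refl) (simp add: inner_diff_left ee_add[symmetric] algebra_simps)
  finally show ?thesis unfolding fourier_ee by simp
qed

text \<open>
  Bessel's inequality for the difference quotient \<open>(tent(s + t b) - tent(s)) / t\<close>, which is bounded by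
  1 with support in a fixed ball, followed by Fatou's lemma for \<open>t \<rightarrow> 0\<close>.
\<close>

lemma lowpass_directional_moment:
  fixes b :: "'a::euclidean_space"
  assumes b: "b \<in> Basis"
  shows "(\<integral>\<^sup>+z. ennreal (lowpass z * (2 * pi * (z \<bullet> b))\<^sup>2) \<partial>lborel) \<le> ennreal (measure lborel (cball (0::'a) 1))"
proof -
  let ?V = "measure lborel (cball (0::'a) 1)"
  let ?t = "\<lambda>n. 1 / real (n + 2)"
  have le: "(\<integral>\<^sup>+z. ennreal (lowpass z * (2 * sin (pi * (?t n * (z \<bullet> b))) / ?t n)\<^sup>2) \<partial>lborel) \<le> ennreal ?V" for n
  proof -
    have t: "0 < ?t n" "?t n \<le> 1/2" by auto
    let ?g = "\<lambda>s. tent (s + ?t n *\<^sub>R b) - tent s"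
    have gB: "cmod (?g s) \<le> ?t n" for s
      using tent_lipschitz[of s "?t n *\<^sub>R b"] b by simp
    have gs: "?g s = 0" if "norm s > 1" for s
    proof -
      have "norm s - norm (?t n *\<^sub>R b) \<le> norm (s + ?t n *\<^sub>R b)" by (rule norm_diff_ineq)
      moreover have "norm (?t n *\<^sub>R b) \<le> 1/2" using t b by simp
      ultimately have "norm (s + ?t n *\<^sub>R b) > 1/4" using that by linarith
      then show ?thesis using that by (simp add: tent_support)
    qed
    have g: "integrable lborel ?g" "l2_le ?g (?t n * sqrt ?V)"
      using bounded_support_l2[of ?g "?t n" 1] gB gs by auto
    have "fourier ?g z = (ee (?t n * (z \<bullet> b)) - 1) * fourier tent z" for z
    proof -
      have "integrable lborel (\<lambda>s. tent (s + ?t n *\<^sub>R b))" by (rule integrable_lborel_translate(2)[OF tent_l2(1)])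
      from fourier_diff[OF this tent_l2(1)] show ?thesis
        by (simp only: fourier_translate) (simp add: algebra_simps inner_commute)
    qed
    then have F: "(cmod (fourier ?g z))\<^sup>2 = 4 * (sin (pi * (?t n * (z \<bullet> b))))\<^sup>2 * lowpass z" for z
      by (simp only: norm_mult power_mult_distrib ee_diff_1_power2 lowpass_def)
    then have eq: "ennreal (lowpass z * (2 * sin (pi * (?t n * (z \<bullet> b))) / ?t n)\<^sup>2) = ennreal (1 / (?t n)\<^sup>2) * ennreal ((cmod (fourier ?g z))\<^sup>2)" for z
    proof -
      have "L * (2 * S / t)\<^sup>2 = 1 / t\<^sup>2 * (4 * S\<^sup>2 * L)" for L S t :: real
        by (simp add: power_divide power_mult_distrib)
      from this[of "lowpass z" "sin (pi * (?t n * (z \<bullet> b)))" "?t n"]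
      show ?thesis by (simp only: F) (rule ennreal_mult; simp add: lowpass_nonneg)
    qed
    have "(\<integral>\<^sup>+z. ennreal (lowpass z * (2 * sin (pi * (?t n * (z \<bullet> b))) / ?t n)\<^sup>2) \<partial>lborel) =
        ennreal (1 / (?t n)\<^sup>2) * (\<integral>\<^sup>+z. ennreal ((cmod (fourier ?g z))\<^sup>2) \<partial>lborel)"
      unfolding eq by (rule nn_integral_cmult) measurable
    also have "\<dots> \<le> ennreal (1 / (?t n)\<^sup>2) * ennreal ((?t n * sqrt ?V)\<^sup>2)"
      by (intro mult_left_mono l2_le_bound[OF Bessel[OF g]]) auto
    also have "\<dots> = ennreal ?V"
    proof -
      have "1 / t\<^sup>2 * (t * s)\<^sup>2 = s\<^sup>2" if "t \<noteq> 0" for t s :: real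
        using that by (simp add: power_mult_distrib)
      from this[of "?t n" "sqrt ?V"] t(1)
      have "1 / (?t n)\<^sup>2 * (?t n * sqrt ?V)\<^sup>2 = ?V" by simp
      then show ?thesis by (subst ennreal_mult[symmetric]) (simp_all only: zero_le_power2 zero_le_divide_1_iff)
    qed
    finally show ?thesis .
  qed
  have "(\<integral>\<^sup>+z. ennreal (lowpass z * (2 * pi * (z \<bullet> b))\<^sup>2) \<partial>lborel) =
      (\<integral>\<^sup>+z. liminf (\<lambda>n. ennreal (lowpass z * (2 * sin (pi * (?t n * (z \<bullet> b))) / ?t n)\<^sup>2)) \<partial>lborel)"
  proof (rule nn_integral_cong)
    fix z :: 'a
    have "(\<lambda>n. 2 * sin (pi * (1 / real (n + 2) * c)) / (1 / real (n + 2))) \<longlonglongrightarrow> 2 * pi * c" for c :: real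
      by real_asymp
    then have "(\<lambda>n. ennreal (lowpass z * (2 * sin (pi * (?t n * (z \<bullet> b))) / ?t n)\<^sup>2)) \<longlonglongrightarrow> ennreal (lowpass z * (2 * pi * (z \<bullet> b))\<^sup>2)"
      by (intro tendsto_ennrealI tendsto_intros)
    from lim_imp_Liminf[OF _ this]
    show "ennreal (lowpass z * (2 * pi * (z \<bullet> b))\<^sup>2) = liminf (\<lambda>n. ennreal (lowpass z * (2 * sin (pi * (?t n * (z \<bullet> b))) / ?t n)\<^sup>2))"
      by simp
  qed
  also have "\<dots> \<le> liminf (\<lambda>n. \<integral>\<^sup>+z. ennreal (lowpass z * (2 * sin (pi * (?t n * (z \<bullet> b))) / ?t n)\<^sup>2) \<partial>lborel)"
    by (rule nn_integral_liminf) measurable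
  also have "\<dots> \<le> liminf (\<lambda>n::nat. ennreal ?V)"
    by (intro Liminf_mono always_eventually allI le)
  also have "\<dots> = ennreal ?V" by (simp add: Liminf_const)
  finally show ?thesis .
qed

lemma lowpass_moment: "(\<integral>\<^sup>+z. ennreal (norm z * lowpass (z::'a::euclidean_space)) \<partial>lborel) < \<infinity>"
proof -
  have n2: "(norm x)\<^sup>2 = (\<Sum>b\<in>Basis. (x \<bullet> b)\<^sup>2)" for x :: 'a
    unfolding power2_norm_eq_inner by (subst euclidean_inner) (simp add: power2_eq_square)
  have "(\<integral>\<^sup>+z. ennreal (norm z * lowpass (z::'a)) \<partial>lborel) \<le>
      (\<integral>\<^sup>+z. ennreal (lowpass z) + (\<Sum>b\<in>(Basis::'a set). ennreal (lowpass z * (2 * pi * (z \<bullet> b))\<^sup>2)) \<partial>lborel)"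
  proof (rule nn_integral_mono)
    fix z :: 'a
    have "norm z \<le> 1 + (norm z)\<^sup>2"
      using sum_squares_bound[of 1 "norm z"] by (simp add: power2_eq_square)
         (smt (verit) norm_ge_zero zero_le_mult_iff)
    also have "\<dots> \<le> 1 + (2 * pi)\<^sup>2 * (norm z)\<^sup>2"
    proof -
      have "(1::real)\<^sup>2 \<le> (2 * pi)\<^sup>2" using pi_gt3 by (intro power_mono) auto
      then have "1 * (norm z)\<^sup>2 \<le> (2 * pi)\<^sup>2 * (norm z)\<^sup>2" by (intro mult_right_mono) auto
      then show ?thesis by simp
    qed
    also have "\<dots> = 1 + (\<Sum>b\<in>Basis. (2 * pi * (z \<bullet> b))\<^sup>2)"
      by (simp add: n2 sum_distrib_left power_mult_distrib)
    finally have "norm z * lowpass z \<le> (1 + (\<Sum>b\<in>Basis. (2 * pi * (z \<bullet> b))\<^sup>2)) * lowpass z"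
      by (rule mult_right_mono) (rule lowpass_nonneg)
    also have "\<dots> = lowpass z + (\<Sum>b\<in>Basis. lowpass z * (2 * pi * (z \<bullet> b))\<^sup>2)"
      by (simp only: distrib_right mult_1 sum_distrib_right) (simp only: mult.commute)
    finally have "ennreal (norm z * lowpass z) \<le> ennreal (lowpass z + (\<Sum>b\<in>Basis. lowpass z * (2 * pi * (z \<bullet> b))\<^sup>2))"
      by (rule ennreal_leI)
    then show "ennreal (norm z * lowpass z) \<le> ennreal (lowpass z) + (\<Sum>b\<in>(Basis::'a set). ennreal (lowpass z * (2 * pi * (z \<bullet> b))\<^sup>2))"
      by (simp add: lowpass_nonneg sum_nonneg ennreal_plus sum_ennreal)
  qed
  also have "\<dots> = (\<integral>\<^sup>+z. ennreal (lowpass (z::'a)) \<partial>lborel) + (\<Sum>b\<in>(Basis::'a set). \<integral>\<^sup>+z. ennreal (lowpass z * (2 * pi * (z \<bullet> b))\<^sup>2) \<partial>lborel)"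
    by (subst nn_integral_add) (auto simp: nn_integral_sum)
  also have "\<dots> < \<infinity>"
  proof -
    have "(\<integral>\<^sup>+z. ennreal (lowpass (z::'a)) \<partial>lborel) < \<infinity>"
      using integrable_lowpass[where 'a='a] by (simp add: integrable_iff_bounded lowpass_nonneg)
    moreover have "(\<Sum>b\<in>(Basis::'a set). \<integral>\<^sup>+z. ennreal (lowpass z * (2 * pi * (z \<bullet> b))\<^sup>2) \<partial>lborel) < \<infinity>"
      by (auto simp: less_top[symmetric] top_unique dest!: lowpass_directional_moment)
    ultimately show ?thesis by simp
  qed
  finally show ?thesis .
qed

definition lowpass_at :: "real \<Rightarrow> 'a::euclidean_space \<Rightarrow> real" where
  "lowpass_at lam z = lam ^ DIM('a) * lowpass (lam *\<^sub>R z) / (\<integral>z. lowpass (z::'a) \<partial>lborel)"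

lemma lowpass_at_nonneg: "0 < lam \<Longrightarrow> 0 \<le> lowpass_at lam z"
  unfolding lowpass_at_def by (intro divide_nonneg_nonneg mult_nonneg_nonneg lowpass_nonneg
    less_imp_le[OF lowpass_integral_pos]) auto

lemma integrable_lowpass_at: "0 < lam \<Longrightarrow> integrable lborel (lowpass_at lam)"
  unfolding lowpass_at_def[abs_def]
  using integrable_lborel_affine[OF integrable_lowpass, of lam 0]
  by (auto intro!: Bochner_Integration.integrable_divide Bochner_Integration.integrable_mult_right)

lemma integral_lowpass_at:
  assumes "0 < lam" shows "(\<integral>z. lowpass_at lam (z::'a::euclidean_space) \<partial>lborel) = 1"
proof -
  have "(\<integral>z. lowpass_at lam (z::'a) \<partial>lborel) = lam ^ DIM('a) * (\<integral>z. lowpass (0 + lam *\<^sub>R (z::'a)) \<partial>lborel) / (\<integral>z. lowpass (z::'a) \<partial>lborel)"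
    unfolding lowpass_at_def by simp
  also have "lam ^ DIM('a) * (\<integral>z. lowpass (0 + lam *\<^sub>R (z::'a)) \<partial>lborel) = (\<integral>z. lowpass (z::'a) \<partial>lborel)"
    using integral_lborel_affine[of lam "lowpass :: 'a \<Rightarrow> real" 0] assms by simp
  finally show ?thesis using lowpass_integral_pos[where 'a='a] by simp
qed

lemma lowpass_at_l2:
  assumes "0 < lam" shows "\<exists>d. l2_le (\<lambda>z::'a::euclidean_space. complex_of_real (lowpass_at lam z)) d"
proof -
  obtain d where d: "l2_le (\<lambda>z::'a. complex_of_real (lowpass z)) d" using lowpass_l2 by blast
  let ?I = "\<integral>\<^sup>+z. ennreal ((cmod (complex_of_real (lowpass (lam *\<^sub>R (z::'a)))))\<^sup>2) \<partial>lborel"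
  have "ennreal (\<bar>lam\<bar> ^ DIM('a)) * ?I \<le> ennreal (d\<^sup>2)"
    using l2_le_bound[OF d] nn_integral_lborel_affine[of "\<lambda>z::'a. ennreal ((cmod (complex_of_real (lowpass z)))\<^sup>2)" lam 0] assms
    by simp
  then have "ennreal (\<bar>lam\<bar> ^ DIM('a)) * ?I < \<infinity>" by (rule le_less_trans) simp
  then have "?I < \<infinity>" using assms by (auto simp: ennreal_mult_less_top)
  then have "l2_le (\<lambda>z::'a. complex_of_real (lowpass (lam *\<^sub>R z))) (sqrt (enn2real ?I))"
    by (simp add: l2_le_def less_top)
  from l2_le_cmult[OF this, of "of_real (lam ^ DIM('a) / (\<integral>z. lowpass (z::'a) \<partial>lborel))"]
  show ?thesis by (auto simp: lowpass_at_def)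
qed

lemma lowpass_at_moment:
  "\<exists>C\<ge>0. \<forall>lam>0. (\<integral>\<^sup>+z. ennreal (norm z * lowpass_at lam (z::'a::euclidean_space)) \<partial>lborel) \<le> ennreal (C / lam)"
proof -
  let ?I = "\<integral>z. lowpass (z::'a) \<partial>lborel"
  define M where "M = enn2real (\<integral>\<^sup>+z. ennreal (norm z * lowpass (z::'a)) \<partial>lborel)"
  have M: "(\<integral>\<^sup>+z. ennreal (norm z * lowpass (z::'a)) \<partial>lborel) = ennreal M" and M0: "0 \<le> M"
    using lowpass_moment[where 'a='a] by (auto simp: M_def less_top)
  have I: "0 < ?I" by (rule lowpass_integral_pos)
  have "(\<integral>\<^sup>+z. ennreal (norm z * lowpass_at lam (z::'a)) \<partial>lborel) \<le> ennreal (M / ?I / lam)" if lam: "lam > 0" for lam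
  proof -
    have "(\<integral>\<^sup>+z. ennreal (norm z * lowpass_at lam (z::'a)) \<partial>lborel) =
        (\<integral>\<^sup>+z. ennreal (1 / (?I * lam)) * (ennreal (\<bar>lam\<bar> ^ DIM('a)) * ennreal (norm (lam *\<^sub>R z) * lowpass (lam *\<^sub>R (z::'a)))) \<partial>lborel)"
      using lam I by (intro nn_integral_cong) (simp add: lowpass_at_def lowpass_nonneg field_simps flip: ennreal_mult)
    also have "\<dots> = ennreal (1 / (?I * lam)) * (ennreal (\<bar>lam\<bar> ^ DIM('a)) * (\<integral>\<^sup>+z. ennreal (norm (lam *\<^sub>R z) * lowpass (lam *\<^sub>R (z::'a))) \<partial>lborel))"
      by (simp add: nn_integral_cmult)
    also have "ennreal (\<bar>lam\<bar> ^ DIM('a)) * (\<integral>\<^sup>+z. ennreal (norm (lam *\<^sub>R z) * lowpass (lam *\<^sub>R (z::'a))) \<partial>lborel) = ennreal M"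
      using nn_integral_lborel_affine[of "\<lambda>z::'a. ennreal (norm z * lowpass z)" lam 0] lam M by simp
    also have "ennreal (1 / (?I * lam)) * ennreal M = ennreal (M / ?I / lam)"
      using lam I M0 by (simp flip: ennreal_mult)
    finally show ?thesis by simp
  qed
  moreover have "0 \<le> M / ?I" using M0 I by simp
  ultimately show ?thesis by blast
qed

section \<open>Smooth functions of one variable and tensor products\<close>

text \<open>
  Infinite differentiability as a greatest fixed point: coinduction spares all formulas for higher
  derivatives of products.
\<close>

coinductive smooth1 :: "(real \<Rightarrow> complex) \<Rightarrow> bool" where
  "(\<And>t. (f has_vector_derivative f' t) (at t)) \<Longrightarrow> smooth1 f' \<Longrightarrow> smooth1 f"

lemma smooth1_deriv:
  assumes "smooth1 f"
  obtains f' where "\<And>t. (f has_vector_derivative f' t) (at t)" "smooth1 f'"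
  using assms by (cases rule: smooth1.cases) auto

lemma smooth1_continuous:
  assumes "smooth1 f" shows "continuous_on A f"
proof -
  obtain f' where "\<And>t. (f has_vector_derivative f' t) (at t)" using smooth1_deriv[OF assms] by blast
  then show ?thesis
    by (meson continuous_at_imp_continuous_on has_vector_derivative_continuous)
qed

text \<open>
  The derivative of a product is a sum of two products, so coinduction for products has to
  include the sums.\<close>

inductive smooth1_products :: "(real \<Rightarrow> complex) \<Rightarrow> bool" where
  "smooth1 g \<Longrightarrow> smooth1 k \<Longrightarrow> smooth1_products (\<lambda>t. g t * k t)"
| "smooth1_products f \<Longrightarrow> smooth1_products g \<Longrightarrow> smooth1_products (\<lambda>t. f t + g t)"

lemma smooth1_products_deriv:
  assumes "smooth1_products f"
  shows "\<exists>f'. (\<forall>t. (f has_vector_derivative f' t) (at t)) \<and> smooth1_products f'"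
  using assms
proof induction
  case (1 g k)
  obtain g' where g': "\<And>t. (g has_vector_derivative g' t) (at t)" "smooth1 g'" using 1 smooth1_deriv by blast
  obtain k' where k': "\<And>t. (k has_vector_derivative k' t) (at t)" "smooth1 k'" using 1 smooth1_deriv by blast
  have "((\<lambda>t. g t * k t) has_vector_derivative g t * k' t + g' t * k t) (at t)" for t
    by (rule has_vector_derivative_mult[OF g'(1) k'(1)])
  moreover have "smooth1_products (\<lambda>t. g t * k' t + g' t * k t)"
    using 1 g' k' by (intro smooth1_products.intros)
  ultimately show ?case by (intro exI[of _ "\<lambda>t. g t * k' t + g' t * k t"]) auto
next
  case (2 f g)
  then obtain f' g' where d: "\<And>t. (f has_vector_derivative f' t) (at t)" "\<And>t. (g has_vector_derivative g' t) (at t)"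
    and p: "smooth1_products f'" "smooth1_products g'" by blast
  have "((\<lambda>t. f t + g t) has_vector_derivative f' t + g' t) (at t)" for t
    by (intro has_vector_derivative_add d)
  moreover have "smooth1_products (\<lambda>t. f' t + g' t)" using p by (rule smooth1_products.intros)
  ultimately show ?case by (intro exI[of _ "\<lambda>t. f' t + g' t"]) auto
qed

lemma smooth1_mult:
  assumes "smooth1 g" "smooth1 k" shows "smooth1 (\<lambda>t. g t * k t)"
proof -
  have "smooth1_products (\<lambda>t. g t * k t)" using assms by (rule smooth1_products.intros)
  then show ?thesis
  proof (rule smooth1.coinduct)
    fix f assume "smooth1_products f"
    then obtain f' where "\<forall>t. (f has_vector_derivative f' t) (at t)" "smooth1_products f'"
      using smooth1_products_deriv by blast
    then show "\<exists>g g'. f = g \<and> (\<forall>t. (g has_vector_derivative g' t) (at t)) \<and> (smooth1_products g' \<or> smooth1 g')"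
      by (intro exI[of _ f] exI[of _ f']) auto
  qed
qed

lemma smooth1_affine:
  assumes "smooth1 g" shows "smooth1 (\<lambda>t. a * g (c * t + s))"
proof -
  let ?P = "\<lambda>f. \<exists>a g. smooth1 g \<and> f = (\<lambda>t. a * g (c * t + s))"
  have "?P (\<lambda>t. a * g (c * t + s))" using assms by (intro exI[of _ a] exI[of _ g]) simp
  then show ?thesis
  proof (rule smooth1.coinduct[where X = ?P])
    fix f assume "?P f"
    then obtain a g where g: "smooth1 g" and f: "f = (\<lambda>t. a * g (c * t + s))" by (elim exE conjE)
    obtain g' where g': "\<And>t. (g has_vector_derivative g' t) (at t)" "smooth1 g'" using g smooth1_deriv by blast
    have "(f has_vector_derivative (a * of_real c) * g' (c * t + s)) (at t)" for t
    proof -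
      have "((\<lambda>t. c * t + s) has_real_derivative c) (at t)" by (auto intro!: derivative_eq_intros)
      then have "((\<lambda>t. c * t + s) has_vector_derivative c) (at t)" by (simp add: has_real_derivative_iff_has_vector_derivative)
      from vector_diff_chain_at[OF this g'(1)]
      have "((\<lambda>t. g (c * t + s)) has_vector_derivative c *\<^sub>R g' (c * t + s)) (at t)" by (simp add: o_def)
      from has_vector_derivative_mult_right[OF this, of a]
      show ?thesis unfolding f by (simp add: scaleR_conv_of_real mult.assoc)
    qed
    moreover have "?P (\<lambda>t. (a * of_real c) * g' (c * t + s))"
      using g'(2) by (intro exI[of _ "a * of_real c"] exI[of _ g']) simp
    ultimately show "\<exists>h h'. f = h \<and> (\<forall>t. (h has_vector_derivative h' t) (at t)) \<and> (?P h' \<or> smooth1 h')"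
      by (intro exI[of _ f] exI[of _ "\<lambda>t. (a * of_real c) * g' (c * t + s)"]) auto
  qed
qed

lemma smooth1_ee: "smooth1 (\<lambda>t. a * ee (x * t))"
proof -
  let ?P = "\<lambda>f. \<exists>a. f = (\<lambda>t. a * ee (x * t))"
  have d: "((\<lambda>t. a * ee (x * t)) has_vector_derivative (a * (2 * of_real pi * \<i> * of_real x)) * ee (x * t)) (at t)" for a t
  proof -
    have "((\<lambda>z. a * exp (2 * of_real pi * \<i> * of_real x * z)) has_field_derivative
        a * (exp (2 * of_real pi * \<i> * of_real x * of_real t) * (2 * of_real pi * \<i> * of_real x))) (at (of_real t))"
      by (auto intro!: derivative_eq_intros)
    from has_vector_derivative_real_field[OF this]
    show ?thesis by (simp add: ee_def ac_simps)
  qed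
  have "?P (\<lambda>t. a * ee (x * t))" by (rule exI) (rule refl)
  then show ?thesis
  proof (rule smooth1.coinduct[where X = ?P])
    fix f assume "?P f"
    then obtain a where f: "f = (\<lambda>t. a * ee (x * t))" by (elim exE)
    show "\<exists>h h'. f = h \<and> (\<forall>t. (h has_vector_derivative h' t) (at t)) \<and> (?P h' \<or> smooth1 h')"
      using d[of a] unfolding f
      by (intro exI[of _ "\<lambda>t. a * ee (x * t)"] exI[of _ "\<lambda>t. (a * (2 * of_real pi * \<i> * of_real x)) * ee (x * t)"]) auto
  qed
qed

lemma smooth1_cnj:
  assumes "smooth1 g" shows "smooth1 (\<lambda>t. cnj (g t))"
proof -
  let ?P = "\<lambda>f. \<exists>g. smooth1 g \<and> f = (\<lambda>t. cnj (g t))"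
  have "?P (\<lambda>t. cnj (g t))" using assms by (intro exI[of _ g]) simp
  then show ?thesis
  proof (rule smooth1.coinduct[where X = ?P])
    fix f assume "?P f"
    then obtain g where g: "smooth1 g" and f: "f = (\<lambda>t. cnj (g t))" by (elim exE conjE)
    obtain g' where g': "\<And>t. (g has_vector_derivative g' t) (at t)" "smooth1 g'" using g smooth1_deriv by blast
    have "(f has_vector_derivative cnj (g' t)) (at t)" for t
      unfolding f by (rule has_vector_derivative_cnj[OF g'(1)])
    moreover have "?P (\<lambda>t. cnj (g' t))" using g'(2) by (intro exI[of _ g']) simp
    ultimately show "\<exists>h h'. f = h \<and> (\<forall>t. (h has_vector_derivative h' t) (at t)) \<and> (?P h' \<or> smooth1 h')"
      by (intro exI[of _ f] exI[of _ "\<lambda>t. cnj (g' t)"]) auto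
  qed
qed

lemma test_function_smooth1:
  assumes "\<beta> \<in> test_functions" shows "smooth1 \<beta>"
proof -
  have d: "iter_partial (replicate n 1) \<beta> differentiable (at x)" for n and x :: real
  proof -
    have "replicate n (1::real) \<in> lists Basis" by (simp add: in_lists_conv_set)
    then show ?thesis using assms unfolding test_functions_def smooth_def by blast
  qed
  have "((iter_partial (replicate n 1) \<beta>) has_vector_derivative iter_partial (replicate (Suc n) 1) \<beta> x) (at x)" for n x
    using d[of n x] unfolding frechet_derivative_works has_vector_derivative_def
    by (simp add: linear_frechet_derivative linear_scale[symmetric] d)
  then have D: "\<forall>n. \<forall>x. ((iter_partial (replicate n 1) \<beta>) has_vector_derivative iter_partial (replicate (Suc n) 1) \<beta> x) (at x)" by blast
  let ?P = "\<lambda>f. \<exists>n. f = iter_partial (replicate n 1) \<beta>"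
  have "?P \<beta>" by (intro exI[of _ 0]) simp
  then show ?thesis
  proof (rule smooth1.coinduct[where X = ?P])
    fix f assume "?P f"
    then obtain n where f: "f = iter_partial (replicate n 1) \<beta>" by (elim exE)
    have "?P (iter_partial (replicate (Suc n) 1) \<beta>)" by (rule exI) (rule refl)
    then show "\<exists>h h'. f = h \<and> (\<forall>t. (h has_vector_derivative h' t) (at t)) \<and> (?P h' \<or> smooth1 h')"
      using D[rule_format, of n]
      by (intro exI[of _ f] exI[of _ "iter_partial (replicate (Suc n) 1) \<beta>"] conjI allI disjI1) (simp_all only: f)
  qed
qed

lemma test_function_support:
  fixes \<beta> :: "real \<Rightarrow> complex"
  assumes "fun_support \<beta> \<subseteq> {1/2<..<2}" and "\<beta> t \<noteq> 0"
  shows "1/2 < t \<and> t < 2"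
proof -
  have "t \<in> fun_support \<beta>"
    unfolding fun_support_def using assms(2) by (intro subsetD[OF closure_subset]) (simp add: support_on_def)
  with assms(1) show ?thesis by auto
qed

definition tensor :: "('a::euclidean_space \<Rightarrow> real \<Rightarrow> complex) \<Rightarrow> 'a \<Rightarrow> complex" where
  "tensor g x = (\<Prod>b\<in>Basis. g b (x \<bullet> b))"

lemma tensor_has_derivative:
  assumes "\<And>b t. b \<in> Basis \<Longrightarrow> (g b has_vector_derivative g' b t) (at t)"
  shows "(tensor g has_derivative (\<lambda>h. \<Sum>b\<in>Basis. ((h \<bullet> b) *\<^sub>R g' b (x \<bullet> b)) * (\<Prod>c\<in>Basis - {b}. g c (x \<bullet> c)))) (at x)"
  unfolding tensor_def[abs_def]
proof (rule has_derivative_prod)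
  fix b :: 'a assume b: "b \<in> Basis"
  have "(g b has_derivative (\<lambda>h. h *\<^sub>R g' b (x \<bullet> b))) (at (x \<bullet> b))"
    using assms[OF b] by (simp add: has_vector_derivative_def)
  then have "((g b \<circ> (\<lambda>x. x \<bullet> b)) has_derivative ((\<lambda>h. h *\<^sub>R g' b (x \<bullet> b)) \<circ> (\<lambda>h. h \<bullet> b))) (at x)"
    by (intro diff_chain_at) (auto intro!: derivative_eq_intros)
  then show "((\<lambda>x. g b (x \<bullet> b)) has_derivative (\<lambda>h. (h \<bullet> b) *\<^sub>R g' b (x \<bullet> b))) (at x)"
    by (simp add: o_def)
qed

text \<open>
  A partial derivative of a tensor product differentiates one factor, so the class of tensor products of
  smooth functions is stable under it.
\<close>

lemma tensor_iter_partial: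
  assumes "bs \<in> lists Basis" "\<And>b. smooth1 (g b)"
  shows "\<exists>g'. (\<forall>b. smooth1 (g' b)) \<and> iter_partial bs (tensor g) = tensor g'"
  using assms(1)
proof (induction bs)
  case Nil
  then show ?case using assms(2) by auto
next
  case (Cons b bs)
  then obtain g1 where g1: "\<And>b. smooth1 (g1 b)" and eq: "iter_partial bs (tensor g) = tensor g1" by auto
  have b: "b \<in> Basis" using Cons by auto
  have "\<forall>c. \<exists>d. (\<forall>t. (g1 c has_vector_derivative d t) (at t)) \<and> smooth1 d"
    using g1 smooth1_deriv by metis
  then obtain d where d: "\<And>c t. (g1 c has_vector_derivative d c t) (at t)" "\<And>c. smooth1 (d c)" by metis
  have "iter_partial (b # bs) (tensor g) x = tensor (g1(b := d b)) x" for x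
  proof -
    have "iter_partial (b # bs) (tensor g) x = frechet_derivative (tensor g1) (at x) b" by (simp add: eq)
    also have "\<dots> = (\<Sum>c\<in>Basis. ((b \<bullet> c) *\<^sub>R d c (x \<bullet> c)) * (\<Prod>c'\<in>Basis - {c}. g1 c' (x \<bullet> c')))"
      by (subst frechet_derivative_at[OF tensor_has_derivative[OF d(1)], symmetric]) simp
    also have "\<dots> = (\<Sum>c\<in>Basis. if c = b then d b (x \<bullet> b) * (\<Prod>c'\<in>Basis - {b}. g1 c' (x \<bullet> c')) else 0)"
      using b by (intro sum.cong) (auto simp: inner_Basis)
    also have "\<dots> = d b (x \<bullet> b) * (\<Prod>c'\<in>Basis - {b}. g1 c' (x \<bullet> c'))" using b by simp
    also have "\<dots> = tensor (g1(b := d b)) x"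
      unfolding tensor_def using b by (subst (2) prod.remove[of _ b]) (auto intro!: prod.cong)
    finally show ?thesis .
  qed
  then have "iter_partial (b # bs) (tensor g) = tensor (g1(b := d b))" by (rule ext)
  moreover have "\<forall>c. smooth1 ((g1(b := d b)) c)" using g1 d(2) by simp
  ultimately show ?case by blast
qed

lemma smooth_tensor:
  assumes "\<And>b. smooth1 (g b)" shows "smooth (tensor g)"
  unfolding smooth_def
proof (intro ballI allI)
  fix bs :: "'a list" and x assume "bs \<in> lists Basis"
  from tensor_iter_partial[of bs g, OF this assms]
  obtain g1 where g1: "\<And>b. smooth1 (g1 b)" and eq: "iter_partial bs (tensor g) = tensor g1" by auto
  have "\<forall>c. \<exists>d. (\<forall>t. (g1 c has_vector_derivative d t) (at t)) \<and> smooth1 d"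
    using g1 smooth1_deriv by metis
  then obtain d where d: "\<And>c t. (g1 c has_vector_derivative d c t) (at t)" by metis
  show "iter_partial bs (tensor g) differentiable (at x)"
    unfolding eq by (rule differentiableI[OF tensor_has_derivative[OF d]])
qed

lemma continuous_tensor:
  assumes "\<And>b. smooth1 (g b)" shows "continuous_on A (tensor g)"
  unfolding tensor_def[abs_def]
  by (intro continuous_intros continuous_on_compose2[OF smooth1_continuous[OF assms, of UNIV]]) auto

section \<open>Functions without low frequencies\<close>

text \<open>
  The last condition provides test functions that concentrate at an arbitrary point \<open>s\<close> and whose Fourier
  transforms are translated by an arbitrary \<open>x\<close>.
\<close>

definition bump :: "('a::euclidean_space \<Rightarrow> complex) \<Rightarrow> bool" where
  "bump G \<longleftrightarrow> continuous_on UNIV G \<and> (\<forall>x. norm x > 1/2 \<longrightarrow> G x = 0) \<and> (\<exists>B. \<forall>x. cmod (G x) \<le> B) \<and>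
     (\<integral>x. G x \<partial>lborel) \<noteq> 0 \<and> (\<forall>h>0. \<forall>s x. smooth (\<lambda>\<xi>. G ((\<xi> - s) /\<^sub>R h) * ee (x \<bullet> \<xi>)))"

text \<open>
  A nonzero \<open>\<beta>\<close> already contains a bump: \<open>\<bar>\<beta>\<bar>\<^sup>2\<close> is nonnegative, and a product over the coordinates of rescaled
  copies of it, moved so that \<open>t0\<close> goes to the origin, is positive there and has small support.
\<close>

lemma bump_exists:
  fixes \<beta> :: "real \<Rightarrow> complex"
  assumes \<beta>: "\<beta> \<in> test_functions" and supp: "fun_support \<beta> \<subseteq> {1/2<..<2}" and nz: "\<beta> t0 \<noteq> 0"
  shows "\<exists>G :: 'a::euclidean_space \<Rightarrow> complex. bump G"
proof -
  have s\<beta>: "smooth1 \<beta>" by (rule test_function_smooth1[OF \<beta>])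
  note \<beta>0 = test_function_support[OF supp]
  \<comment> \<open>Dilating by \<open>k\<close> confines each coordinate to \<open>\<bar>t\<bar> < 1 / (2 DIM('a))\<close>, hence the tensor product to the ball of radius 1/2.\<close>
  define k where "k = 4 * real DIM('a)"
  have k: "k > 0" by (simp add: k_def)
  define \<gamma> where "\<gamma> t = \<beta> (k * t + t0) * cnj (\<beta> (k * t + t0))" for t
  have \<gamma>_eq: "\<gamma> t = of_real ((cmod (\<beta> (k * t + t0)))\<^sup>2)" for t
    unfolding \<gamma>_def by (rule complex_norm_square[symmetric])
  have s\<gamma>: "smooth1 \<gamma>"
    using smooth1_affine[OF s\<beta>, of 1 k t0] unfolding \<gamma>_def[abs_def] by (auto intro: smooth1_mult smooth1_cnj)
  have \<gamma>0: "\<bar>t\<bar> < 1 / (2 * real DIM('a))" if "\<gamma> t \<noteq> 0" for t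
  proof -
    have "\<beta> (k * t + t0) \<noteq> 0" using that by (auto simp: \<gamma>_def)
    from \<beta>0[OF this] \<beta>0[OF nz] have "\<bar>k * t\<bar> < 2" by linarith
    then have "k * \<bar>t\<bar> < 2" using k by (simp add: abs_mult)
    then show ?thesis using k by (simp add: k_def field_simps)
  qed
  let ?G = "tensor (\<lambda>_::'a. \<gamma>)"
  have cont: "continuous_on UNIV ?G" by (rule continuous_tensor[OF s\<gamma>])
  have supp: "?G x = 0" if "norm x > 1/2" for x
  proof (rule ccontr)
    assume "?G x \<noteq> 0"
    then have "\<And>b. b \<in> Basis \<Longrightarrow> \<bar>x \<bullet> b\<bar> < 1 / (2 * real DIM('a))" by (auto simp: tensor_def intro: \<gamma>0)
    then have "(\<Sum>b\<in>(Basis::'a set). \<bar>x \<bullet> b\<bar>) \<le> (\<Sum>b\<in>(Basis::'a set). 1 / (2 * real DIM('a)))"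
      by (intro sum_mono less_imp_le)
    then have "norm x \<le> 1/2" using norm_le_l1[of x] by simp
    with that show False by simp
  qed
  have bdd: "\<exists>B. \<forall>x. cmod (?G x) \<le> B"
  proof -
    have "compact (?G ` cball 0 (1/2))"
      by (intro compact_continuous_image continuous_on_subset[OF cont]) auto
    then obtain B where B: "\<And>y. y \<in> ?G ` cball 0 (1/2) \<Longrightarrow> cmod y \<le> B"
      using compact_imp_bounded bounded_iff by metis
    have "cmod (?G x) \<le> max B 0" for x
      using B[of "?G x"] supp[of x] by (cases "norm x \<le> 1/2") auto
    then show ?thesis by blast
  qed
  then obtain B where B: "\<And>x. cmod (?G x) \<le> B" by blast
  have int: "integrable lborel ?G"
    using bounded_support_l2(1)[of ?G B "1/2"] B supp borel_measurable_continuous_onI[OF cont] by auto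
  define g where "g x = (\<Prod>b\<in>(Basis::'a set). (cmod (\<beta> (k * (x \<bullet> b) + t0)))\<^sup>2)" for x
  have Gg: "?G x = of_real (g x)" for x unfolding tensor_def g_def \<gamma>_eq by simp
  have g0: "0 \<le> g x" for x unfolding g_def by (intro prod_nonneg) auto
  have gi: "integrable lborel g" using int unfolding Gg[abs_def] complex_of_real_integrable_eq .
  have pos: "(\<integral>x. ?G x \<partial>lborel) \<noteq> 0"
  proof
    assume "(\<integral>x. ?G x \<partial>lborel) = 0"
    then have "(\<integral>x. g x \<partial>lborel) = 0" unfolding Gg by simp
    then have ae: "AE x in lborel. g x = 0"
      using integral_nonneg_eq_0_iff_AE[OF gi] g0 by auto
    have gc: "continuous_on UNIV g"
      using continuous_on_norm[OF cont] g0 unfolding Gg by (simp add: abs_of_nonneg)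
    have "open {x. 0 < g x}"
      by (rule open_Collect_less[OF continuous_on_const gc])
    moreover have "0 \<in> {x. 0 < g x}" using nz by (auto simp: g_def intro: prod_pos)
    ultimately obtain e where e: "e > 0" "ball 0 e \<subseteq> {x. 0 < g x}" by (auto simp: open_contains_ball)
    have "AE x in lborel. x \<notin> ball (0::'a) e" using ae e(2) by (auto elim!: eventually_mono)
    then have "emeasure lborel (ball (0::'a) e) = 0"
      by (subst (asm) AE_iff_measurable[OF _ refl]) (auto simp: ball_def)
    then show False using unit_ball_vol_pos[of "real DIM('a)"] e(1) by (simp add: emeasure_ball)
  qed
  have "smooth (\<lambda>\<xi>. ?G ((\<xi> - s) /\<^sub>R h) * ee (x \<bullet> \<xi>))" if h: "h > 0" for h and s x :: 'a
  proof -
    have "(\<lambda>\<xi>. ?G ((\<xi> - s) /\<^sub>R h) * ee (x \<bullet> \<xi>)) =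
        tensor (\<lambda>b t. (1 * \<gamma> (inverse h * t + (- inverse h * (s \<bullet> b)))) * (1 * ee ((x \<bullet> b) * t)))"
    proof
      fix \<xi>
      have "ee (x \<bullet> \<xi>) = (\<Prod>b\<in>Basis. ee ((x \<bullet> b) * (\<xi> \<bullet> b)))"
        by (subst euclidean_inner) (simp add: ee_sum)
      then show "?G ((\<xi> - s) /\<^sub>R h) * ee (x \<bullet> \<xi>) =
        tensor (\<lambda>b t. (1 * \<gamma> (inverse h * t + (- inverse h * (s \<bullet> b)))) * (1 * ee ((x \<bullet> b) * t))) \<xi>"
        by (simp add: tensor_def prod.distrib inner_diff_left algebra_simps)
    qed
    then show ?thesis
      by (simp only:) (intro smooth_tensor smooth1_mult smooth1_affine smooth1_ee s\<gamma>)
  qed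
  with cont supp bdd pos have "bump ?G" unfolding bump_def by blast
  then show ?thesis by blast
qed

text \<open>
  Every point of the closed ball of radius \<open>lam / 2\<close> has a neighbourhood on which the Fourier transform of
  \<open>f\<close> vanishes as a distribution. By compactness the neighbourhoods can be taken to be balls of one
  radius \<open>e\<close>.
\<close>

lemma fourier_dist_vanishes_locally:
  fixes f :: "'a::euclidean_space \<Rightarrow> complex"
  assumes "fourier_support f \<subseteq> {\<xi>. lam \<le> norm \<xi>}" and "lam > 0"
  obtains e where "e > 0" "\<And>s \<phi>. norm s \<le> lam / 2 \<Longrightarrow> \<phi> \<in> test_functions \<Longrightarrow> fun_support \<phi> \<subseteq> ball s e \<Longrightarrow>
    (\<integral>y. f y * fourier \<phi> y \<partial>lborel) = 0"
proof -
  let ?C = "{U. open U \<and> (\<forall>\<phi> \<in> test_functions. fun_support \<phi> \<subseteq> U \<longrightarrow> fourier_dist (regular_dist f) \<phi> = 0)}"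
  have h1: "compact (cball (0::'a) (lam / 2))" by simp
  have h2: "cball 0 (lam / 2) \<subseteq> \<Union> ?C"
  proof
    fix s :: 'a assume "s \<in> cball 0 (lam / 2)"
    then have "s \<notin> fourier_support f" using assms by auto
    then show "s \<in> \<Union> ?C" unfolding fourier_support_def dist_support_def by simp
  qed
  have h3: "\<And>U. U \<in> ?C \<Longrightarrow> open U" by simp
  have "\<exists>e>0. \<forall>s\<in>cball 0 (lam / 2). \<exists>U\<in>?C. ball s e \<subseteq> U"
  proof (rule Heine_Borel_lemma[OF h1 h2 h3])
    fix e :: real assume "0 < e" "\<And>s. s \<in> cball 0 (lam / 2) \<Longrightarrow> \<exists>U\<in>?C. ball s e \<subseteq> U"
    then show "\<exists>e>0. \<forall>s\<in>cball 0 (lam / 2). \<exists>U\<in>?C. ball s e \<subseteq> U" by (intro exI conjI ballI)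
  qed
  then obtain e where e: "e > 0" "\<forall>s\<in>cball 0 (lam / 2). \<exists>U\<in>?C. ball s e \<subseteq> U" by (elim exE conjE)
  show ?thesis
  proof (rule that[OF e(1)])
    fix s :: 'a and \<phi> assume s: "norm s \<le> lam / 2" and \<phi>: "\<phi> \<in> test_functions" "fun_support \<phi> \<subseteq> ball s e"
    have "s \<in> cball 0 (lam / 2)" using s by simp
    then obtain U where "U \<in> ?C" "ball s e \<subseteq> U" using e(2) by (elim ballE bexE) auto
    then have "fourier_dist (regular_dist f) \<phi> = 0" using \<phi> by (auto simp: subset_trans)
    then show "(\<integral>y. f y * fourier \<phi> y \<partial>lborel) = 0" by (simp add: fourier_dist_def regular_dist_def)
  qed
qed

lemma autocorr_tent_support: "norm v > 1/2 \<Longrightarrow> autocorr tent v = 0"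
proof -
  assume v: "norm v > 1/2"
  have "tent s * cnj (tent (s + v)) = 0" for s
  proof (cases "norm s > 1/4")
    case False
    then have "norm (s + v) > 1/4" using norm_diff_ineq[of v s] v by (simp add: add.commute)
    then show ?thesis by (simp add: tent_support)
  qed (simp add: tent_support)
  then have "(\<lambda>s. tent s * cnj (tent (s + v))) = (\<lambda>s. 0)" by (rule ext)
  then show ?thesis unfolding autocorr_def by (simp only: Bochner_Integration.integral_zero)
qed

lemma fourier_bump:
  fixes G :: "'a::euclidean_space \<Rightarrow> complex"
  assumes h: "h > 0"
  shows "fourier (\<lambda>\<xi>. G ((\<xi> - s) /\<^sub>R h) * ee (x \<bullet> \<xi>)) y = of_real (h ^ DIM('a)) * (ee ((x - y) \<bullet> s) * fourier G (h *\<^sub>R (y - x)))"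
proof -
  have "fourier (\<lambda>\<xi>. G ((\<xi> - s) /\<^sub>R h) * ee (x \<bullet> \<xi>)) y = (\<integral>\<xi>. G ((\<xi> - s) /\<^sub>R h) * ee ((x - y) \<bullet> \<xi>) \<partial>lborel)"
    unfolding fourier_ee
    by (intro Bochner_Integration.integral_cong refl) (simp add: inner_diff_left inner_diff_right inner_commute mult.assoc flip: ee_add)
  also have "\<dots> = (\<bar>h\<bar> ^ DIM('a)) *\<^sub>R (\<integral>\<eta>. G ((s + h *\<^sub>R \<eta> - s) /\<^sub>R h) * ee ((x - y) \<bullet> (s + h *\<^sub>R \<eta>)) \<partial>lborel)"
    using h by (intro integral_lborel_affine) simp
  also have "(\<integral>\<eta>. G ((s + h *\<^sub>R \<eta> - s) /\<^sub>R h) * ee ((x - y) \<bullet> (s + h *\<^sub>R \<eta>)) \<partial>lborel) =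
      (\<integral>\<eta>. ee ((x - y) \<bullet> s) * (G \<eta> * ee (- (\<eta> \<bullet> (h *\<^sub>R (y - x))))) \<partial>lborel)"
  proof (intro Bochner_Integration.integral_cong refl)
    fix \<eta>
    have "ee ((x - y) \<bullet> (s + h *\<^sub>R \<eta>)) = ee ((x - y) \<bullet> s) * ee (- (\<eta> \<bullet> (h *\<^sub>R (y - x))))"
      by (simp add: inner_add_right inner_diff_left inner_diff_right inner_commute algebra_simps flip: ee_add)
    then show "G ((s + h *\<^sub>R \<eta> - s) /\<^sub>R h) * ee ((x - y) \<bullet> (s + h *\<^sub>R \<eta>)) = ee ((x - y) \<bullet> s) * (G \<eta> * ee (- (\<eta> \<bullet> (h *\<^sub>R (y - x)))))"
      using h by simp
  qed
  also have "\<dots> = ee ((x - y) \<bullet> s) * fourier G (h *\<^sub>R (y - x))"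
    unfolding fourier_ee by simp
  finally show ?thesis using h by (simp add: scaleR_conv_of_real)
qed

lemma fourier_tendsto:
  fixes f :: "'a::euclidean_space \<Rightarrow> complex"
  assumes f: "integrable lborel f" and \<xi>: "\<xi> \<longlonglongrightarrow> \<eta>"
  shows "(\<lambda>n. fourier f (\<xi> n)) \<longlonglongrightarrow> fourier f \<eta>"
  unfolding fourier_ee
proof (rule integral_dominated_convergence[where w = "\<lambda>x. cmod (f x)"])
  note [measurable] = borel_measurable_integrable[OF f, simplified]
  show "(\<lambda>x. f x * ee (- (x \<bullet> \<eta>))) \<in> borel_measurable lborel" by measurable
  show "(\<lambda>x. f x * ee (- (x \<bullet> \<xi> n))) \<in> borel_measurable lborel" for n by measurable
  show "integrable lborel (\<lambda>x. cmod (f x))" using f by simp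
  show "AE x in lborel. (\<lambda>n. f x * ee (- (x \<bullet> \<xi> n))) \<longlonglongrightarrow> f x * ee (- (x \<bullet> \<eta>))"
    by (intro AE_I2 tendsto_mult tendsto_const continuous_on_tendsto_compose[OF continuous_ee[of UNIV]] tendsto_minus tendsto_inner \<xi>) auto
  show "AE x in lborel. norm (f x * ee (- (x \<bullet> \<xi> n))) \<le> cmod (f x)" for n
    by (simp add: norm_mult)
qed

text \<open>
  Test a bump of width \<open>h\<close> at the frequency \<open>lam v\<close>, for \<open>\<bar>v\<bar> \<le> 1/2\<close>. The vanishing of the Fourier transform
  there says that \<open>f (x - z) ee (z \<bullet> lam v) fourier G (- h z)\<close> has integral 0. Integrating this against
  \<open>autocorr tent v\<close> turns the character into \<open>lowpass (lam z)\<close>, and \<open>h \<rightarrow> 0\<close> turns the last factor into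
  the nonzero constant \<open>fourier G 0\<close>. Superposing bumps in this way
  takes the place of a partition of unity in frequency space.
\<close>

theorem lowpass_orthogonal:
  fixes f :: "'a::euclidean_space \<Rightarrow> complex"
  assumes G: "bump (G :: 'a \<Rightarrow> complex)" and f: "l2_le f a"
    and supp: "fourier_support f \<subseteq> {\<xi>. lam \<le> norm \<xi>}" and lam: "lam > 0"
  shows "(\<integral>z. of_real (lowpass_at lam z) * f (x - z) \<partial>lborel) = 0"
proof -
  note [measurable] = l2_le_measurable[OF f]
  have contG: "continuous_on UNIV G" and Gs: "\<And>x. norm x > 1/2 \<Longrightarrow> G x = 0" and GI: "(\<integral>x. G x \<partial>lborel) \<noteq> 0"
    and Gsm: "\<And>h s x. h > 0 \<Longrightarrow> smooth (\<lambda>\<xi>. G ((\<xi> - s) /\<^sub>R h) * ee (x \<bullet> \<xi>))"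
    using G unfolding bump_def by blast+
  obtain B where GB: "\<And>x. cmod (G x) \<le> B" using G unfolding bump_def by blast
  have [measurable]: "G \<in> borel_measurable borel" by (rule borel_measurable_continuous_onI[OF contG])
  have Gi: "integrable lborel G" using bounded_support_l2(1)[of G B "1/2"] GB Gs by auto
  obtain b where Gb: "l2_le G b" using bounded_support_l2(2)[of G B "1/2"] GB Gs by auto
  have FG2: "l2_le (fourier G) b" by (rule Bessel[OF Gi Gb])
  obtain e where e: "e > 0" and van: "\<And>s \<phi>. norm s \<le> lam / 2 \<Longrightarrow> \<phi> \<in> test_functions \<Longrightarrow> fun_support \<phi> \<subseteq> ball s e \<Longrightarrow>
    (\<integral>y. f y * fourier \<phi> y \<partial>lborel) = 0"
    using fourier_dist_vanishes_locally[OF supp lam] by blast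
  have zero: "(\<integral>z. f (x - z) * (ee (z \<bullet> s) * fourier G (- (h *\<^sub>R z))) \<partial>lborel) = 0"
    if s: "norm s \<le> lam / 2" and h: "0 < h" "h \<le> e" for s h
  proof -
    let ?\<phi> = "\<lambda>\<xi>. G ((\<xi> - s) /\<^sub>R h) * ee (x \<bullet> \<xi>)"
    have sup: "fun_support ?\<phi> \<subseteq> cball s (h / 2)"
      unfolding fun_support_def
    proof (rule closure_minimal)
      show "support_on UNIV ?\<phi> \<subseteq> cball s (h / 2)"
      proof
        fix \<xi> assume "\<xi> \<in> support_on UNIV ?\<phi>"
        then have "G ((\<xi> - s) /\<^sub>R h) \<noteq> 0" by (auto simp: support_on_def)
        then have "norm ((\<xi> - s) /\<^sub>R h) \<le> 1/2" using Gs by (meson not_le)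
        moreover have "norm ((\<xi> - s) /\<^sub>R h) = norm (\<xi> - s) / h"
          using h unfolding norm_scaleR by (simp add: divide_inverse)
        ultimately have "norm (\<xi> - s) / h \<le> 1/2" by linarith
        then have "norm (\<xi> - s) \<le> h / 2" using h by (simp add: pos_divide_le_eq)
        then show "\<xi> \<in> cball s (h / 2)" by (simp add: dist_norm norm_minus_commute)
      qed
    qed simp
    have "bounded (fun_support ?\<phi>)" by (rule bounded_subset[OF bounded_cball sup])
    moreover have "closed (fun_support ?\<phi>)" unfolding fun_support_def by (rule closed_closure)
    ultimately have "compact (fun_support ?\<phi>)" by (simp only: compact_eq_bounded_closed simp_thms)
    then have t: "?\<phi> \<in> test_functions" using Gsm[OF h(1)] by (simp add: test_functions_def)
    have "fun_support ?\<phi> \<subseteq> ball s e" using sup h by (auto simp: subset_iff)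
    from van[OF s t this]
    have "(\<integral>y. f y * (of_real (h ^ DIM('a)) * (ee ((x - y) \<bullet> s) * fourier G (h *\<^sub>R (y - x)))) \<partial>lborel) = 0"
      by (simp only: fourier_bump[OF h(1)])
    also have "(\<integral>y. f y * (of_real (h ^ DIM('a)) * (ee ((x - y) \<bullet> s) * fourier G (h *\<^sub>R (y - x)))) \<partial>lborel) =
        (\<integral>z. f (x - z) * (of_real (h ^ DIM('a)) * (ee ((x - (x - z)) \<bullet> s) * fourier G (h *\<^sub>R (x - z - x)))) \<partial>lborel)"
      by (rule integral_lborel_translate(4)[symmetric])
    also have "\<dots> = (\<integral>z. of_real (h ^ DIM('a)) * (f (x - z) * (ee (z \<bullet> s) * fourier G (- (h *\<^sub>R z)))) \<partial>lborel)"
      by (intro Bochner_Integration.integral_cong refl) (simp add: mult.left_commute)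
    also have "\<dots> = of_real (h ^ DIM('a)) * (\<integral>z. f (x - z) * (ee (z \<bullet> s) * fourier G (- (h *\<^sub>R z))) \<partial>lborel)"
      by (rule Bochner_Integration.integral_mult_right_zero)
    finally show ?thesis using h by (simp del: of_real_power)
  qed
  have zero': "(\<integral>z. f (x - z) * fourier G (- (h *\<^sub>R z)) * of_real (lowpass (lam *\<^sub>R z)) \<partial>lborel) = 0"
    if h: "0 < h" "h \<le> e" for h
  proof -
    let ?F = "\<lambda>z. f (x - z) * fourier G (- (h *\<^sub>R z))"
    have Fi: "integrable lborel ?F"
    proof -
      have "integrable lborel (\<lambda>z. (cmod (fourier G (0 + (- h) *\<^sub>R z)))\<^sup>2)"
        using integrable_lborel_affine[OF l2_le_sharp(1)[OF FG2], of "- h" 0] h by simp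
      then have i: "integrable lborel (\<lambda>z. (cmod (fourier G (- (h *\<^sub>R z))))\<^sup>2)" by simp
      have "l2_le (\<lambda>z. fourier G (- (h *\<^sub>R z))) (sqrt (\<integral>z. (cmod (fourier G (- (h *\<^sub>R z))))\<^sup>2 \<partial>lborel))"
        using nn_integral_eq_integral[OF i] by (simp add: l2_le_def)
      from l2_le_integrable_mult[OF l2_le_affine(3)[OF f] this] show ?thesis .
    qed
    note [measurable] = borel_measurable_integrable[OF Fi, simplified]
    let ?a = "autocorr (tent :: 'a \<Rightarrow> complex)"
    have ai: "integrable lborel ?a" by (rule integrable_autocorr[OF tent_l2(1)])
    have "(\<integral>\<^sup>+v. \<integral>\<^sup>+z. ennreal (norm (?F z * (?a v * ee (v \<bullet> (lam *\<^sub>R z))))) \<partial>lborel \<partial>lborel) < \<infinity>"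
      using Fi ai by (simp add: norm_mult[of "?F _"] norm_mult[of "?a _"] ennreal_mult nn_integral_multc nn_integral_cmult integrable_iff_bounded ennreal_mult_less_top
        del: norm_mult)
    note swap = integral_lborel_swap[OF _ this]
    have "(\<integral>z. ?F z * of_real (lowpass (lam *\<^sub>R z)) \<partial>lborel) = (\<integral>z. \<integral>v. ?F z * (?a v * ee (v \<bullet> (lam *\<^sub>R z))) \<partial>lborel \<partial>lborel)"
      unfolding lowpass_def norm_fourier_power2[OF tent_l2(1)] by simp
    also have "\<dots> = (\<integral>v. \<integral>z. ?F z * (?a v * ee (v \<bullet> (lam *\<^sub>R z))) \<partial>lborel \<partial>lborel)"
      by (rule swap[symmetric]) measurable
    also have "\<dots> = (\<integral>v. 0 \<partial>(lborel :: 'a measure))"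
    proof (intro Bochner_Integration.integral_cong refl)
      fix v :: 'a
      have "(\<integral>z. ?F z * (?a v * ee (v \<bullet> (lam *\<^sub>R z))) \<partial>lborel) =
          (\<integral>z. ?a v * (f (x - z) * (ee (z \<bullet> (lam *\<^sub>R v)) * fourier G (- (h *\<^sub>R z)))) \<partial>lborel)"
        by (intro Bochner_Integration.integral_cong refl) (simp add: inner_commute[of v] ac_simps)
      also have "\<dots> = ?a v * (\<integral>z. f (x - z) * (ee (z \<bullet> (lam *\<^sub>R v)) * fourier G (- (h *\<^sub>R z))) \<partial>lborel)"
        by (rule Bochner_Integration.integral_mult_right_zero)
      also have "\<dots> = 0"
      proof (cases "norm v > 1/2")
        case True then show ?thesis by (simp add: autocorr_tent_support)
      next
        case False
        then have "norm (lam *\<^sub>R v) \<le> lam / 2" using lam by simp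
        from zero[OF this h] show ?thesis by simp
      qed
      finally show "(\<integral>z. ?F z * (?a v * ee (v \<bullet> (lam *\<^sub>R z))) \<partial>lborel) = 0" .
    qed
    finally show ?thesis by simp
  qed
  define h where "h n = e / real (Suc n)" for n
  have h: "0 < h n" "h n \<le> e" for n using e by (auto simp: h_def field_simps)
  have hlim: "h \<longlonglongrightarrow> 0" unfolding h_def by real_asymp
  obtain d where d: "l2_le (\<lambda>z. complex_of_real (lowpass_at lam (z::'a))) d" using lowpass_at_l2[OF lam] by blast
  have fi: "integrable lborel (\<lambda>z. f (x - z) * of_real (lowpass_at lam z))"
    by (rule l2_le_integrable_mult[OF l2_le_affine(3)[OF f] d])
  let ?I = "\<integral>z. lowpass (z::'a) \<partial>lborel"
  have z2: "(\<integral>z. fourier G (- (h n *\<^sub>R z)) * (f (x - z) * of_real (lowpass_at lam z)) \<partial>lborel) = 0" for n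
  proof -
    have "(\<integral>z. fourier G (- (h n *\<^sub>R z)) * (f (x - z) * of_real (lowpass_at lam z)) \<partial>lborel) =
      (\<integral>z. of_real (lam ^ DIM('a) / ?I) * (f (x - z) * fourier G (- (h n *\<^sub>R z)) * of_real (lowpass (lam *\<^sub>R z))) \<partial>lborel)"
      by (intro Bochner_Integration.integral_cong refl) (simp add: lowpass_at_def)
    also have "\<dots> = of_real (lam ^ DIM('a) / ?I) * 0"
      by (subst Bochner_Integration.integral_mult_right_zero) (simp only: zero'[OF h])
    finally show ?thesis by simp
  qed
  have "(\<lambda>n. \<integral>z. fourier G (- (h n *\<^sub>R z)) * (f (x - z) * of_real (lowpass_at lam z)) \<partial>lborel) \<longlonglongrightarrow>
      (\<integral>z. fourier G 0 * (f (x - z) * of_real (lowpass_at lam z)) \<partial>lborel)"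
  proof (rule integral_dominated_convergence[where w = "\<lambda>z. (\<integral>x. cmod (G x) \<partial>lborel) * cmod (f (x - z) * of_real (lowpass_at lam z))"])
    note [measurable] = borel_measurable_integrable[OF fi, simplified]
    show "(\<lambda>z. fourier G 0 * (f (x - z) * of_real (lowpass_at lam z))) \<in> borel_measurable lborel" by measurable
    show "(\<lambda>z. fourier G (- (h n *\<^sub>R z)) * (f (x - z) * of_real (lowpass_at lam z))) \<in> borel_measurable lborel" for n by measurable
    show "integrable lborel (\<lambda>z. (\<integral>x. cmod (G x) \<partial>lborel) * cmod (f (x - z) * of_real (lowpass_at lam z)))"
      using fi by (intro integrable_mult_right integrable_norm)
    show "AE z in lborel. (\<lambda>n. fourier G (- (h n *\<^sub>R z)) * (f (x - z) * of_real (lowpass_at lam z))) \<longlonglongrightarrow> fourier G 0 * (f (x - z) * of_real (lowpass_at lam z))"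
    proof (intro AE_I2 tendsto_mult_right fourier_tendsto[OF Gi])
      fix z :: 'a
      have "(\<lambda>n. - (h n *\<^sub>R z)) \<longlonglongrightarrow> - (0 *\<^sub>R z)" by (intro tendsto_intros hlim)
      then show "(\<lambda>n. - (h n *\<^sub>R z)) \<longlonglongrightarrow> 0" by simp
    qed
    show "AE z in lborel. norm (fourier G (- (h n *\<^sub>R z)) * (f (x - z) * of_real (lowpass_at lam z))) \<le>
      (\<integral>x. cmod (G x) \<partial>lborel) * cmod (f (x - z) * of_real (lowpass_at lam z))" for n
      unfolding norm_mult[of "fourier _ _"]
      by (intro AE_I2 mult_right_mono norm_fourier_le_integral[OF Gi]) auto
  qed
  then have "(\<integral>z. fourier G 0 * (f (x - z) * of_real (lowpass_at lam z)) \<partial>lborel) = 0"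
    unfolding z2 by (simp add: LIMSEQ_const_iff)
  moreover have "fourier G 0 \<noteq> 0" using GI by (simp add: fourier_ee)
  ultimately have "(\<integral>z. f (x - z) * of_real (lowpass_at lam z) \<partial>lborel) = 0" by simp
  then show ?thesis by (simp add: mult.commute)
qed

section \<open>Fourier decay of homogeneous kernels\<close>

text \<open>
  Move the ball by \<open>t e\<close>, where \<open>e\<close> is the direction of \<open>\<zeta>\<close> and \<open>0 \<le> t \<le> 1\<close>. Averaging over \<open>t\<close> replaces the
  condition on \<open>y\<close> by a condition on \<open>t\<close> alone, which holds on an interval of length \<open>2 a / \<bar>\<zeta>\<bar>\<close>.
\<close>

lemma slab_measure:
  fixes \<zeta> :: "'a::euclidean_space"
  assumes \<zeta>: "\<zeta> \<noteq> 0" and a: "0 < a"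
  shows "(\<integral>\<^sup>+y. indicator (cball 0 2) y * indicator {- a<..<a} (y \<bullet> \<zeta>) \<partial>lborel) \<le>
    ennreal (measure lborel (cball (0::'a) 3) * (2 * a / norm \<zeta>))"
proof -
  let ?V = "measure lborel (cball (0::'a) 3)"
  define e where "e = \<zeta> /\<^sub>R norm \<zeta>"
  have e: "norm e = 1" "e \<bullet> \<zeta> = norm \<zeta>"
    using \<zeta> by (simp_all add: e_def flip: power2_norm_eq_inner) (simp add: power2_eq_square)
  let ?I = "\<integral>\<^sup>+y. indicator (cball 0 2) y * indicator {- a<..<a} (y \<bullet> \<zeta>) \<partial>lborel"
  have t: "?I \<le> (\<integral>\<^sup>+y. indicator (cball 0 3) y * indicator {- a<..<a} (y \<bullet> \<zeta> + t * norm \<zeta>) \<partial>lborel)" if "t \<in> {0..1}" for t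
  proof -
    have m: "(\<lambda>y. indicator (cball 0 2) y * indicator {- a<..<a} (y \<bullet> \<zeta>) :: ennreal) \<in> borel_measurable borel" by measurable
    have "?I = (\<integral>\<^sup>+y. indicator (cball 0 2) (y + t *\<^sub>R e) * indicator {- a<..<a} ((y + t *\<^sub>R e) \<bullet> \<zeta>) \<partial>lborel)"
      by (rule nn_integral_lborel_translate(2)[OF m, symmetric])
    also have "\<dots> \<le> (\<integral>\<^sup>+y. indicator (cball 0 3) y * indicator {- a<..<a} (y \<bullet> \<zeta> + t * norm \<zeta>) \<partial>lborel)"
    proof (intro nn_integral_mono mult_mono)
      fix y
      have "norm y \<le> norm (y + t *\<^sub>R e) + norm (t *\<^sub>R e)" using norm_triangle_ineq4[of "y + t *\<^sub>R e" "t *\<^sub>R e"] by simp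
      then show "indicator (cball 0 2) (y + t *\<^sub>R e) \<le> (indicator (cball 0 3) y :: ennreal)"
        using that e(1) by (auto simp: indicator_def)
    qed (auto simp: inner_add_left e(2))
    finally show ?thesis .
  qed
  have "?I = (\<integral>\<^sup>+t. ?I * indicator {0..1::real} t \<partial>lborel)"
    by (subst nn_integral_cmult_indicator) auto
  also have "\<dots> \<le> (\<integral>\<^sup>+t. (\<integral>\<^sup>+y. indicator (cball 0 3) y * indicator {- a<..<a} (y \<bullet> \<zeta> + t * norm \<zeta>) \<partial>lborel) \<partial>lborel)"
    using t by (intro nn_integral_mono) (auto simp: indicator_def)
  also have "\<dots> = (\<integral>\<^sup>+y. (\<integral>\<^sup>+t. indicator (cball 0 3) y * indicator {- a<..<a} (y \<bullet> \<zeta> + t * norm \<zeta>) \<partial>lborel) \<partial>lborel)"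
    by (rule nn_integral_lborel_swap) measurable
  also have "\<dots> = (\<integral>\<^sup>+y. indicator (cball (0::'a) 3) y * ennreal (2 * a / norm \<zeta>) \<partial>lborel)"
  proof (rule nn_integral_cong)
    fix y
    have "(\<integral>\<^sup>+t. indicator {- a<..<a} (y \<bullet> \<zeta> + t * norm \<zeta>) \<partial>lborel) = ennreal (2 * a / norm \<zeta>)"
    proof -
      have m: "indicator {- a<..<a} \<in> borel_measurable borel" by (rule borel_measurable_indicator) simp
      have "ennreal (norm \<zeta>) * (\<integral>\<^sup>+t. indicator {- a<..<a} (y \<bullet> \<zeta> + t * norm \<zeta>) \<partial>lborel) = (\<integral>\<^sup>+t. indicator {- a<..<a} t \<partial>lborel)"
        using nn_integral_real_affine[OF m, of "norm \<zeta>" "y \<bullet> \<zeta>"] \<zeta> by (simp add: mult.commute)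
      also have "\<dots> = ennreal (2 * a)" using a by simp
      finally have "ennreal (1 / norm \<zeta>) * (ennreal (norm \<zeta>) * (\<integral>\<^sup>+t. indicator {- a<..<a} (y \<bullet> \<zeta> + t * norm \<zeta>) \<partial>lborel)) = ennreal (1 / norm \<zeta>) * ennreal (2 * a)"
        by simp
      then show ?thesis using \<zeta> a by (simp flip: mult.assoc ennreal_mult)
    qed
    then show "(\<integral>\<^sup>+t. indicator (cball 0 3) y * indicator {- a<..<a} (y \<bullet> \<zeta> + t * norm \<zeta>) \<partial>lborel) = indicator (cball 0 3) y * ennreal (2 * a / norm \<zeta>)"
      by (subst nn_integral_cmult) auto
  qed
  also have "\<dots> = ennreal ?V * ennreal (2 * a / norm \<zeta>)"
    by (subst nn_integral_multc) (auto simp: emeasure_cball_vol)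
  also have "\<dots> = ennreal (?V * (2 * a / norm \<zeta>))" using a by (intro ennreal_mult[symmetric]) auto
  finally show ?thesis .
qed

text \<open>
  Shifting \<open>s\<close> by half a period \<open>1 / (2 c)\<close> changes the sign of the exponential, so twice the integral is an
  integral of \<open>u s - u (s + h)\<close>. For a Lipschitz function this replaces integration by parts.
\<close>

lemma oscillatory_integral_bound:
  fixes u :: "real \<Rightarrow> complex"
  assumes [measurable]: "u \<in> borel_measurable borel" and uB: "\<And>s. cmod (u s) \<le> B"
    and us: "\<And>s. s \<notin> {1..2} \<Longrightarrow> u s = 0" and L: "0 \<le> L"
    and lip: "\<And>s t. s \<in> {1/2..5/2} \<Longrightarrow> t \<in> {1/2..5/2} \<Longrightarrow> cmod (u s - u t) \<le> L * \<bar>s - t\<bar>"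
    and c: "1 \<le> \<bar>c\<bar>"
  shows "cmod (\<integral>s. u s * ee (- (s * c)) \<partial>lborel) \<le> L / \<bar>c\<bar>"
proof -
  define h where "h = 1 / (2 * c)"
  have c0: "c \<noteq> 0" using c by auto
  have h: "\<bar>h\<bar> \<le> 1/2" "\<bar>h\<bar> = 1 / (2 * \<bar>c\<bar>)" using c by (auto simp: h_def abs_mult field_simps)
  have ui: "integrable lborel u"
  proof (rule bounded_support_l2(1)[OF _ uB])
    show "norm s > 2 \<Longrightarrow> u s = 0" for s using us[of s] by (cases "s \<in> {1..2}") auto
  qed measurable
  let ?J = "\<integral>s. u s * ee (- (s * c)) \<partial>lborel"
  have i1: "integrable lborel (\<lambda>s. u s * ee (- (s * c)))" by (rule integrable_mult_ee(1)[OF ui]) measurable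
  have i2: "integrable lborel (\<lambda>s. u (s + h) * ee (- (s * c)))"
    by (rule integrable_mult_ee(1)[OF integrable_lborel_translate(2)[OF ui]]) measurable
  have half: "ee (- (h * c)) = -1"
  proof -
    have "h * c = 1/2" using c0 by (simp add: h_def)
    then have "2 * pi * - (h * c) = - pi" by simp
    then show ?thesis by (simp only: ee_cis) (simp add: complex_eq_iff)
  qed
  have "?J = (\<integral>s. u (s + h) * ee (- ((s + h) * c)) \<partial>lborel)"
    by (rule integral_lborel_translate(2)[symmetric])
  also have "\<dots> = (\<integral>s. - (u (s + h) * ee (- (s * c))) \<partial>lborel)"
  proof (intro Bochner_Integration.integral_cong refl)
    fix s
    have "- ((s + h) * c) = - (s * c) + - (h * c)" by (simp add: algebra_simps)
    then have "ee (- ((s + h) * c)) = - ee (- (s * c))" by (simp only: ee_add half) simp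
    then show "u (s + h) * ee (- ((s + h) * c)) = - (u (s + h) * ee (- (s * c)))" by simp
  qed
  finally have J: "?J = - (\<integral>s. u (s + h) * ee (- (s * c)) \<partial>lborel)" by simp
  have "2 * ?J = ?J - (\<integral>s. u (s + h) * ee (- (s * c)) \<partial>lborel)" using J by simp
  also have "\<dots> = (\<integral>s. u s * ee (- (s * c)) - u (s + h) * ee (- (s * c)) \<partial>lborel)"
    by (rule Bochner_Integration.integral_diff[OF i1 i2, symmetric])
  finally have "ennreal (cmod (2 * ?J)) \<le> (\<integral>\<^sup>+s. ennreal (cmod (u s * ee (- (s * c)) - u (s + h) * ee (- (s * c)))) \<partial>lborel)"
    by (simp only: norm_integral_le_nn_integral)
  also have "\<dots> \<le> (\<integral>\<^sup>+s. ennreal (L * \<bar>h\<bar>) * indicator {1/2..5/2::real} s \<partial>lborel)"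
  proof (rule nn_integral_mono)
    fix s
    have eq: "cmod (u s * ee (- (s * c)) - u (s + h) * ee (- (s * c))) = cmod (u s - u (s + h))"
      by (simp add: norm_mult flip: left_diff_distrib)
    show "ennreal (cmod (u s * ee (- (s * c)) - u (s + h) * ee (- (s * c)))) \<le> ennreal (L * \<bar>h\<bar>) * indicator {1/2..5/2::real} s"
    proof (cases "s \<in> {1/2..5/2} \<and> s + h \<in> {1/2..5/2}")
      case True
      then have "cmod (u s - u (s + h)) \<le> L * \<bar>h\<bar>" using lip[of s "s + h"] by simp
      then show ?thesis using True unfolding eq by (simp add: ennreal_leI)
    next
      case False
      show ?thesis
      proof (cases "s \<in> {1/2..5/2}")
        case True
        then have sh: "s + h \<notin> {1/2..5/2}" using False by simp
        then have "u (s + h) = 0" by (intro us) auto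
        moreover have "u s = 0" by (rule us) (use sh h(1) in auto)
        ultimately show ?thesis unfolding eq by simp
      next
        case s: False
        then have "u s = 0" by (intro us) auto
        moreover have "s + h \<notin> {1..2}" using s h(1) by auto
        then have "u (s + h) = 0" by (rule us)
        ultimately show ?thesis unfolding eq by simp
      qed
    qed
  qed
  also have "\<dots> = ennreal (L * \<bar>h\<bar>) * ennreal 2" by (subst nn_integral_cmult_indicator) auto
  also have "\<dots> = ennreal (L * \<bar>h\<bar> * 2)" using L by (intro ennreal_mult[symmetric]) auto
  finally have "cmod (2 * ?J) \<le> L * \<bar>h\<bar> * 2" using L by (subst (asm) ennreal_le_iff) auto
  then have "cmod ?J \<le> L * \<bar>h\<bar>" by (simp add: norm_mult)
  also have "\<dots> \<le> L / \<bar>c\<bar>" using L c unfolding h(2) by (simp add: field_simps)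
  finally show ?thesis .
qed

lemma test_function_bounds:
  fixes \<beta> :: "real \<Rightarrow> complex"
  assumes \<beta>: "\<beta> \<in> test_functions" and supp: "fun_support \<beta> \<subseteq> {1/2<..<2}"
  shows "\<exists>B>0. (\<forall>t. cmod (\<beta> t) \<le> B) \<and> (\<forall>s\<in>{0..5}. \<forall>t\<in>{0..5}. cmod (\<beta> s - \<beta> t) \<le> B * \<bar>s - t\<bar>)"
    and "continuous_on UNIV \<beta>"
proof -
  have s: "smooth1 \<beta>" by (rule test_function_smooth1[OF \<beta>])
  have \<beta>0: "1/2 < t \<and> t < 2" if "\<beta> t \<noteq> 0" for t
    by (rule test_function_support[OF supp that])
  show cont: "continuous_on UNIV \<beta>" by (rule smooth1_continuous[OF s])
  obtain d where d: "\<And>t. (\<beta> has_vector_derivative d t) (at t)" "smooth1 d" using smooth1_deriv[OF s] by blast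
  have "compact (d ` {0..5})" by (intro compact_continuous_image smooth1_continuous[OF d(2)]) auto
  then obtain B1 where B1: "\<And>t. t \<in> {0..5} \<Longrightarrow> cmod (d t) \<le> B1"
    using compact_imp_bounded bounded_iff by (metis imageI)
  have "compact (\<beta> ` {0..5})" by (intro compact_continuous_image continuous_on_subset[OF cont]) auto
  then obtain B2 where B2: "\<And>t. t \<in> {0..5} \<Longrightarrow> cmod (\<beta> t) \<le> B2"
    using compact_imp_bounded bounded_iff by (metis imageI)
  define B where "B = max 1 (max B1 B2)"
  have B: "B > 0" "B1 \<le> B" "B2 \<le> B" by (auto simp: B_def)
  have "cmod (\<beta> t) \<le> B" for t
    using B2[of t] \<beta>0[of t] B by (cases "\<beta> t = 0") force+
  moreover have "cmod (\<beta> s - \<beta> t) \<le> B * \<bar>s - t\<bar>" if "s \<in> {0..5}" "t \<in> {0..5}" for s t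
  proof -
    have "norm (\<beta> s - \<beta> t) \<le> B * norm (s - t)"
    proof (rule differentiable_bound[where S = "{0..5}" and f' = "\<lambda>x h. h *\<^sub>R d x"])
      fix x :: real assume x: "x \<in> {0..5}"
      show "(\<beta> has_derivative (\<lambda>h. h *\<^sub>R d x)) (at x within {0..5})"
        using d(1)[of x] by (auto simp: has_vector_derivative_def intro: has_derivative_at_withinI)
      show "onorm (\<lambda>h. h *\<^sub>R d x) \<le> B"
      proof (rule onorm_le)
        fix h :: real
        have "\<bar>h\<bar> * cmod (d x) \<le> \<bar>h\<bar> * B" using B1[OF x] B by (intro mult_left_mono) auto
        then show "norm (h *\<^sub>R d x) \<le> B * norm h" by (simp add: mult.commute)
      qed
    qed (use that in auto)
    then show ?thesis by simp
  qed
  ultimately show "\<exists>B>0. (\<forall>t. cmod (\<beta> t) \<le> B) \<and> (\<forall>s\<in>{0..5}. \<forall>t\<in>{0..5}. cmod (\<beta> s - \<beta> t) \<le> B * \<bar>s - t\<bar>)"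
    using B(1) by blast
qed

text \<open>
  With \<open>DIM('a) = 2 d\<close> this is the kernel of the bilinear operator on a product of two \<open>d\<close>-dimensional
  spaces.
\<close>

definition hom_kernel :: "(real \<Rightarrow> complex) \<Rightarrow> ('a \<Rightarrow> complex) \<Rightarrow> 'a::euclidean_space \<Rightarrow> complex" where
  "hom_kernel \<beta> \<Omega> y = \<Omega> (y /\<^sub>R norm y) * of_real (norm y powr (- real DIM('a))) * \<beta> (norm y)"

lemma K0_eq: "K0 \<beta> \<Omega> = hom_kernel \<beta> \<Omega>"
  by (simp add: fun_eq_iff K0_def hom_kernel_def)

text \<open>
  The angular part of the kernel does not change under dilations, so the substitution \<open>y \<mapsto> s y\<close> moves \<open>s\<close>
  into the smooth radial part and the exponential. Averaging over \<open>s\<close> in \<open>{1..2}\<close> with a Lipschitz weight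
  produces for each \<open>y\<close> an oscillatory integral in \<open>s\<close> with frequency \<open>y \<bullet> \<zeta>\<close>. It is small unless
  \<open>\<bar>y \<bullet> \<zeta>\<bar>\<close> is less than \<open>a = sqrt \<bar>\<zeta>\<bar>\<close>, and the slab of exceptional \<open>y\<close> has measure \<open>O(1 / a)\<close>.
\<close>

theorem hom_kernel_fourier_decay:
  assumes \<beta>: "\<beta> \<in> test_functions" and supp: "fun_support \<beta> \<subseteq> {1/2<..<2}"
  shows "\<exists>C>0. \<forall>(\<Omega> :: 'a::euclidean_space \<Rightarrow> complex) N. (\<lambda>y. \<Omega> (y /\<^sub>R norm y)) \<in> borel_measurable borel \<longrightarrow> (\<forall>y. cmod (\<Omega> y) \<le> N) \<longrightarrow>
    (\<forall>\<zeta>. \<zeta> \<noteq> 0 \<longrightarrow> cmod (fourier (hom_kernel \<beta> \<Omega>) \<zeta>) \<le> C * N / sqrt (norm \<zeta>))"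
proof -
  obtain B where B: "B > 0" "\<And>t. cmod (\<beta> t) \<le> B"
    and lip: "\<And>s t. s \<in> {0..5} \<Longrightarrow> t \<in> {0..5} \<Longrightarrow> cmod (\<beta> s - \<beta> t) \<le> B * \<bar>s - t\<bar>"
    using test_function_bounds(1)[OF \<beta> supp] by blast
  note \<beta>0 = test_function_support[OF supp]
  have [measurable]: "\<beta> \<in> borel_measurable borel"
    by (rule borel_measurable_continuous_onI[OF test_function_bounds(2)[OF \<beta> supp]])
  let ?n = "DIM('a)"
  define V2 where "V2 = measure lborel (cball (0::'a) 2)"
  define V3 where "V3 = measure lborel (cball (0::'a) 3)"
  define w where "w s = max 0 (1/2 - \<bar>s - 3/2\<bar>)" for s :: real
  have w: "0 \<le> w s" "w s \<le> 1/2" "s \<notin> {1..2} \<Longrightarrow> w s = 0" "\<bar>w s - w t\<bar> \<le> \<bar>s - t\<bar>" for s t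
    by (auto simp: w_def max_def abs_if split: if_splits)
  have [measurable]: "w \<in> borel_measurable borel" unfolding w_def[abs_def] by measurable
  define w0 where "w0 = (\<integral>s. w s \<partial>lborel)"
  have wi: "integrable lborel w"
  proof (rule Bochner_Integration.integrable_bound)
    show "integrable lborel (indicator {1..2::real} :: real \<Rightarrow> real)" by (rule integrable_real_indicator) auto
    show "AE s in lborel. norm (w s) \<le> norm (indicator {1..2} s :: real)"
    proof (intro AE_I2)
      fix s show "norm (w s) \<le> norm (indicator {1..2} s :: real)"
        using w(1)[of s] w(2)[of s] w(3)[of s] by (auto simp: indicator_def)
    qed
  qed simp
  have w0: "w0 > 0"
  proof -
    have "(\<integral>s. 1/4 * indicator {5/4..7/4::real} s \<partial>lborel) \<le> w0"
      unfolding w0_def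
    proof (rule integral_mono[OF _ wi])
      show "integrable lborel (\<lambda>s. 1/4 * indicator {5/4..7/4::real} s :: real)"
        by (intro integrable_mult_right integrable_real_indicator emeasure_bounded_finite) auto
      show "1/4 * indicator {5/4..7/4} s \<le> w s" for s
        by (auto simp: w_def indicator_def abs_if)
    qed
    then show ?thesis by simp
  qed
  define C where "C = 4 ^ ?n * (2 * B) * (V2 + 2 * V3) / w0"
  have V: "V2 \<ge> 0" "V3 > 0" unfolding V2_def V3_def by (auto simp: content_cball unit_ball_vol_pos)
  have C: "C > 0" unfolding C_def using B w0 V by (intro divide_pos_pos mult_pos_pos) auto
  have "cmod (fourier (hom_kernel \<beta> \<Omega>) \<zeta>) \<le> C * N / sqrt (norm \<zeta>)"
    if [measurable]: "(\<lambda>y. \<Omega> (y /\<^sub>R norm y)) \<in> borel_measurable borel" and N: "\<And>y. cmod (\<Omega> y) \<le> N" and \<zeta>: "\<zeta> \<noteq> 0"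
    for \<Omega> :: "'a \<Rightarrow> complex" and N \<zeta>
  proof -
    have N0: "0 \<le> N" using N[of 0] norm_ge_zero order_trans by blast
    let ?k = "hom_kernel \<beta> \<Omega>"
    have km[measurable]: "?k \<in> borel_measurable borel" unfolding hom_kernel_def[abs_def] by measurable
    define om where "om y = \<Omega> (y /\<^sub>R norm y) * of_real (norm y powr (- real ?n))" for y
    have [measurable]: "om \<in> borel_measurable borel" unfolding om_def[abs_def] by measurable
    have dil: "fourier ?k \<zeta> = (\<integral>y. om y * (\<beta> (s * norm y) * ee (- (s * (y \<bullet> \<zeta>)))) \<partial>lborel)" if s: "s > 0" for s
    proof -
      have "fourier ?k \<zeta> = \<bar>s\<bar> ^ ?n *\<^sub>R (\<integral>y. ?k (0 + s *\<^sub>R y) * ee (- ((0 + s *\<^sub>R y) \<bullet> \<zeta>)) \<partial>lborel)"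
        unfolding fourier_ee using s by (intro integral_lborel_affine) simp
      also have "\<dots> = (\<integral>y. of_real (s ^ ?n) * (?k (s *\<^sub>R y) * ee (- (s * (y \<bullet> \<zeta>)))) \<partial>lborel)"
        using s by (simp add: scaleR_conv_of_real)
      also have "\<dots> = (\<integral>y. om y * (\<beta> (s * norm y) * ee (- (s * (y \<bullet> \<zeta>)))) \<partial>lborel)"
      proof (intro Bochner_Integration.integral_cong refl)
        fix y :: 'a
        have 1: "(s *\<^sub>R y) /\<^sub>R norm (s *\<^sub>R y) = y /\<^sub>R norm y" using s by simp
        have 2: "s ^ ?n * (s * norm y) powr (- real ?n) = norm y powr (- real ?n)"
          using s by (simp add: powr_mult powr_minus powr_realpow)
        have 3: "complex_of_real (s ^ ?n) * of_real ((s * norm y) powr (- real ?n)) = of_real (norm y powr (- real ?n))"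
          unfolding of_real_mult[symmetric] 2 ..
        have "norm (s *\<^sub>R y) = s * norm y" using s by simp
        then have "of_real (s ^ ?n) * ?k (s *\<^sub>R y) =
            (of_real (s ^ ?n) * of_real ((s * norm y) powr (- real ?n))) * (\<Omega> (y /\<^sub>R norm y) * \<beta> (s * norm y))"
          unfolding hom_kernel_def 1 by (simp only: ac_simps)
        also have "\<dots> = om y * \<beta> (s * norm y)" unfolding 3 om_def by (simp only: ac_simps)
        finally have "of_real (s ^ ?n) * ?k (s *\<^sub>R y) = om y * \<beta> (s * norm y)" .
        then show "of_real (s ^ ?n) * (?k (s *\<^sub>R y) * ee (- (s * (y \<bullet> \<zeta>)))) = om y * (\<beta> (s * norm y) * ee (- (s * (y \<bullet> \<zeta>))))"
          by (simp only: mult.assoc[symmetric])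
      qed
      finally show ?thesis .
    qed
    define J where "J y = (\<integral>s. of_real (w s) * \<beta> (s * norm y) * ee (- (s * (y \<bullet> \<zeta>))) \<partial>lborel)" for y
    have u0: "of_real (w s) * \<beta> (s * norm y) = 0" if "norm y \<notin> {1/4..2}" for s y
    proof (cases "s \<in> {1..2}")
      case True
      then have "\<not> (1/2 < s * norm y \<and> s * norm y < 2)"
      proof (cases "norm y < 1/4")
        case y: True
        have "s * norm y \<le> 2 * norm y" using True by (intro mult_right_mono) auto
        with y show ?thesis by simp
      next
        case False
        then have "norm y > 2" using that by auto
        moreover have "1 * norm y \<le> s * norm y" using True by (intro mult_right_mono) auto
        ultimately show ?thesis by simp
      qed
      then show ?thesis using \<beta>0 by auto
    qed (simp add: w)
    have ob: "cmod (om y) \<le> 4 ^ ?n * N" if "norm y \<in> {1/4..2}" for y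
    proof -
      have "norm y powr (- real ?n) \<le> (1/4) powr (- real ?n)"
        using that by (intro powr_mono2') auto
      also have "\<dots> = 4 ^ ?n" by (simp add: powr_minus powr_realpow power_divide flip: power_inverse)
      finally have "norm y powr (- real ?n) * cmod (\<Omega> (y /\<^sub>R norm y)) \<le> 4 ^ ?n * N"
        by (intro mult_mono N) auto
      then show ?thesis by (simp add: om_def norm_mult mult.commute)
    qed
    have uB: "cmod (of_real (w s) * \<beta> (s * norm y)) \<le> B" for s y
    proof -
      have "w s * cmod (\<beta> (s * norm y)) \<le> 1 * B" using w[of s] B by (intro mult_mono) auto
      then show ?thesis using w[of s] by (simp add: norm_mult)
    qed
    define a where "a = sqrt (norm \<zeta>)"
    have a: "a > 0" using \<zeta> by (simp add: a_def)
    have Jb: "cmod (J y) \<le> B" for y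
    proof -
      have "ennreal (cmod (J y)) \<le> (\<integral>\<^sup>+s. ennreal (cmod (of_real (w s) * \<beta> (s * norm y) * ee (- (s * (y \<bullet> \<zeta>))))) \<partial>lborel)"
        unfolding J_def by (rule norm_integral_le_nn_integral)
      also have "\<dots> \<le> (\<integral>\<^sup>+s. ennreal B * indicator {1..2::real} s \<partial>lborel)"
      proof (rule nn_integral_mono)
        fix s show "ennreal (cmod (of_real (w s) * \<beta> (s * norm y) * ee (- (s * (y \<bullet> \<zeta>))))) \<le> ennreal B * indicator {1..2::real} s"
          using uB[of s y] w(3)[of s] by (cases "s \<in> {1..2}") (auto simp: norm_mult intro: ennreal_leI)
      qed
      also have "\<dots> = ennreal B" by (subst nn_integral_cmult_indicator) auto
      finally show ?thesis using B by (simp add: ennreal_le_iff)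
    qed
    have Jd: "cmod (J y) \<le> 2 * B * (1 / a)" if y: "norm y \<in> {1/4..2}" and big: "a \<le> \<bar>y \<bullet> \<zeta>\<bar>" for y
    proof (cases "1 \<le> a")
      case True
      have "cmod (J y) \<le> (2 * B) / \<bar>y \<bullet> \<zeta>\<bar>"
        unfolding J_def
      proof (rule oscillatory_integral_bound)
        show "(\<lambda>s. of_real (w s) * \<beta> (s * norm y)) \<in> borel_measurable borel" by measurable
        show "cmod (of_real (w s) * \<beta> (s * norm y)) \<le> B" for s by (rule uB)
        show "s \<notin> {1..2} \<Longrightarrow> of_real (w s) * \<beta> (s * norm y) = 0" for s using w(3)[of s] by simp
        fix s t :: real assume s: "s \<in> {1/2..5/2}" and t: "t \<in> {1/2..5/2}"
        have in5: "r * norm y \<in> {0..5}" if "r \<in> {1/2..5/2}" for r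
          using that y mult_mono[of r "5/2" "norm y" 2] by auto
        have dec: "of_real (w s) * \<beta> (s * norm y) - of_real (w t) * \<beta> (t * norm y) =
            of_real (w s - w t) * \<beta> (s * norm y) + of_real (w t) * (\<beta> (s * norm y) - \<beta> (t * norm y))"
          by (simp add: algebra_simps)
        have "cmod (of_real (w s) * \<beta> (s * norm y) - of_real (w t) * \<beta> (t * norm y)) \<le>
            cmod (of_real (w s - w t) * \<beta> (s * norm y)) + cmod (of_real (w t) * (\<beta> (s * norm y) - \<beta> (t * norm y)))"
          unfolding dec by (rule norm_triangle_ineq)
        also have "\<dots> = \<bar>w s - w t\<bar> * cmod (\<beta> (s * norm y)) + w t * cmod (\<beta> (s * norm y) - \<beta> (t * norm y))"
          using w(1)[of t] by (simp add: norm_mult del: of_real_diff)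
        also have "\<dots> \<le> \<bar>s - t\<bar> * B + 1/2 * (B * \<bar>s * norm y - t * norm y\<bar>)"
          using w B by (intro add_mono mult_mono lip in5 s t) auto
        also have "\<bar>s * norm y - t * norm y\<bar> = \<bar>s - t\<bar> * norm y" by (simp add: abs_mult flip: left_diff_distrib)
        also have "\<bar>s - t\<bar> * B + 1/2 * (B * (\<bar>s - t\<bar> * norm y)) \<le> \<bar>s - t\<bar> * B + 1/2 * (B * (\<bar>s - t\<bar> * 2))"
          using y B by (intro add_mono mult_left_mono) auto
        also have "\<dots> = 2 * B * \<bar>s - t\<bar>" by simp
        finally show "cmod (of_real (w s) * \<beta> (s * norm y) - of_real (w t) * \<beta> (t * norm y)) \<le> 2 * B * \<bar>s - t\<bar>" .
      qed (use B True big in auto)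
      also have "\<dots> \<le> 2 * B / a" using big a B by (intro divide_left_mono) auto
      finally show ?thesis by simp
    next
      case False
      then have "1 \<le> 1 / a" using a by simp
      then have "B * 1 \<le> 2 * B * (1 / a)" using B by (intro mult_mono) auto
      then show ?thesis using Jb[of y] by simp
    qed
    have fin: "(\<integral>\<^sup>+s. \<integral>\<^sup>+y. ennreal (cmod (om y * (of_real (w s) * \<beta> (s * norm y) * ee (- (s * (y \<bullet> \<zeta>)))))) \<partial>lborel \<partial>lborel) < \<infinity>"
    proof -
      have "(\<integral>\<^sup>+s. \<integral>\<^sup>+y. ennreal (cmod (om y * (of_real (w s) * \<beta> (s * norm y) * ee (- (s * (y \<bullet> \<zeta>)))))) \<partial>lborel \<partial>lborel) \<le>
          (\<integral>\<^sup>+s. \<integral>\<^sup>+y. ennreal (4 ^ ?n * N * B) * indicator (cball (0::'a) 2) y * indicator {1..2::real} s \<partial>lborel \<partial>lborel)"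
      proof (intro nn_integral_mono)
        fix s y
        show "ennreal (cmod (om y * (of_real (w s) * \<beta> (s * norm y) * ee (- (s * (y \<bullet> \<zeta>)))))) \<le> ennreal (4 ^ ?n * N * B) * indicator (cball (0::'a) 2) y * indicator {1..2::real} s"
        proof (cases "norm y \<in> {1/4..2} \<and> s \<in> {1..2}")
          case True
          have "cmod (om y) * cmod (of_real (w s) * \<beta> (s * norm y)) \<le> 4 ^ ?n * N * B"
            using True B N0 by (intro mult_mono ob uB) auto
          then show ?thesis using True by (auto simp: norm_mult mult.assoc intro: ennreal_leI)
        next
          case False
          then have "of_real (w s) * \<beta> (s * norm y) = 0" using u0[of y s] w(3)[of s] by auto
          then show ?thesis by auto
        qed
      qed
      also have "\<dots> = ennreal (4 ^ ?n * N * B) * ennreal V2"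
        by (simp add: nn_integral_multc nn_integral_cmult emeasure_cball_vol V2_def)
      also have "\<dots> < \<infinity>" by (simp add: ennreal_mult_less_top)
      finally show ?thesis .
    qed
    have "of_real w0 * fourier ?k \<zeta> = (\<integral>s. of_real (w s) * fourier ?k \<zeta> \<partial>lborel)"
      unfolding w0_def by (subst integral_mult_left_zero) simp
    also have "\<dots> = (\<integral>s. \<integral>y. om y * (of_real (w s) * \<beta> (s * norm y) * ee (- (s * (y \<bullet> \<zeta>)))) \<partial>lborel \<partial>lborel)"
    proof (intro Bochner_Integration.integral_cong refl)
      fix s
      show "of_real (w s) * fourier ?k \<zeta> = (\<integral>y. om y * (of_real (w s) * \<beta> (s * norm y) * ee (- (s * (y \<bullet> \<zeta>)))) \<partial>lborel)"
      proof (cases "s \<in> {1..2}")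
        case True
        then have "s > 0" by simp
        have "of_real (w s) * fourier ?k \<zeta> = (\<integral>y. of_real (w s) * (om y * (\<beta> (s * norm y) * ee (- (s * (y \<bullet> \<zeta>))))) \<partial>lborel)"
          unfolding dil[OF \<open>s > 0\<close>] by simp
        then show ?thesis by (simp only: ac_simps)
      qed (simp add: w)
    qed
    also have "\<dots> = (\<integral>y. \<integral>s. om y * (of_real (w s) * \<beta> (s * norm y) * ee (- (s * (y \<bullet> \<zeta>)))) \<partial>lborel \<partial>lborel)"
      by (rule integral_lborel_swap[OF _ fin]) measurable
    also have "\<dots> = (\<integral>y. om y * J y \<partial>lborel)"
      unfolding J_def by simp
    finally have eq: "of_real w0 * fourier ?k \<zeta> = (\<integral>y. om y * J y \<partial>lborel)" .
    have "ennreal (cmod (of_real w0 * fourier ?k \<zeta>)) \<le> (\<integral>\<^sup>+y. ennreal (cmod (om y * J y)) \<partial>lborel)"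
      unfolding eq by (rule norm_integral_le_nn_integral)
    also have "\<dots> \<le> (\<integral>\<^sup>+y. ennreal (4 ^ ?n * N * (2 * B)) * (ennreal (1 / a) * indicator (cball (0::'a) 2) y + indicator (cball 0 2) y * indicator {- a<..<a} (y \<bullet> \<zeta>)) \<partial>lborel)"
    proof (rule nn_integral_mono)
      fix y
      show "ennreal (cmod (om y * J y)) \<le> ennreal (4 ^ ?n * N * (2 * B)) * (ennreal (1 / a) * indicator (cball (0::'a) 2) y + indicator (cball 0 2) y * indicator {- a<..<a} (y \<bullet> \<zeta>))"
      proof (cases "norm y \<in> {1/4..2}")
        case y: True
        show ?thesis
        proof (cases "a \<le> \<bar>y \<bullet> \<zeta>\<bar>")
          case True
          have "cmod (om y * J y) \<le> (4 ^ ?n * N) * (2 * B * (1 / a))"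
            unfolding norm_mult using N0 by (intro mult_mono ob[OF y] Jd[OF y True]) auto
          then have "ennreal (cmod (om y * J y)) \<le> ennreal ((4 ^ ?n * N * (2 * B)) * (1 / a))"
            by (intro ennreal_leI) (simp add: mult.assoc)
          also have "\<dots> = ennreal (4 ^ ?n * N * (2 * B)) * ennreal (1 / a)"
            using N0 B a by (intro ennreal_mult) auto
          finally show ?thesis using y True by (auto simp: indicator_def)
        next
          case False
          have "cmod (om y * J y) \<le> (4 ^ ?n * N) * B"
            unfolding norm_mult using N0 by (intro mult_mono ob[OF y] Jb) auto
          also have "\<dots> \<le> (4 ^ ?n * N) * (2 * B)" using N0 B by (intro mult_left_mono) auto
          finally have "ennreal (cmod (om y * J y)) \<le> ennreal (4 ^ ?n * N * (2 * B)) * 1" by (simp add: ennreal_leI)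
          also have "\<dots> \<le> ennreal (4 ^ ?n * N * (2 * B)) * (ennreal (1 / a) + 1)"
            by (intro mult_left_mono) auto
          also have "ennreal (1 / a) + 1 = ennreal (1 / a) * indicator (cball 0 2) y + indicator (cball 0 2) y * indicator {- a<..<a} (y \<bullet> \<zeta>)"
            using y False by (auto simp: indicator_def)
          finally show ?thesis .
        qed
      next
        case False
        have "J y = 0" unfolding J_def
          by (simp only: u0[OF False] mult_zero_left Bochner_Integration.integral_zero)
        then show ?thesis by simp
      qed
    qed
    also have "\<dots> = ennreal (4 ^ ?n * N * (2 * B)) * (ennreal (1 / a) * ennreal V2 + (\<integral>\<^sup>+y. indicator (cball 0 2) y * indicator {- a<..<a} (y \<bullet> \<zeta>) \<partial>lborel))"
      by (simp add: nn_integral_cmult nn_integral_add emeasure_cball_vol V2_def)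
    also have "\<dots> \<le> ennreal (4 ^ ?n * N * (2 * B)) * (ennreal (1 / a) * ennreal V2 + ennreal (V3 * (2 * a / norm \<zeta>)))"
      unfolding V3_def by (intro mult_left_mono add_left_mono slab_measure[OF \<zeta> a]) auto
    also have "\<dots> = ennreal (4 ^ ?n * N * (2 * B) * (1 / a * V2 + V3 * (2 * a / norm \<zeta>)))"
    proof -
      have nn: "0 \<le> 1 / a * V2" "0 \<le> V3 * (2 * a / norm \<zeta>)" "0 \<le> 4 ^ ?n * N * (2 * B)" using N0 B a V by auto
      have "ennreal (1 / a) * ennreal V2 + ennreal (V3 * (2 * a / norm \<zeta>)) = ennreal (1 / a * V2 + V3 * (2 * a / norm \<zeta>))"
        using a V nn by (simp only: ennreal_plus ennreal_mult' zero_le_divide_1_iff less_imp_le)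
      then show ?thesis using nn by (simp only: ennreal_mult add_nonneg_nonneg)
    qed
    finally have "cmod (of_real w0 * fourier ?k \<zeta>) \<le> 4 ^ ?n * N * (2 * B) * (1 / a * V2 + V3 * (2 * a / norm \<zeta>))"
      using N0 B a V by (subst (asm) ennreal_le_iff) auto
    moreover have "a / norm \<zeta> = 1 / a"
    proof -
      have "norm \<zeta> = a * a" using \<zeta> by (simp add: a_def)
      then show ?thesis using a by simp
    qed
    then have "2 * a / norm \<zeta> = 2 * (1 / a)" by (metis times_divide_eq_right)
    ultimately have "w0 * cmod (fourier ?k \<zeta>) \<le> 4 ^ ?n * N * (2 * B) * (1 / a * V2 + V3 * (2 * (1 / a)))"
      using w0 by (simp add: norm_mult)
    also have "\<dots> = w0 * (C * N / a)"
      using w0 a by (simp add: C_def field_simps)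
    finally have "cmod (fourier ?k \<zeta>) \<le> C * N / a" using w0 by (rule mult_left_le_imp_le)
    then show ?thesis by (simp add: a_def)
  qed
  with C show ?thesis by blast
qed

section \<open>Gain for functions without low frequencies\<close>

text \<open>
  The low-pass kernel at scale \<open>1 / lam\<close> has \<open>\<delta> = O(1 / lam)\<close>. The choice \<open>R = lam powr (1/2)\<close> and
  \<open>\<tau> = lam powr (- 1/8)\<close> balances the terms \<open>\<tau>\<close> and \<open>1 / (\<tau> sqrt R)\<close>, and \<open>R \<delta> = O(lam powr (- 1/2))\<close>
  is smaller.
\<close>

lemma high_frequency_decay:
  assumes G: "bump (G :: 'a::euclidean_space \<Rightarrow> complex)" and Cd: "0 \<le> Cd"
  shows "\<exists>C>0. \<forall>(K :: 'a \<times> 'a \<Rightarrow> complex) lam f a g h B.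
    unit_kernel K (measure lborel (cball (0::'a) 2)) \<longrightarrow>
    (\<forall>\<zeta>. \<zeta> \<noteq> 0 \<longrightarrow> cmod (fourier K \<zeta>) \<le> Cd / sqrt (norm \<zeta>)) \<longrightarrow>
    1 \<le> lam \<longrightarrow> l2_le f a \<longrightarrow> fourier_support f \<subseteq> {\<xi>. lam \<le> norm \<xi>} \<longrightarrow> l2_pair g h B \<longrightarrow>
    cmod (trilinear K f g h) \<le> C * lam powr (- 1 / 8) * a * B"
proof -
  obtain C1 where C1: "C1 \<ge> 0" and mom: "\<And>lam. lam > 0 \<Longrightarrow>
      (\<integral>\<^sup>+z. ennreal (norm z * lowpass_at lam (z::'a)) \<partial>lborel) \<le> ennreal (C1 / lam)"
    using lowpass_at_moment[where 'a='a] by blast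
  define V where "V = measure lborel (cball (0::'a) 2)"
  define Q where "Q = measure lborel (cball (0::'a) 4) / sqrt (measure lborel (cball (0::'a) 1))"
  define W where "W = measure lborel (cball (0::'a\<times>'a) 2)"
  have VQW: "0 \<le> V" "0 \<le> Q" "0 \<le> W" by (auto simp: V_def Q_def W_def)
  define C where "C = (V * sqrt V * ((1 + 2 * pi) * C1) + 2 + Cd * V * 2) * Q + W * C1 + 1"
  have C: "C > 0" unfolding C_def using VQW C1 Cd
    by (intro add_nonneg_pos add_nonneg_nonneg mult_nonneg_nonneg) auto
  have "cmod (trilinear K f g h) \<le> C * lam powr (- 1 / 8) * a * B"
    if K: "unit_kernel K V" and decay: "\<And>\<zeta>. \<zeta> \<noteq> 0 \<Longrightarrow> cmod (fourier K \<zeta>) \<le> Cd / sqrt (norm \<zeta>)"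
      and lam: "1 \<le> lam" and f: "l2_le f a" and supp: "fourier_support f \<subseteq> {\<xi>. lam \<le> norm \<xi>}" and gh: "l2_pair g h B"
    for K :: "'a \<times> 'a \<Rightarrow> complex" and lam f a g h B
  proof -
    interpret unit_kernel K V by (rule K)
    have lam0: "0 < lam" using lam by simp
    have l: "l2_le (\<lambda>x. g (x - 0) * h x) B" using gh unfolding l2_pair_def by blast
    have a0: "0 \<le> a" "0 \<le> B" using l2_le_nonneg[OF f] l2_le_nonneg[OF l] by auto
    obtain d where d: "l2_le (\<lambda>z. complex_of_real (lowpass_at lam (z::'a))) d" using lowpass_at_l2[OF lam0] by blast
    define R where "R = lam powr (1/2)"
    define \<tau> where "\<tau> = lam powr (- 1 / 8)"
    define \<delta> where "\<delta> = C1 / lam"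
    have R: "R \<ge> 1" using lam by (simp add: R_def ge_one_powr_ge_zero)
    have \<tau>: "\<tau> > 0" using lam0 by (simp add: \<tau>_def)
    have \<delta>0: "\<delta> \<ge> 0" using C1 lam0 by (simp add: \<delta>_def)
    have main: "cmod (trilinear K f g h) \<le>
      ((V * sqrt V * ((1 + 2 * pi * R) * \<delta>) + 2 * \<tau> + Cd / sqrt R * (V / \<tau>) * 2) *
       measure lborel (cball (0::'a) 4) / sqrt (measure lborel (cball (0::'a) 1)) + measure lborel (cball (0::'a\<times>'a) 2) * \<delta>) * a * B"
      by (rule trilinear_high_frequency[OF decay Cd lowpass_at_nonneg[OF lam0] integrable_lowpass_at[OF lam0]
          integral_lowpass_at[OF lam0] mom[OF lam0, folded \<delta>_def] \<delta>0 d f lowpass_orthogonal[OF G f supp lam0] gh])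
         (use R \<tau> in auto)
    have \<delta>\<tau>: "\<delta> \<le> C1 * \<tau>"
    proof -
      have "1 / lam = lam powr (-1)" using lam0 by (simp add: powr_minus_divide)
      also have "\<dots> \<le> \<tau>" unfolding \<tau>_def using lam by (intro powr_mono) auto
      finally show ?thesis using mult_left_mono[of "1 / lam" \<tau> C1] C1 by (simp add: \<delta>_def)
    qed
    have R\<delta>: "(1 + 2 * pi * R) * \<delta> \<le> (1 + 2 * pi) * C1 * \<tau>"
    proof -
      have "(1 + 2 * pi * R) * \<delta> \<le> ((1 + 2 * pi) * R) * \<delta>"
        using R \<delta>0 by (intro mult_right_mono) (auto simp: algebra_simps)
      also have "\<dots> = (1 + 2 * pi) * C1 * (R / lam)" by (simp add: \<delta>_def)
      also have "R / lam = lam powr (1/2 - 1)" using lam0 unfolding R_def powr_diff by simp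
      also have "(1 + 2 * pi) * C1 * lam powr (1/2 - 1) \<le> (1 + 2 * pi) * C1 * \<tau>"
        unfolding \<tau>_def using lam C1 by (intro mult_left_mono powr_mono) auto
      finally show ?thesis .
    qed
    have R\<tau>: "Cd / sqrt R * (V / \<tau>) * 2 = Cd * V * 2 * \<tau>"
    proof -
      have s: "sqrt R = lam powr (1/4)" unfolding R_def using lam0 by (simp add: powr_half_sqrt[symmetric] powr_powr)
      have "sqrt R * \<tau> * \<tau> = 1" unfolding s \<tau>_def using lam0 by (simp flip: powr_add)
      then have "1 / (sqrt R * \<tau>) = \<tau>" using \<tau> R by (simp add: field_simps)
      then have "Cd * V * 2 * (1 / (sqrt R * \<tau>)) = Cd * V * 2 * \<tau>" by simp
      then show ?thesis by (simp add: field_simps)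
    qed
    have "(V * sqrt V * ((1 + 2 * pi * R) * \<delta>) + 2 * \<tau> + Cd / sqrt R * (V / \<tau>) * 2) * Q + W * \<delta> \<le>
        (V * sqrt V * ((1 + 2 * pi) * C1 * \<tau>) + 2 * \<tau> + Cd * V * 2 * \<tau>) * Q + W * (C1 * \<tau>)"
      unfolding R\<tau> using VQW
      by (intro add_mono mult_right_mono mult_left_mono R\<delta> \<delta>\<tau> order_refl mult_nonneg_nonneg) auto
    also have "\<dots> \<le> C * \<tau>" unfolding C_def using \<tau> by (simp add: algebra_simps)
    finally have "((V * sqrt V * ((1 + 2 * pi * R) * \<delta>) + 2 * \<tau> + Cd / sqrt R * (V / \<tau>) * 2) * Q + W * \<delta>) * (a * B) \<le> C * \<tau> * (a * B)"
      using a0 by (intro mult_right_mono) auto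
    then show ?thesis using main unfolding Q_def W_def \<tau>_def by (simp add: mult.assoc)
  qed
  with C show ?thesis unfolding V_def by blast
qed

section \<open>The surface measure and homogeneous kernels\<close>

lemma measurable_sgn_sphere:
  "(\<lambda>y. y /\<^sub>R norm y) \<in> restrict_space borel (- {0}) \<rightarrow>\<^sub>M restrict_space borel (sphere (0::'a::euclidean_space) 1)"
proof (rule measurable_restrict_space2)
  show "(\<lambda>y. y /\<^sub>R norm y) \<in> space (restrict_space borel (- {0})) \<rightarrow> sphere (0::'a) 1"
    by (auto simp: space_restrict_space)
  have "(\<lambda>y::'a. y /\<^sub>R norm y) \<in> borel_measurable borel" by measurable
  then show "(\<lambda>y::'a. y /\<^sub>R norm y) \<in> borel_measurable (restrict_space borel (- {0}))"
    by (rule measurable_restrict_space1)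
qed

lemma measurable_sphere_lift:
  fixes \<Omega> :: "'a::euclidean_space \<Rightarrow> complex"
  assumes "\<Omega> \<in> borel_measurable sphere_measure"
  shows "(\<lambda>y. \<Omega> (y /\<^sub>R norm y)) \<in> borel_measurable borel"
proof -
  have "\<Omega> \<in> borel_measurable (restrict_space borel (sphere 0 1))"
    using assms by (simp cong: measurable_cong_sets add: sets_sphere_measure)
  from measurable_compose[OF measurable_sgn_sphere this]
  have "(\<lambda>y. indicator (- {0}) y *\<^sub>R \<Omega> (y /\<^sub>R norm y)) \<in> borel_measurable borel"
    by (subst (asm) borel_measurable_restrict_space_iff) auto
  then have "(\<lambda>y. indicator (- {0}) y *\<^sub>R \<Omega> (y /\<^sub>R norm y) + indicator {0} y *\<^sub>R \<Omega> 0) \<in> borel_measurable borel"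
    by measurable
  also have "(\<lambda>y. indicator (- {0}) y *\<^sub>R \<Omega> (y /\<^sub>R norm y) + indicator {0} y *\<^sub>R \<Omega> 0) = (\<lambda>y. \<Omega> (y /\<^sub>R norm y))"
    by (auto simp: fun_eq_iff indicator_def)
  finally show ?thesis .
qed

lemma nn_integral_sphere:
  fixes F :: "'a::euclidean_space \<Rightarrow> ennreal"
  assumes "F \<in> borel_measurable sphere_measure"
  shows "(\<integral>\<^sup>+\<theta>. F \<theta> \<partial>sphere_measure) =
    of_nat DIM('a) * (\<integral>\<^sup>+y. F (y /\<^sub>R norm y) * indicator (ball 0 1 - {0}) y \<partial>lborel)"
proof -
  let ?B = "ball 0 1 - {0} :: 'a set"
  have F: "F \<in> borel_measurable (restrict_space borel (sphere 0 1))"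
    using assms by (simp cong: measurable_cong_sets add: sets_sphere_measure)
  have meas: "sgn \<in> restrict_space lborel ?B \<rightarrow>\<^sub>M restrict_space borel (sphere (0::'a) 1)"
  proof (rule measurable_restrict_space2)
    show "sgn \<in> space (restrict_space lborel ?B) \<rightarrow> sphere 0 1"
      by (auto simp: space_restrict_space norm_sgn)
    have "(\<lambda>x::'a. x /\<^sub>R norm x) \<in> borel_measurable borel" by measurable
    then have "(sgn :: 'a \<Rightarrow> 'a) \<in> borel_measurable lborel" by (simp add: sgn_div_norm[abs_def])
    then show "sgn \<in> borel_measurable (restrict_space lborel ?B)" by (rule measurable_restrict_space1)
  qed
  have "(\<integral>\<^sup>+\<theta>. F \<theta> \<partial>sphere_measure) = of_nat DIM('a) *
      (\<integral>\<^sup>+\<theta>. F \<theta> \<partial>distr (restrict_space lborel ?B) (restrict_space borel (sphere 0 1)) sgn)"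
    unfolding sphere_measure_def by (rule nn_integral_scale_measure) (simp add: F)
  also have "(\<integral>\<^sup>+\<theta>. F \<theta> \<partial>distr (restrict_space lborel ?B) (restrict_space borel (sphere 0 1)) sgn) =
      (\<integral>\<^sup>+y. F (sgn y) \<partial>restrict_space lborel ?B)"
    by (rule nn_integral_distr[OF meas]) (simp add: F)
  also have "\<dots> = (\<integral>\<^sup>+y. F (sgn y) * indicator ?B y \<partial>lborel)"
    by (rule nn_integral_restrict_space) simp
  finally show ?thesis by (simp add: sgn_div_norm)
qed

lemma hom_kernel_measurable:
  assumes \<beta>: "\<beta> \<in> test_functions" "fun_support \<beta> \<subseteq> {1/2<..<2}"
    and [measurable]: "(\<lambda>y. \<Omega> (y /\<^sub>R norm y)) \<in> borel_measurable borel"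
  shows "hom_kernel \<beta> \<Omega> \<in> borel_measurable borel"
proof -
  have [measurable]: "\<beta> \<in> borel_measurable borel"
    by (rule borel_measurable_continuous_onI[OF test_function_bounds(2)[OF \<beta>]])
  show ?thesis unfolding hom_kernel_def[abs_def] by measurable
qed

lemma hom_kernel_bound:
  fixes \<Omega> :: "'a::euclidean_space \<Rightarrow> complex"
  assumes \<beta>: "\<beta> \<in> test_functions" "fun_support \<beta> \<subseteq> {1/2<..<2}" and B: "\<And>t. cmod (\<beta> t) \<le> B"
  shows "cmod (hom_kernel \<beta> \<Omega> y) \<le> 2 ^ DIM('a) * B * cmod (\<Omega> (y /\<^sub>R norm y))"
    and "norm y \<notin> {1/2<..<2} \<Longrightarrow> hom_kernel \<beta> \<Omega> y = 0"
proof -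
  note \<beta>0 = test_function_support[OF \<beta>(2)]
  show z: "hom_kernel \<beta> \<Omega> y = 0" if "norm y \<notin> {1/2<..<2}"
    using \<beta>0[of "norm y"] that by (auto simp: hom_kernel_def)
  have B0: "0 \<le> B" using B[of 0] norm_ge_zero order_trans by blast
  show "cmod (hom_kernel \<beta> \<Omega> y) \<le> 2 ^ DIM('a) * B * cmod (\<Omega> (y /\<^sub>R norm y))"
  proof (cases "norm y \<in> {1/2<..<2}")
    case True
    have "norm y powr (- real DIM('a)) \<le> (1/2) powr (- real DIM('a))"
      using True by (intro powr_mono2') auto
    also have "\<dots> = 2 ^ DIM('a)" by (simp add: powr_minus powr_realpow power_divide flip: power_inverse)
    finally have "norm y powr (- real DIM('a)) * cmod (\<beta> (norm y)) \<le> 2 ^ DIM('a) * B"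
      by (intro mult_mono B) auto
    then have "norm y powr (- real DIM('a)) * cmod (\<beta> (norm y)) * cmod (\<Omega> (y /\<^sub>R norm y)) \<le> 2 ^ DIM('a) * B * cmod (\<Omega> (y /\<^sub>R norm y))"
      by (rule mult_right_mono) auto
    then show ?thesis by (simp add: hom_kernel_def norm_mult ac_simps)
  qed (simp add: z B0)
qed

text \<open>
  The kernel lives on \<open>\<bar>y\<bar> < 2\<close>. Dilating by 2 maps this to the punctured unit ball, over which integrals of
  functions of \<open>y / \<bar>y\<bar>\<close> are integrals over the sphere by the definition of the surface measure.
\<close>

lemma hom_kernel_L1:
  fixes \<Omega> :: "'a::euclidean_space \<Rightarrow> complex"
  assumes \<beta>: "\<beta> \<in> test_functions" "fun_support \<beta> \<subseteq> {1/2<..<2}" and B: "\<And>t. cmod (\<beta> t) \<le> B"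
    and \<Omega>: "\<Omega> \<in> borel_measurable sphere_measure"
  shows "(\<integral>\<^sup>+y. ennreal (cmod (hom_kernel \<beta> \<Omega> y)) \<partial>lborel) \<le>
    ennreal (2 ^ DIM('a) * B * 2 ^ DIM('a)) * (\<integral>\<^sup>+\<theta>. ennreal (cmod (\<Omega> \<theta>)) \<partial>sphere_measure)"
proof -
  note [measurable] = measurable_sphere_lift[OF \<Omega>]
  have B0: "0 \<le> B" using B[of 0] norm_ge_zero order_trans by blast
  let ?g = "\<lambda>y::'a. ennreal (cmod (\<Omega> (y /\<^sub>R norm y)))"
  have m: "(\<lambda>y. ?g y * indicator (ball 0 2 - {0}) y) \<in> borel_measurable borel" by measurable
  have "(\<integral>\<^sup>+y. ennreal (cmod (hom_kernel \<beta> \<Omega> y)) \<partial>lborel) \<le>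
      (\<integral>\<^sup>+y. ennreal (2 ^ DIM('a) * B) * (?g y * indicator (ball 0 2 - {0}) y) \<partial>lborel)"
  proof (rule nn_integral_mono)
    fix y :: 'a
    show "ennreal (cmod (hom_kernel \<beta> \<Omega> y)) \<le> ennreal (2 ^ DIM('a) * B) * (?g y * indicator (ball 0 2 - {0}) y)"
    proof (cases "norm y \<in> {1/2<..<2}")
      case True
      then have "y \<in> ball 0 2 - {0}" by auto
      moreover have "ennreal (cmod (hom_kernel \<beta> \<Omega> y)) \<le> ennreal (2 ^ DIM('a) * B * cmod (\<Omega> (y /\<^sub>R norm y)))"
        by (intro ennreal_leI hom_kernel_bound(1)[OF \<beta> B])
      ultimately show ?thesis using B0 by (simp add: ennreal_mult)
    qed (simp add: hom_kernel_bound(2)[OF \<beta> B])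
  qed
  also have "\<dots> = ennreal (2 ^ DIM('a) * B) * (\<integral>\<^sup>+y. ?g y * indicator (ball 0 2 - {0}) y \<partial>lborel)"
    using m by (intro nn_integral_cmult) simp
  also have "(\<integral>\<^sup>+y. ?g y * indicator (ball 0 2 - {0}) y \<partial>lborel) =
      ennreal (\<bar>2\<bar> ^ DIM('a)) * (\<integral>\<^sup>+y. ?g (0 + 2 *\<^sub>R y) * indicator (ball 0 2 - {0}) (0 + 2 *\<^sub>R y :: 'a) \<partial>lborel)"
    by (rule nn_integral_lborel_affine[OF m]) simp
  also have "(\<integral>\<^sup>+y. ?g (0 + 2 *\<^sub>R y) * indicator (ball 0 2 - {0}) (0 + 2 *\<^sub>R y :: 'a) \<partial>lborel) =
      (\<integral>\<^sup>+y. ?g y * indicator (ball 0 1 - {0}) y \<partial>lborel)"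
    by (intro nn_integral_cong) (auto simp: indicator_def)
  also have "ennreal (2 ^ DIM('a) * B) * (ennreal (\<bar>2\<bar> ^ DIM('a)) * (\<integral>\<^sup>+y. ?g y * indicator (ball 0 1 - {0}) y \<partial>lborel)) =
      ennreal (2 ^ DIM('a) * B * 2 ^ DIM('a)) * (\<integral>\<^sup>+y. ?g y * indicator (ball 0 1 - {0}) y \<partial>lborel)"
    using B0 by (simp add: ennreal_mult mult.assoc)
  also have "\<dots> \<le> ennreal (2 ^ DIM('a) * B * 2 ^ DIM('a)) * (\<integral>\<^sup>+\<theta>. ennreal (cmod (\<Omega> \<theta>)) \<partial>sphere_measure)"
  proof (rule mult_left_mono)
    have "1 * (\<integral>\<^sup>+y. ?g y * indicator (ball 0 1 - {0}) y \<partial>lborel) \<le> of_nat DIM('a) * (\<integral>\<^sup>+y. ?g y * indicator (ball 0 1 - {0}) y \<partial>lborel)"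
    proof (rule mult_right_mono)
      have "of_nat 1 \<le> (of_nat DIM('a) :: ennreal)" using DIM_positive[where 'a='a] by (intro of_nat_mono) simp
      then show "1 \<le> (of_nat DIM('a) :: ennreal)" by simp
    qed simp
    also have "\<dots> = (\<integral>\<^sup>+\<theta>. ennreal (cmod (\<Omega> \<theta>)) \<partial>sphere_measure)"
      using \<Omega> by (intro nn_integral_sphere[symmetric]) measurable
    finally show "(\<integral>\<^sup>+y. ?g y * indicator (ball 0 1 - {0}) y \<partial>lborel) \<le> (\<integral>\<^sup>+\<theta>. ennreal (cmod (\<Omega> \<theta>)) \<partial>sphere_measure)" by simp
  qed simp
  finally show ?thesis .
qed

section \<open>Truncation of a function in Lp\<close>

lemma Lp_space_D:
  assumes "f \<in> Lp_space p M"
  shows "f \<in> borel_measurable M" "eLp_norm p M f = ennreal (Lp_norm p M f)" "0 \<le> Lp_norm p M f"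
  using assms by (auto simp: Lp_space_def Lp_norm_def less_top)

lemma Lp_norm_top_AE:
  assumes "f \<in> Lp_space \<infinity> M" shows "AE x in M. cmod (f x) \<le> Lp_norm \<infinity> M f"
proof -
  have "AE x in M. ennreal (cmod (f x)) \<le> esssup M (\<lambda>x. ennreal (cmod (f x)))" by (rule esssup_AE)
  moreover have "esssup M (\<lambda>x. ennreal (cmod (f x))) = ennreal (Lp_norm \<infinity> M f)"
    using Lp_space_D(2)[OF assms] by (simp add: eLp_norm_def)
  ultimately show ?thesis using Lp_space_D(3)[OF assms] by (simp add: ennreal_le_iff)
qed

lemma Lp_norm_finite:
  assumes f: "f \<in> Lp_space p M" and p: "p \<noteq> \<infinity>" "0 < enn2real p"
  shows "(\<integral>\<^sup>+ x. ennreal (norm (f x) powr enn2real p) \<partial>M) = ennreal (Lp_norm p M f powr enn2real p)"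
proof -
  let ?I = "\<integral>\<^sup>+ x. ennreal (norm (f x) powr enn2real p) \<partial>M"
  have "eLp_norm p M f < \<infinity>" using f by (simp add: Lp_space_def)
  then have I: "?I \<noteq> \<infinity>" using p by (auto simp: eLp_norm_def Let_def split: if_splits)
  then have "Lp_norm p M f = enn2real ?I powr (1 / enn2real p)"
    using p by (simp add: Lp_norm_def eLp_norm_def Let_def)
  then have "Lp_norm p M f powr enn2real p = enn2real ?I" using p by (simp add: powr_powr)
  then show ?thesis using I by (simp add: less_top)
qed

lemma Lp_2_l2_le:
  assumes "f \<in> Lp_space 2 lborel" shows "l2_le f (Lp_norm 2 lborel f)"
proof -
  have "(\<integral>\<^sup>+ x. ennreal (cmod (f x) powr 2) \<partial>lborel) = ennreal (Lp_norm 2 lborel f powr 2)"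
    using Lp_norm_finite[OF assms] by simp
  then show ?thesis using Lp_space_D[OF assms] by (simp add: l2_le_def powr_numeral)
qed

text \<open>
  For finite \<open>q\<close> this is the inequality \<open>\<bar>f\<bar> \<le> (A L)^(1 - q) \<bar>f\<bar>^q\<close> on the set where \<open>\<bar>f\<bar> > A L\<close>, with \<open>A\<close> the norm of
  \<open>f\<close>; for \<open>A = 0\<close> the function vanishes almost everywhere, and for \<open>q = \<infinity>\<close> that set is null.
\<close>

lemma truncation_tail:
  assumes q: "1 < (q::ennreal)"
  shows "\<exists>\<kappa>>0. \<forall>f\<in>Lp_space q M. \<forall>L\<ge>1.
    (\<integral>\<^sup>+x. ennreal (cmod (if cmod (f x) \<le> Lp_norm q M f * L then 0 else f x)) \<partial>M) \<le> ennreal (Lp_norm q M f * L powr (- \<kappa>))"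
proof (cases "q = \<infinity>")
  case True
  have "(\<integral>\<^sup>+x. ennreal (cmod (if cmod (f x) \<le> Lp_norm q M f * L then 0 else f x)) \<partial>M) = 0"
    if f: "f \<in> Lp_space q M" and L: "L \<ge> 1" for f L
  proof -
    have "AE x in M. cmod (f x) \<le> Lp_norm q M f" using Lp_norm_top_AE f True by blast
    then have "AE x in M. ennreal (cmod (if cmod (f x) \<le> Lp_norm q M f * L then 0 else f x)) = 0"
    proof eventually_elim
      case (elim x)
      have "Lp_norm q M f * 1 \<le> Lp_norm q M f * L" using L Lp_space_D(3)[OF f] by (intro mult_left_mono) auto
      with elim show ?case by simp
    qed
    then have "(\<integral>\<^sup>+x. ennreal (cmod (if cmod (f x) \<le> Lp_norm q M f * L then 0 else f x)) \<partial>M) = (\<integral>\<^sup>+x. 0 \<partial>M)"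
      by (rule nn_integral_cong_AE)
    then show ?thesis by simp
  qed
  then show ?thesis by (intro exI[of _ 1]) auto
next
  case False
  define r where "r = enn2real q"
  have r: "r > 1"
  proof -
    obtain r0 where r0: "q = ennreal r0" "0 \<le> r0" using False by (cases q) auto
    then have "ennreal 1 < ennreal r0" using q by simp
    then have "1 < r0" using r0(2) by (subst (asm) ennreal_less_iff) auto
    then show ?thesis using r0 by (simp add: r_def)
  qed
  have "(\<integral>\<^sup>+x. ennreal (cmod (if cmod (f x) \<le> Lp_norm q M f * L then 0 else f x)) \<partial>M) \<le> ennreal (Lp_norm q M f * L powr (- (r - 1)))"
    if f: "f \<in> Lp_space q M" and L: "L \<ge> 1" for f L
  proof -
    define A where "A = Lp_norm q M f"
    have A0: "0 \<le> A" using Lp_space_D(3)[OF f] by (simp add: A_def)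
    have [measurable]: "f \<in> borel_measurable M" by (rule Lp_space_D(1)[OF f])
    have I: "(\<integral>\<^sup>+ x. ennreal (cmod (f x) powr r) \<partial>M) = ennreal (A powr r)"
      using Lp_norm_finite[OF f False] r by (simp add: r_def A_def)
    show ?thesis
    proof (cases "A = 0")
      case True
      then have I0: "(\<integral>\<^sup>+ x. ennreal (cmod (f x) powr r) \<partial>M) = 0" using I by simp
      have "(\<lambda>x. ennreal (cmod (f x) powr r)) \<in> borel_measurable M" by measurable
      with I0 have "AE x in M. ennreal (cmod (f x) powr r) = 0" by (simp only: nn_integral_0_iff_AE)
      then have "AE x in M. ennreal (cmod (if cmod (f x) \<le> A * L then 0 else f x)) = 0"
        by eventually_elim simp
      then have "(\<integral>\<^sup>+x. ennreal (cmod (if cmod (f x) \<le> A * L then 0 else f x)) \<partial>M) = (\<integral>\<^sup>+x. 0 \<partial>M)"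
        by (rule nn_integral_cong_AE)
      then show ?thesis by (simp add: A_def)
    next
      case False
      then have AL: "0 < A * L" "A > 0" using A0 L by auto
      have "(\<integral>\<^sup>+x. ennreal (cmod (if cmod (f x) \<le> A * L then 0 else f x)) \<partial>M) \<le>
          (\<integral>\<^sup>+x. ennreal ((A * L) powr (1 - r)) * ennreal (cmod (f x) powr r) \<partial>M)"
      proof (rule nn_integral_mono)
        fix x
        show "ennreal (cmod (if cmod (f x) \<le> A * L then 0 else f x)) \<le> ennreal ((A * L) powr (1 - r)) * ennreal (cmod (f x) powr r)"
        proof (cases "cmod (f x) \<le> A * L")
          case False
          then have fx: "cmod (f x) > 0" using AL by linarith
          have "cmod (f x) = cmod (f x) powr (1 - r) * cmod (f x) powr r" using fx by (simp flip: powr_add)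
          also have "\<dots> \<le> (A * L) powr (1 - r) * cmod (f x) powr r"
            using False AL r by (intro mult_right_mono powr_mono2') auto
          finally have "ennreal (cmod (f x)) \<le> ennreal ((A * L) powr (1 - r) * cmod (f x) powr r)" by (rule ennreal_leI)
          also have "\<dots> = ennreal ((A * L) powr (1 - r)) * ennreal (cmod (f x) powr r)" by (intro ennreal_mult) auto
          finally show ?thesis using False by simp
        qed simp
      qed
      also have "\<dots> = ennreal ((A * L) powr (1 - r)) * ennreal (A powr r)"
        by (simp add: nn_integral_cmult I)
      also have "\<dots> = ennreal ((A * L) powr (1 - r) * A powr r)" by (intro ennreal_mult[symmetric]) auto
      also have "(A * L) powr (1 - r) * A powr r = A * L powr (- (r - 1))"
      proof -
        have "(A * L) powr (1 - r) * A powr r = (A powr (1 - r) * A powr r) * L powr (1 - r)"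
          using A0 L by (simp add: powr_mult)
        also have "A powr (1 - r) * A powr r = A" using AL by (simp flip: powr_add)
        finally show ?thesis by simp
      qed
      finally show ?thesis by (simp add: A_def)
    qed
  qed
  then show ?thesis using r by (intro exI[of _ "r - 1"]) auto
qed

section \<open>Exchanging the two variables\<close>

lemma integral_lborel_prod_swap:
  fixes F :: "'a::euclidean_space \<times> 'a \<Rightarrow> complex"
  assumes [measurable]: "F \<in> borel_measurable borel"
  shows "(\<integral>p. F (snd p, fst p) \<partial>lborel) = (\<integral>p. F p \<partial>lborel)"
proof -
  have "F \<in> borel_measurable (lborel \<Otimes>\<^sub>M lborel)" by (simp add: lborel_prod del: measurable_lborel1)
  from lborel_pair.integral_product_swap[OF this] show ?thesis
    by (simp add: lborel_prod case_prod_unfold)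
qed

lemma nn_integral_lborel_prod_swap:
  fixes F :: "'a::euclidean_space \<times> 'a \<Rightarrow> ennreal"
  assumes [measurable]: "F \<in> borel_measurable borel"
  shows "(\<integral>\<^sup>+p. F (snd p, fst p) \<partial>lborel) = (\<integral>\<^sup>+p. F p \<partial>lborel)"
proof -
  have "(\<integral>\<^sup>+p. F (snd p, fst p) \<partial>(lborel \<Otimes>\<^sub>M lborel)) = (\<integral>\<^sup>+y. \<integral>\<^sup>+w. F (w, y) \<partial>lborel \<partial>lborel)"
    by (subst lborel.nn_integral_fst[symmetric]) auto
  also have "\<dots> = (\<integral>\<^sup>+w. \<integral>\<^sup>+y. F (w, y) \<partial>lborel \<partial>lborel)"
    by (rule nn_integral_lborel_swap) measurable
  also have "\<dots> = (\<integral>\<^sup>+p. F p \<partial>(lborel \<Otimes>\<^sub>M lborel))"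
  proof (rule lborel.nn_integral_fst)
    show "F \<in> borel_measurable (lborel \<Otimes>\<^sub>M lborel)" unfolding lborel_prod by simp
  qed
  finally show ?thesis by (simp add: lborel_prod)
qed

lemma trilinear_swap:
  assumes [measurable]: "K \<in> borel_measurable borel" "f \<in> borel_measurable borel" "g \<in> borel_measurable borel"
  shows "trilinear (\<lambda>p. K (snd p, fst p)) f g h = trilinear K g f h"
  unfolding trilinear_def
proof (rule Bochner_Integration.integral_cong[OF refl])
  fix x
  have "(\<lambda>p. K p * g (x - fst p) * f (x - snd p) * cnj (h x)) \<in> borel_measurable borel" by measurable
  from integral_lborel_prod_swap[OF this]
  show "(\<integral>p. K (snd p, fst p) * f (x - fst p) * g (x - snd p) * cnj (h x) \<partial>lborel) =
      (\<integral>p. K p * g (x - fst p) * f (x - snd p) * cnj (h x) \<partial>lborel)"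
    by (simp add: ac_simps)
qed

lemma fourier_swap:
  fixes K :: "'a::euclidean_space \<times> 'a \<Rightarrow> complex"
  assumes [measurable]: "K \<in> borel_measurable borel"
  shows "fourier (\<lambda>p. K (snd p, fst p)) \<zeta> = fourier K (snd \<zeta>, fst \<zeta>)"
proof -
  have "(\<lambda>p. K p * ee (- (p \<bullet> (snd \<zeta>, fst \<zeta>)))) \<in> borel_measurable borel" by measurable
  from integral_lborel_prod_swap[OF this] show ?thesis
    unfolding fourier_ee by (simp add: inner_prod_def add.commute)
qed

section \<open>The estimate for kernels with integrable angular part\<close>

lemma l2_pair_bounded:
  fixes g h :: "'a::euclidean_space \<Rightarrow> complex"
  assumes g: "l2_le g b" and [measurable]: "h \<in> borel_measurable borel"
    and h: "AE x in lborel. cmod (h x) \<le> M" and M: "0 \<le> M"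
  shows "l2_pair g h (b * M)" "l2_pair h g (b * M)"
proof -
  note [measurable] = l2_le_measurable[OF g]
  have b0: "0 \<le> b" by (rule l2_le_nonneg[OF g])
  have prod: "l2_le (\<lambda>x. k x * h x) (b * M)" if k: "l2_le k b" for k
  proof -
    note [measurable] = l2_le_measurable[OF k]
    have "(\<integral>\<^sup>+x. ennreal ((cmod (k x * h x))\<^sup>2) \<partial>lborel) \<le> (\<integral>\<^sup>+x. ennreal (M\<^sup>2) * ennreal ((cmod (k x))\<^sup>2) \<partial>lborel)"
    proof (rule nn_integral_mono_AE)
      show "AE x in lborel. ennreal ((cmod (k x * h x))\<^sup>2) \<le> ennreal (M\<^sup>2) * ennreal ((cmod (k x))\<^sup>2)"
        using h
      proof eventually_elim
        case (elim x)
        then have "(cmod (h x))\<^sup>2 * (cmod (k x))\<^sup>2 \<le> M\<^sup>2 * (cmod (k x))\<^sup>2"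
          by (intro mult_right_mono power_mono) auto
        then have "ennreal ((cmod (k x * h x))\<^sup>2) \<le> ennreal (M\<^sup>2 * (cmod (k x))\<^sup>2)"
          by (intro ennreal_leI) (simp add: norm_mult power_mult_distrib mult.commute)
        then show ?case by (simp add: ennreal_mult)
      qed
    qed
    also have "\<dots> = ennreal (M\<^sup>2) * (\<integral>\<^sup>+x. ennreal ((cmod (k x))\<^sup>2) \<partial>lborel)"
      by (rule nn_integral_cmult) measurable
    also have "\<dots> \<le> ennreal (M\<^sup>2) * ennreal (b\<^sup>2)" by (intro mult_left_mono l2_le_bound k) auto
    also have "\<dots> = ennreal ((b * M)\<^sup>2)" by (simp add: power_mult_distrib mult.commute flip: ennreal_mult)
    finally show ?thesis using b0 M by (simp add: l2_le_def)
  qed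
  have lg: "(\<integral>\<^sup>+x. ennreal ((cmod (g x))\<^sup>2) * indicator (cball 0 r) (x - z) \<partial>lborel) < \<infinity>" for z r
  proof -
    have "(\<integral>\<^sup>+x. ennreal ((cmod (g x))\<^sup>2) * indicator (cball 0 r) (x - z) \<partial>lborel) \<le> (\<integral>\<^sup>+x. ennreal ((cmod (g x))\<^sup>2) \<partial>lborel)"
      by (intro nn_integral_mono) (auto simp: indicator_def)
    also have "\<dots> \<le> ennreal (b\<^sup>2)" by (rule l2_le_bound[OF g])
    finally show ?thesis by (rule le_less_trans) simp
  qed
  have lh: "(\<integral>\<^sup>+x. ennreal ((cmod (h x))\<^sup>2) * indicator (cball 0 r) (x - z) \<partial>lborel) < \<infinity>" for z r
  proof -
    have "(\<integral>\<^sup>+x. ennreal ((cmod (h x))\<^sup>2) * indicator (cball 0 r) (x - z) \<partial>lborel) \<le>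
        (\<integral>\<^sup>+x. ennreal (M\<^sup>2) * indicator (cball z r) x \<partial>lborel)"
    proof (rule nn_integral_mono_AE)
      show "AE x in lborel. ennreal ((cmod (h x))\<^sup>2) * indicator (cball 0 r) (x - z) \<le> ennreal (M\<^sup>2) * indicator (cball z r) x"
        using h
      proof eventually_elim
        case (elim x)
        then have "ennreal ((cmod (h x))\<^sup>2) \<le> ennreal (M\<^sup>2)" by (intro ennreal_leI power_mono) auto
        then show ?case by (auto simp: indicator_def dist_norm norm_minus_commute)
      qed
    qed
    also have "\<dots> = ennreal (M\<^sup>2) * emeasure lborel (cball z r)"
      by (rule nn_integral_cmult_indicator) simp
    also have "\<dots> < \<infinity>" using emeasure_lborel_cball_finite[of z r] by (simp add: ennreal_mult_less_top)
    finally show ?thesis .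
  qed
  have 1: "l2_le (\<lambda>x. g (x - v) * h x) (b * M)" for v by (rule prod[OF l2_le_affine(2)[OF g]])
  have 2: "l2_le (\<lambda>x. h (x - v) * g x) (b * M)" for v
    using l2_le_affine(2)[OF prod[OF l2_le_affine(1)[OF g, of v]], of v] by (simp add: mult.commute)
  show "l2_pair g h (b * M)" "l2_pair h g (b * M)"
    using 1 2 lg lh by (auto simp: l2_pair_def)
qed

lemma fourier_cmult: "fourier (\<lambda>x. c * f x) \<xi> = c * fourier f \<xi>"
  unfolding fourier_ee by (simp add: mult.assoc)

text \<open>
  Truncate \<open>\<Omega>\<close> at height \<open>A L\<close>, where \<open>A\<close> is its norm and \<open>L = lam powr (1/16)\<close>. The bounded part loses a factor
  \<open>L\<close> against the gain \<open>lam powr (- 1/8)\<close>; the rest has small mass. Both parts of the kernel keep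
  their properties when the two variables are exchanged, which gives the second inequality.
\<close>

lemma rough_trilinear_bound:
  fixes \<beta> :: "real \<Rightarrow> complex" and q :: ennreal
  assumes \<beta>: "\<beta> \<in> test_functions" "fun_support \<beta> \<subseteq> {1/2<..<2}" and nz: "\<beta> t0 \<noteq> 0" and q: "1 < q"
  shows "\<exists>c>0. \<exists>C>0. \<forall>lam\<ge>1. \<forall>\<Omega>\<in>Lp_space q (sphere_measure :: ('a::euclidean_space \<times> 'a) measure). \<forall>f a g h B.
    l2_le f a \<longrightarrow> fourier_support f \<subseteq> {\<xi>. lam \<le> norm \<xi>} \<longrightarrow> l2_pair g h B \<longrightarrow>
    cmod (trilinear (K0 \<beta> \<Omega>) f g h) \<le> C * lam powr (- c) * Lp_norm q sphere_measure \<Omega> * a * B \<and>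
    cmod (trilinear (K0 \<beta> \<Omega>) g f h) \<le> C * lam powr (- c) * Lp_norm q sphere_measure \<Omega> * a * B"
proof -
  obtain G :: "'a \<Rightarrow> complex" where G: "bump G" using bump_exists[OF \<beta> nz] by blast
  obtain B0 where B0: "B0 > 0" "\<And>t. cmod (\<beta> t) \<le> B0" using test_function_bounds(1)[OF \<beta>] by blast
  obtain C0 where C0: "C0 > 0" and dec: "\<And>(\<Omega> :: 'a \<times> 'a \<Rightarrow> complex) N \<zeta>.
      (\<lambda>y. \<Omega> (y /\<^sub>R norm y)) \<in> borel_measurable borel \<Longrightarrow> (\<And>y. cmod (\<Omega> y) \<le> N) \<Longrightarrow> \<zeta> \<noteq> 0 \<Longrightarrow>
      cmod (fourier (hom_kernel \<beta> \<Omega>) \<zeta>) \<le> C0 * N / sqrt (norm \<zeta>)"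
    using hom_kernel_fourier_decay[OF \<beta>, where 'a = "'a \<times> 'a"] by blast
  obtain \<kappa> where \<kappa>: "\<kappa> > 0" and tail: "\<And>\<Omega> L. \<Omega> \<in> Lp_space q (sphere_measure :: ('a \<times> 'a) measure) \<Longrightarrow> L \<ge> 1 \<Longrightarrow>
      (\<integral>\<^sup>+x. ennreal (cmod (if cmod (\<Omega> x) \<le> Lp_norm q sphere_measure \<Omega> * L then 0 else \<Omega> x)) \<partial>sphere_measure)
        \<le> ennreal (Lp_norm q sphere_measure \<Omega> * L powr (- \<kappa>))"
    using truncation_tail[OF q, of "sphere_measure :: ('a \<times> 'a) measure"] by blast
  define c0 where "c0 = 2 ^ DIM('a \<times> 'a) * B0"
  have c0: "c0 > 0" using B0 by (simp add: c0_def)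
  define W1 where "W1 = 2 ^ DIM('a \<times> 'a) * B0 * 2 ^ DIM('a \<times> 'a)"
  have W1: "W1 > 0" using B0 by (simp add: W1_def)
  define Cd where "Cd = C0 / c0"
  have Cd: "0 \<le> Cd" using C0 c0 by (simp add: Cd_def)
  define V where "V = measure lborel (cball (0::'a) 2)"
  obtain C1 where C1: "C1 > 0" and high: "\<And>(K :: 'a \<times> 'a \<Rightarrow> complex) lam f a g h B. unit_kernel K V \<Longrightarrow>
      (\<And>\<zeta>. \<zeta> \<noteq> 0 \<Longrightarrow> cmod (fourier K \<zeta>) \<le> Cd / sqrt (norm \<zeta>)) \<Longrightarrow> 1 \<le> lam \<Longrightarrow> l2_le f a \<Longrightarrow>
      fourier_support f \<subseteq> {\<xi>. lam \<le> norm \<xi>} \<Longrightarrow> l2_pair g h B \<Longrightarrow>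
      cmod (trilinear K f g h) \<le> C1 * lam powr (- 1 / 8) * a * B"
    using high_frequency_decay[OF G Cd] unfolding V_def by blast
  define c where "c = min 1 \<kappa> / 16"
  have c: "c > 0" "c \<le> 1 / 16" "c \<le> \<kappa> / 16" using \<kappa> by (auto simp: c_def)
  define C where "C = c0 * C1 + W1"
  have C: "C > 0" using c0 C1 W1 by (simp add: C_def add_pos_pos)
  have key: "cmod (trilinear (\<lambda>p. Ks p + Kb p) f g h) \<le> C * lam powr (- c) * A * a * B"
    if lam: "1 \<le> lam" and A: "0 \<le> A"
      and Ks[measurable]: "Ks \<in> borel_measurable borel" and Ksb: "\<And>p. cmod (Ks p) \<le> c0 * (A * lam powr (1/16))"
      and Kss: "\<And>p. norm p > 2 \<Longrightarrow> Ks p = 0"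
      and Ksd: "\<And>\<zeta>. \<zeta> \<noteq> 0 \<Longrightarrow> cmod (fourier Ks \<zeta>) \<le> C0 * (A * lam powr (1/16)) / sqrt (norm \<zeta>)"
      and Kb[measurable]: "Kb \<in> borel_measurable borel"
      and KbL: "(\<integral>\<^sup>+p. ennreal (cmod (Kb p)) \<partial>lborel) \<le> ennreal (W1 * (A * (lam powr (1/16)) powr (- \<kappa>)))"
      and f: "l2_le f a" and supp: "fourier_support f \<subseteq> {\<xi>. lam \<le> norm \<xi>}" and gh: "l2_pair g h B"
    for Ks Kb :: "'a \<times> 'a \<Rightarrow> complex" and lam A f a g h B
  proof -
    have lam0: "0 < lam" using lam by simp
    have l: "l2_le (\<lambda>x. g (x - 0) * h x) B" using gh unfolding l2_pair_def by blast
    have a0: "0 \<le> a" "0 \<le> B" using l2_le_nonneg[OF f] l2_le_nonneg[OF l] by auto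
    define M where "M = A * lam powr (1/16)"
    have M: "0 \<le> M" using A by (simp add: M_def)
    have Ksi: "integrable lborel Ks" using bounded_support_l2(1)[of Ks "c0 * M" 2] Ksb Kss by (auto simp: M_def)
    have KsL: "(\<integral>\<^sup>+p. ennreal (cmod (Ks p)) \<partial>lborel) \<le> ennreal (\<integral>p. cmod (Ks p) \<partial>lborel)"
      using Ksi by (simp add: nn_integral_eq_integral)
    have Ks0: "0 \<le> (\<integral>p. cmod (Ks p) \<partial>lborel)" by (rule integral_nonneg_AE) simp
    have W0: "0 \<le> W1 * (A * (lam powr (1/16)) powr (- \<kappa>))" using W1 A by simp
    have split: "trilinear (\<lambda>p. Ks p + Kb p) f g h = trilinear Ks f g h + trilinear Kb f g h"
      by (rule trilinear_add_kernel[OF Ks Kb KsL Ks0 KbL W0 f gh])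
    have big: "cmod (trilinear Kb f g h) \<le> W1 * lam powr (- c) * A * (a * B)"
    proof -
      have "cmod (trilinear Kb f g h) \<le> W1 * (A * (lam powr (1/16)) powr (- \<kappa>)) * a * B"
        by (rule trilinear_bound[OF Kb KbL W0 f gh])
      also have "\<dots> = W1 * (A * lam powr (- \<kappa> / 16)) * (a * B)" by (simp add: powr_powr mult.assoc)
      also have "\<dots> \<le> W1 * (A * lam powr (- c)) * (a * B)"
        using lam c a0 A W1 by (intro mult_right_mono mult_left_mono powr_mono mult_nonneg_nonneg) auto
      finally show ?thesis by (simp add: ac_simps)
    qed
    have small: "cmod (trilinear Ks f g h) \<le> c0 * C1 * lam powr (- c) * A * (a * B)"
    proof (cases "M = 0")
      case True
      then have "Ks p = 0" for p using Ksb[of p] by (simp add: M_def[symmetric])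
      then have "trilinear Ks f g h = 0" unfolding trilinear_def by simp
      then show ?thesis using c0 C1 A a0 by simp
    next
      case False
      then have M0: "M > 0" using M by simp
      define K where "K p = of_real (1 / (c0 * M)) * Ks p" for p
      have uk: "unit_kernel K V"
      proof
        show "K \<in> borel_measurable borel" unfolding K_def[abs_def] by measurable
        fix p
        show "cmod (K p) \<le> 1"
          using Ksb[of p] c0 M0 by (simp add: K_def norm_mult norm_divide M_def[symmetric] divide_le_eq)
        show "norm p > 2 \<Longrightarrow> K p = 0" by (simp add: K_def Kss)
      qed (simp add: V_def)
      have dK: "cmod (fourier K \<zeta>) \<le> Cd / sqrt (norm \<zeta>)" if "\<zeta> \<noteq> 0" for \<zeta>
      proof -
        have "cmod (fourier K \<zeta>) = 1 / (c0 * M) * cmod (fourier Ks \<zeta>)"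
          unfolding K_def[abs_def] fourier_cmult norm_mult norm_of_real using c0 M0 by simp
        also have "\<dots> \<le> 1 / (c0 * M) * (C0 * M / sqrt (norm \<zeta>))"
          using Ksd[OF that] c0 M0 by (intro mult_left_mono) (auto simp: M_def)
        also have "\<dots> = Cd / sqrt (norm \<zeta>)" using M0 c0 by (simp add: Cd_def)
        finally show ?thesis .
      qed
      have "Ks = (\<lambda>p. of_real (c0 * M) * K p)" using c0 M0 by (auto simp: K_def fun_eq_iff)
      then have "trilinear Ks f g h = of_real (c0 * M) * trilinear K f g h"
        using trilinear_cmult_kernel[of "of_real (c0 * M)" K f g h] by simp
      then have "cmod (trilinear Ks f g h) = c0 * M * cmod (trilinear K f g h)"
        using c0 M0 by (simp add: norm_mult)
      also have "\<dots> \<le> c0 * M * (C1 * lam powr (- 1 / 8) * a * B)"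
        using c0 M0 by (intro mult_left_mono high[OF uk dK lam f supp gh]) auto
      also have "\<dots> = c0 * C1 * (lam powr (1/16) * lam powr (- 1 / 8)) * A * (a * B)"
        by (simp add: M_def)
      also have "lam powr (1/16) * lam powr (- 1 / 8) = lam powr (- 1 / 16)" by (simp flip: powr_add)
      also have "c0 * C1 * lam powr (- 1 / 16) * A * (a * B) \<le> c0 * C1 * lam powr (- c) * A * (a * B)"
        using lam c c0 C1 A a0 by (intro mult_right_mono mult_left_mono powr_mono mult_nonneg_nonneg) auto
      finally show ?thesis .
    qed
    have "cmod (trilinear (\<lambda>p. Ks p + Kb p) f g h) \<le> cmod (trilinear Ks f g h) + cmod (trilinear Kb f g h)"
      unfolding split by (rule norm_triangle_ineq)
    also have "\<dots> \<le> c0 * C1 * lam powr (- c) * A * (a * B) + W1 * lam powr (- c) * A * (a * B)"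
      by (rule add_mono[OF small big])
    also have "\<dots> = C * lam powr (- c) * A * a * B" by (simp add: C_def algebra_simps)
    finally show ?thesis .
  qed
  have "cmod (trilinear (K0 \<beta> \<Omega>) f g h) \<le> C * lam powr (- c) * Lp_norm q sphere_measure \<Omega> * a * B \<and>
    cmod (trilinear (K0 \<beta> \<Omega>) g f h) \<le> C * lam powr (- c) * Lp_norm q sphere_measure \<Omega> * a * B"
    if lam: "1 \<le> lam" and \<Omega>: "\<Omega> \<in> Lp_space q (sphere_measure :: ('a \<times> 'a) measure)"
      and f: "l2_le f a" and supp: "fourier_support f \<subseteq> {\<xi>. lam \<le> norm \<xi>}" and gh: "l2_pair g h B"
    for lam \<Omega> f a g h B
  proof -
    define A where "A = Lp_norm q sphere_measure \<Omega>"
    have A: "0 \<le> A" using Lp_space_D(3)[OF \<Omega>] by (simp add: A_def)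
    define L where "L = lam powr (1/16)"
    have L: "1 \<le> L" using lam by (simp add: L_def ge_one_powr_ge_zero)
    have [measurable]: "\<Omega> \<in> borel_measurable sphere_measure" by (rule Lp_space_D(1)[OF \<Omega>])
    define \<Omega>s where "\<Omega>s \<theta> = (if cmod (\<Omega> \<theta>) \<le> A * L then \<Omega> \<theta> else 0)" for \<theta>
    define \<Omega>b where "\<Omega>b \<theta> = (if cmod (\<Omega> \<theta>) \<le> A * L then 0 else \<Omega> \<theta>)" for \<theta>
    have ms: "\<Omega>s \<in> borel_measurable sphere_measure" and mb: "\<Omega>b \<in> borel_measurable sphere_measure"
      unfolding \<Omega>s_def[abs_def] \<Omega>b_def[abs_def] by measurable
    define Ks where "Ks = hom_kernel \<beta> \<Omega>s"
    define Kb where "Kb = hom_kernel \<beta> \<Omega>b"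
    have K: "K0 \<beta> \<Omega> = (\<lambda>p. Ks p + Kb p)"
      by (auto simp: fun_eq_iff K0_eq Ks_def Kb_def hom_kernel_def \<Omega>s_def \<Omega>b_def)
    have Ks[measurable]: "Ks \<in> borel_measurable borel" and Kb[measurable]: "Kb \<in> borel_measurable borel"
      unfolding Ks_def Kb_def by (intro hom_kernel_measurable[OF \<beta>] measurable_sphere_lift ms mb)+
    have \<Omega>sb: "cmod (\<Omega>s \<theta>) \<le> A * L" for \<theta> using A L by (simp add: \<Omega>s_def)
    have Ksb: "cmod (Ks p) \<le> c0 * (A * L)" for p
    proof -
      have "cmod (Ks p) \<le> c0 * cmod (\<Omega>s (p /\<^sub>R norm p))" unfolding Ks_def c0_def by (rule hom_kernel_bound(1)[OF \<beta> B0(2)])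
      also have "\<dots> \<le> c0 * (A * L)" using c0 by (intro mult_left_mono \<Omega>sb) auto
      finally show ?thesis .
    qed
    have Kss: "norm p > 2 \<Longrightarrow> Ks p = 0" for p unfolding Ks_def by (rule hom_kernel_bound(2)[OF \<beta> B0(2)]) simp
    have Ksd: "cmod (fourier Ks \<zeta>) \<le> C0 * (A * L) / sqrt (norm \<zeta>)" if "\<zeta> \<noteq> 0" for \<zeta>
      unfolding Ks_def by (rule dec[OF measurable_sphere_lift[OF ms] \<Omega>sb that])
    have KbL: "(\<integral>\<^sup>+p. ennreal (cmod (Kb p)) \<partial>lborel) \<le> ennreal (W1 * (A * L powr (- \<kappa>)))"
    proof -
      have "(\<integral>\<^sup>+p. ennreal (cmod (Kb p)) \<partial>lborel) \<le> ennreal W1 * (\<integral>\<^sup>+\<theta>. ennreal (cmod (\<Omega>b \<theta>)) \<partial>sphere_measure)"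
        unfolding Kb_def W1_def by (rule hom_kernel_L1[OF \<beta> B0(2) mb])
      also have "\<dots> \<le> ennreal W1 * ennreal (A * L powr (- \<kappa>))"
        unfolding \<Omega>b_def A_def by (intro mult_left_mono tail[OF \<Omega> L]) auto
      also have "\<dots> = ennreal (W1 * (A * L powr (- \<kappa>)))" using W1 A by (intro ennreal_mult[symmetric]) auto
      finally show ?thesis .
    qed
    have 1: "cmod (trilinear (K0 \<beta> \<Omega>) f g h) \<le> C * lam powr (- c) * A * a * B"
      unfolding K by (rule key[OF lam A Ks Ksb[unfolded L_def] Kss Ksd[unfolded L_def] Kb KbL[unfolded L_def] f supp gh])
    let ?s = "\<lambda>(K :: 'a \<times> 'a \<Rightarrow> complex) p. K (snd p, fst p)"
    have nsw: "norm (snd p, fst p) = norm p" for p :: "'a \<times> 'a" by (simp add: norm_prod_def add.commute)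
    have "cmod (trilinear (\<lambda>p. ?s Ks p + ?s Kb p) f g h) \<le> C * lam powr (- c) * A * a * B"
    proof (rule key[OF lam A _ _ _ _ _ _ f supp gh])
      show "?s Ks \<in> borel_measurable borel" "?s Kb \<in> borel_measurable borel" by measurable
      show "cmod (?s Ks p) \<le> c0 * (A * lam powr (1/16))" for p using Ksb[of "(snd p, fst p)"] by (simp add: L_def)
      show "norm p > 2 \<Longrightarrow> ?s Ks p = 0" for p using Kss[of "(snd p, fst p)"] by (simp add: nsw)
      show "cmod (fourier (?s Ks) \<zeta>) \<le> C0 * (A * lam powr (1/16)) / sqrt (norm \<zeta>)" if "\<zeta> \<noteq> 0" for \<zeta>
      proof -
        have "norm (snd \<zeta>, fst \<zeta>) \<noteq> 0" unfolding nsw using that by simp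
        then have "(snd \<zeta>, fst \<zeta>) \<noteq> 0" by (simp only: norm_eq_zero simp_thms)
        from Ksd[OF this] show ?thesis unfolding fourier_swap[OF Ks] nsw L_def .
      qed
      show "(\<integral>\<^sup>+p. ennreal (cmod (?s Kb p)) \<partial>lborel) \<le> ennreal (W1 * (A * (lam powr (1/16)) powr (- \<kappa>)))"
        using nn_integral_lborel_prod_swap[of "\<lambda>p. ennreal (cmod (Kb p))"] KbL by (simp add: L_def)
    qed
    moreover have "trilinear (\<lambda>p. ?s Ks p + ?s Kb p) f g h = trilinear (K0 \<beta> \<Omega>) g f h"
      unfolding K using gh l2_le_measurable[OF f]
      by (intro trilinear_swap[of "\<lambda>p. Ks p + Kb p"]) (auto simp: l2_pair_def)
    ultimately show ?thesis using 1 by (simp add: A_def)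
  qed
  with c(1) C show ?thesis by blast
qed

lemma permutation_123:
  fixes l1 l2 l3 :: nat
  assumes l: "{l1, l2, l3} = {1, 2, 3}"
  shows "l1 = 1 \<and> l2 = 2 \<and> l3 = 3 \<or> l1 = 1 \<and> l2 = 3 \<and> l3 = 2 \<or> l1 = 2 \<and> l2 = 1 \<and> l3 = 3 \<or>
    l1 = 2 \<and> l2 = 3 \<and> l3 = 1 \<or> l1 = 3 \<and> l2 = 1 \<and> l3 = 2 \<or> l1 = 3 \<and> l2 = 2 \<and> l3 = 1"
proof -
  have "l1 = 1 \<or> l1 = 2 \<or> l1 = 3" "l2 = 1 \<or> l2 = 2 \<or> l2 = 3" "l3 = 1 \<or> l3 = 2 \<or> l3 = 3" using l by blast+
  moreover have "1 \<in> {l1, l2, l3} \<and> 2 \<in> {l1, l2, l3} \<and> 3 \<in> {l1, l2, l3}" unfolding l by simp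
  ultimately show ?thesis by (elim disjE) simp_all
qed

theorem theorem1p2:
  fixes \<beta> :: "real \<Rightarrow> complex" and q :: ennreal
  assumes "\<beta> \<in> test_functions" and "fun_support \<beta> \<subseteq> {1/2<..<2}"
    and "1 < q"
  shows "\<exists>c::real. \<exists>C::real. c > 0 \<and> C > 0 \<and>
    (\<forall>lam::real. lam \<ge> 1 \<longrightarrow>
      (\<forall>\<Omega> \<in> Lp_space q (sphere_measure :: ((real^'n) \<times> (real^'n)) measure).
       \<forall>(f :: nat \<Rightarrow> real^'n \<Rightarrow> complex) l1 l2 l3.
         {l1, l2, l3} = {1, 2, 3} \<longrightarrow>
         f l1 \<in> Lp_space 2 lborel \<longrightarrow> f l2 \<in> Lp_space 2 lborel \<longrightarrow> f l3 \<in> Lp_space \<infinity> lborel \<longrightarrow>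
         fourier_support (f l1) \<union> fourier_support (f l2) \<subseteq> {\<xi>. lam \<le> norm \<xi> \<and> norm \<xi> \<le> 2 * lam} \<longrightarrow>
         fourier_support (f l3) \<subseteq> {\<xi>. norm \<xi> \<le> 2 * lam} \<longrightarrow>
         norm (L2_pairing (T0 \<beta> \<Omega> (f 1) (f 2)) (f 3))
           \<le> C * lam powr (- c) * Lp_norm q sphere_measure \<Omega>
               * Lp_norm 2 lborel (f l1) * Lp_norm 2 lborel (f l2) * Lp_norm \<infinity> lborel (f l3)))"
proof (cases "\<exists>t. \<beta> t \<noteq> 0")
  case False
  then have "T0 \<beta> \<Omega> f1 f2 = (\<lambda>x. 0)" for \<Omega> :: "(real^'n) \<times> (real^'n) \<Rightarrow> complex" and f1 f2
    by (simp add: T0_def[abs_def] K0_def case_prod_unfold)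
  then have "norm (L2_pairing (T0 \<beta> \<Omega> f1 f2) f3) = 0"
    for \<Omega> :: "(real^'n) \<times> (real^'n) \<Rightarrow> complex" and f1 f2 f3
    by (simp add: L2_pairing_def)
  then show ?thesis
    by (intro exI[of _ 1]) (auto simp: Lp_norm_def)
next
  case True
  then obtain t0 where t0: "\<beta> t0 \<noteq> 0" by blast
  obtain c C where c: "c > 0" and C: "C > 0" and bound: "\<forall>lam\<ge>1.
      \<forall>\<Omega>\<in>Lp_space q (sphere_measure :: ((real^'n) \<times> (real^'n)) measure). \<forall>f a g h B.
      l2_le f a \<longrightarrow> fourier_support f \<subseteq> {\<xi>. lam \<le> norm \<xi>} \<longrightarrow> l2_pair g h B \<longrightarrow>
      cmod (trilinear (K0 \<beta> \<Omega>) f g h) \<le> C * lam powr (- c) * Lp_norm q sphere_measure \<Omega> * a * B \<and>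
      cmod (trilinear (K0 \<beta> \<Omega>) g f h) \<le> C * lam powr (- c) * Lp_norm q sphere_measure \<Omega> * a * B"
    using rough_trilinear_bound[OF assms(1,2) t0 assms(3), where 'a = "real^'n"] by (elim exE conjE)
  note main = bound[rule_format]
  show ?thesis
  proof (rule exI[of _ c], rule exI[of _ C], intro conjI c C allI ballI impI)
    fix lam :: real and \<Omega> :: "(real^'n) \<times> (real^'n) \<Rightarrow> complex" and f :: "nat \<Rightarrow> real^'n \<Rightarrow> complex" and l1 l2 l3 :: nat
    assume lam: "lam \<ge> 1" and \<Omega>: "\<Omega> \<in> Lp_space q sphere_measure" and l: "{l1, l2, l3} = {1, 2, 3}"
      and f1: "f l1 \<in> Lp_space 2 lborel" and f2: "f l2 \<in> Lp_space 2 lborel" and f3: "f l3 \<in> Lp_space \<infinity> lborel"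
      and supp: "fourier_support (f l1) \<union> fourier_support (f l2) \<subseteq> {\<xi>. lam \<le> norm \<xi> \<and> norm \<xi> \<le> 2 * lam}"
    let ?N1 = "Lp_norm 2 lborel (f l1)" and ?N2 = "Lp_norm 2 lborel (f l2)" and ?N3 = "Lp_norm \<infinity> lborel (f l3)"
    let ?X = "C * lam powr (- c) * Lp_norm q sphere_measure \<Omega>"
    have T: "L2_pairing (T0 \<beta> \<Omega> (f 1) (f 2)) (f 3) = trilinear (K0 \<beta> \<Omega>) (f 1) (f 2) (f 3)"
      unfolding trilinear_eq by (simp add: T0_def[abs_def] bilinear_op_def[abs_def])
    have L1: "l2_le (f l1) ?N1" and L2: "l2_le (f l2) ?N2" using f1 f2 by (auto intro: Lp_2_l2_le)
    have s1: "fourier_support (f l1) \<subseteq> {\<xi>. lam \<le> norm \<xi>}" and s2: "fourier_support (f l2) \<subseteq> {\<xi>. lam \<le> norm \<xi>}"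
      using supp by auto
    have m3: "f l3 \<in> borel_measurable borel" using Lp_space_D(1)[OF f3] by simp
    note p1 = l2_pair_bounded[OF L1 m3 Lp_norm_top_AE[OF f3] Lp_space_D(3)[OF f3]]
    note p2 = l2_pair_bounded[OF L2 m3 Lp_norm_top_AE[OF f3] Lp_space_D(3)[OF f3]]
    note b1 = main[OF lam \<Omega> L1 s1 p2(1)] main[OF lam \<Omega> L1 s1 p2(2)]
    note b2 = main[OF lam \<Omega> L2 s2 p1(1)] main[OF lam \<Omega> L2 s2 p1(2)]
    let ?t = "cmod (trilinear (K0 \<beta> \<Omega>) (f 1) (f 2) (f 3))"
    from permutation_123[OF l] have "?t \<le> ?X * ?N1 * (?N2 * ?N3) \<or> ?t \<le> ?X * ?N2 * (?N1 * ?N3)"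
    proof (elim disjE conjE)
      assume "l1 = 1" "l2 = 2" "l3 = 3"
      with conjunct1[OF b1(1)] show ?thesis by simp
    next
      assume "l1 = 1" "l2 = 3" "l3 = 2"
      with conjunct1[OF b1(2)] show ?thesis by simp
    next
      assume "l1 = 2" "l2 = 1" "l3 = 3"
      with conjunct1[OF b2(1)] show ?thesis by simp
    next
      assume "l1 = 2" "l2 = 3" "l3 = 1"
      with conjunct2[OF b1(2)] show ?thesis by simp
    next
      assume "l1 = 3" "l2 = 1" "l3 = 2"
      with conjunct1[OF b2(2)] show ?thesis by simp
    next
      assume "l1 = 3" "l2 = 2" "l3 = 1"
      with conjunct2[OF b2(2)] show ?thesis by simp
    qed
    then show "norm (L2_pairing (T0 \<beta> \<Omega> (f 1) (f 2)) (f 3)) \<le> ?X * ?N1 * ?N2 * ?N3"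
      unfolding T by (simp only: ac_simps disj_absorb)
  qed
qed

end
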